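(* Suppose $\tilde{\varepsilon}=\gamma\varepsilon$ for some constant $\gamma>0$. Then for any $\alpha>0$ and any $B>0$, \[ \lim_{\varepsilon\rightarrow 0}\left[\sup_{\theta\in\Theta_{\mathrm{Sobolev}}(\alpha,B)} R\left(\theta,Q_{h^{(d(\varepsilon))}_{\mathcal{B}^{*}_{\varepsilon}}}\right) \bigg/\inf_{\widehat{Q}\in\mathcal{D}}\sup_{\theta\in\Theta_{\mathrm{Sobolev}}(\alpha,B)}R(\theta,\widehat{Q})\right]=1. \]
   Context: Model: for $\theta\in l_2$, $P_{\theta}=\bigotimes_{i\ge1}\mathcal{N}(\theta_{i},\varepsilon^{2})$ (observation $X$) and $Q_{\theta}=\bigotimes_{i\ge1}\mathcal{N}(\theta_{i},\tilde{\varepsilon}^{2})$ (future observation $Y$) on $\mathbb{R}^\infty$ with product Borel $\sigma$-field. $\mathcal D$ is the set of all maps $x\mapsto\widehat Q(\cdot;x)$ from $\mathbb{R}^\infty$ to probability measures on $\mathbb{R}^\infty$; risk $R(\theta,\widehat Q)=\int l(\theta,\widehat Q(\cdot;x))\,\mathrm dP_\theta(x)$ with $l(\theta,Q)=\int\log\frac{\mathrm dQ_\theta}{\mathrm dQ}\,\mathrm dQ_\theta$ if $Q_\theta\ll Q$, else $\infty$. Sobolev ellipsoid: $\Theta_{\mathrm{Sobolev}}(\alpha,B)=\{\theta\in l_{2}:\sum_{i\ge1}i^{2\alpha}\theta^{2}_{i} \leq B \}$. Blockwise Stein predictive distribution: for a positive integer $d$ and a partition $\mathcal B(d)=\{B_j\}_{j=1}^J$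 of $\{1,\dots,d\}$ into consecutive blocks $B_1,\dots,B_J$ (in order) of cardinalities $b_j$, write $\theta_{B_j}$ for the corresponding subvector of $\theta^{(d)}=(\theta_1,\dots,\theta_d)$. The blockwise Stein prior is the (improper) density $h^{(d)}_{\mathcal{B}(d)}(\theta^{(d)})=\prod_{j: b_{j}>2}\|\theta_{B_{j}}\|^{2-b_{j}}$ on $\mathbb{R}^d$ ($\|\cdot\|$ the Euclidean norm), with posterior density $h^{(d)}_{\mathcal{B}(d)}(\theta^{(d)}|x^{(d)})\propto h^{(d)}_{\mathcal{B}(d)}(\theta^{(d)})\prod_{i=1}^d \exp(-(x_i-\theta_i)^2/(2\varepsilon^2))$ given $x^{(d)}=(x_1,\dots,x_d)$. The blockwise Stein predictive distribution is $Q_{h^{(d)}_{\mathcal{B}(d)}}(\cdot|X)=\Big(\int \bigotimes_{i=1}^{d}\mathcal{N}(\theta_{i},\tilde{\varepsilon}^{2})\, h^{(d)}_{\mathcal{B}(d)}(\theta^{(d)}|X^{(d)})\,\mathrm{d}\theta^{(d)}\Big)\otimes\bigotimes_{i=d+1}^{\infty}\mathcal{N}(0,\tilde{\varepsilon}^{2})$. Weakly geometric blocks (WGB) system: $d(\varepsilon)=\lfloor 1/\varepsilon^2\rfloor$, $\rho_{\varepsilon}=(\log(1/\varepsilon))^{-1}$, $b^{*}_{\varepsilon,1}=\lceil \rho_{\varepsilon}^{-1}\rceil$, $b^{*}_{\varepsilon,j}=\lfloor b^{*}_{\varepsilon,1}(1+\rho_{\varepsilon})^{j-1}\rfloor$ for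 $2\le j\le J(\varepsilon)-1$, $b^{*}_{\varepsilon,J(\varepsilon)}=d(\varepsilon)-\sum_{j=1}^{J(\varepsilon)-1}b^{*}_{\varepsilon,j}$, where $J(\varepsilon)=\min\{m: b^{*}_{\varepsilon,1}+\sum_{j=2}^{m}\lfloor b^{*}_{\varepsilon,1}(1+\rho_{\varepsilon})^{j-1}\rfloor\geq d(\varepsilon)\}$; $\mathcal{B}^*_\varepsilon$ is the partition of $\{1,\dots,d(\varepsilon)\}$ into consecutive blocks with these cardinalities. $Q_{h^{(d(\varepsilon))}_{\mathcal{B}^{*}_{\varepsilon}}}$ is the blockwise Stein predictive distribution with $d=d(\varepsilon)$ and $\mathcal B(d)=\mathcal B^*_\varepsilon$. *)

theory Defs
  imports "HOL-Probability.Probability"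
begin

text \<open>Sequences in R^infinity are functions nat => real; paper index i >= 1 corresponds to
  Isabelle index i - 1 (i.e. coordinate 0 is the paper's first coordinate).\<close>

type_synonym rseq = "nat \<Rightarrow> real"

definition Rinf :: "rseq measure" where
  "Rinf = PiM UNIV (\<lambda>_. borel)"

definition gauss :: "real \<Rightarrow> real \<Rightarrow> real measure" where
  "gauss m s = density lborel (normal_density m s)"

definition gauss_seq :: "rseq \<Rightarrow> real \<Rightarrow> rseq measure" where
  "gauss_seq \<theta> s = PiM UNIV (\<lambda>i. gauss (\<theta> i) s)"

text \<open>Kullback-Leibler loss l(theta, Q) = int log (dQ_theta/dQ) dQ_theta if Q_theta << Q,
  infinity otherwise. The integral is taken as (positive part) - (negative part);
  the negative part is always finite and the result is nonnegative.\<close>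
definition KL_loss :: "rseq measure \<Rightarrow> rseq measure \<Rightarrow> ennreal" where
  "KL_loss Q\<theta> Q =
     (if absolutely_continuous Q Q\<theta> then
        (\<integral>\<^sup>+ y. ennreal (max 0 (ln (enn2real (RN_deriv Q Q\<theta> y)))) \<partial>Q\<theta>)
        - (\<integral>\<^sup>+ y. ennreal (max 0 (- ln (enn2real (RN_deriv Q Q\<theta> y)))) \<partial>Q\<theta>)
      else \<infinity>)"

definition risk :: "real \<Rightarrow> real \<Rightarrow> rseq \<Rightarrow> (rseq \<Rightarrow> rseq measure) \<Rightarrow> ennreal" where
  "risk \<epsilon> \<epsilon>' \<theta> Qh = (\<integral>\<^sup>+ x. KL_loss (gauss_seq \<theta> \<epsilon>') (Qh x) \<partial>(gauss_seq \<theta> \<epsilon>))"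

definition pred_rules :: "(rseq \<Rightarrow> rseq measure) set" where
  "pred_rules = measurable Rinf (prob_algebra Rinf)"

text \<open>Sobolev ellipsoid (paper's index i corresponds to Suc i here).\<close>
definition sobolev :: "real \<Rightarrow> real \<Rightarrow> rseq set" where
  "sobolev \<alpha> B = {\<theta>. summable (\<lambda>i. (\<theta> i)\<^sup>2)
      \<and> summable (\<lambda>i. real (Suc i) powr (2 * \<alpha>) * (\<theta> i)\<^sup>2)
      \<and> (\<Sum>i. real (Suc i) powr (2 * \<alpha>) * (\<theta> i)\<^sup>2) \<le> B}"

text \<open>A partition of the first d coordinates into consecutive blocks is given by the list
  of block sizes bs (summing to d); block j (0-based) is the following index set.\<close>
definition block :: "nat list \<Rightarrow> nat \<Rightarrow> nat set" where
  "block bs j = {sum_list (take j bs) ..< sum_list (take (Suc j) bs)}"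

definition stein_prior :: "nat list \<Rightarrow> rseq \<Rightarrow> real" where
  "stein_prior bs \<theta> =
     (\<Prod>j\<in>{j. j < length bs \<and> bs ! j > 2}.
        (sqrt (\<Sum>i\<in>block bs j. (\<theta> i)\<^sup>2)) powr (2 - real (bs ! j)))"

definition Rd :: "nat \<Rightarrow> rseq measure" where
  "Rd d = PiM {..<d} (\<lambda>_. lborel)"

definition stein_posterior :: "nat \<Rightarrow> nat list \<Rightarrow> real \<Rightarrow> rseq \<Rightarrow> rseq measure" where
  "stein_posterior d bs \<epsilon> x =
     (let w = (\<lambda>\<theta>. ennreal (stein_prior bs \<theta> * (\<Prod>i<d. normal_density (\<theta> i) \<epsilon> (x i))))
      in density (Rd d) (\<lambda>\<theta>. w \<theta> / (\<integral>\<^sup>+ t. w t \<partial>Rd d)))"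

definition stein_pred :: "nat \<Rightarrow> nat list \<Rightarrow> real \<Rightarrow> real \<Rightarrow> rseq \<Rightarrow> rseq measure" where
  "stein_pred d bs \<epsilon> \<epsilon>' x =
     distr (bind (stein_posterior d bs \<epsilon> x) (\<lambda>\<theta>. PiM {..<d} (\<lambda>i. gauss (\<theta> i) \<epsilon>'))
              \<Otimes>\<^sub>M PiM {d..} (\<lambda>_. gauss 0 \<epsilon>'))
           Rinf (merge {..<d} {d..})"

definition wgb_d :: "real \<Rightarrow> nat" where
  "wgb_d \<epsilon> = nat \<lfloor>1 / \<epsilon>\<^sup>2\<rfloor>"

definition wgb_rho :: "real \<Rightarrow> real" where
  "wgb_rho \<epsilon> = 1 / ln (1 / \<epsilon>)"

definition wgb_b1 :: "real \<Rightarrow> nat" where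
  "wgb_b1 \<epsilon> = nat \<lceil>1 / wgb_rho \<epsilon>\<rceil>"

definition wgb_raw :: "real \<Rightarrow> nat \<Rightarrow> nat" where
  "wgb_raw \<epsilon> j = (if j = 1 then wgb_b1 \<epsilon>
       else nat \<lfloor>real (wgb_b1 \<epsilon>) * (1 + wgb_rho \<epsilon>) ^ (j - 1)\<rfloor>)"

definition wgb_J :: "real \<Rightarrow> nat" where
  "wgb_J \<epsilon> = (LEAST m. m \<ge> 1 \<and> (\<Sum>j=1..m. wgb_raw \<epsilon> j) \<ge> wgb_d \<epsilon>)"

definition wgb_blocks :: "real \<Rightarrow> nat list" where
  "wgb_blocks \<epsilon> =
     map (wgb_raw \<epsilon>) [1..<wgb_J \<epsilon>]
     @ [wgb_d \<epsilon> - (\<Sum>j=1..wgb_J \<epsilon> - 1. wgb_raw \<epsilon> j)]"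

end

theory Submission
  imports Defs
begin

text \<open>
  Lower bound: the Bayes risk of the Gaussian prior \<open>N(0, \<tau> i)\<close>, whose variances lie slightly inside the
  ellipsoid, is computed coordinatewise. A linearised Donsker--Varadhan inequality, applied with the
  log-density of the Gaussian predictive distribution, transfers it to an arbitrary competitor, and a
  quadratic penalty pays for the parameters outside the ellipsoid.

  Upper bound: in a block of size \<open>b > 2\<close> the Stein prior is a mixture over \<open>t\<close> of the priors \<open>N(0, t I)\<close>,
  so up to a logarithmic term its risk is at most that of the best \<open>t\<close>, namely the concave oracle
  risk \<open>b * phi v u (R / b)\<close> at block energy \<open>R\<close>. Since all but few of the weakly geometric blocks are
  thin, the block averages of \<open>\<theta>\<^sup>2\<close> are nearly in the ellipsoid, and the Gaussian prior with these
  variances yields the lower bound at (almost) the same value. The errors of the polylogarithmically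
  many blocks are negligible because the minimax risk grows like a power of \<open>1 / \<epsilon>\<close>.
\<close>

section \<open>Kullback--Leibler loss\<close>

text \<open>Measurability of the loss in \<open>x\<close> and of the risk in \<theta> is avoided. On
  the lower side only explicit measurable minorants are integrated, and the supremum over the
  ellipsoid enters as a constant; on the upper side the loss at each \<open>x\<close> is bounded by
  a polynomial of degree four in \<open>x\<close>, whose Gaussian mean is explicit. As \<theta> may
  have infinitely many nonzero coordinates, its law has an infinite product as density relative to
  centred noise. A Cameron--Martin argument supplies that density and bounds its entropy; all other
  densities involve finitely many coordinates. Two facts about \<open>phi\<close> join the two
  sides. The risk at \<open>t\<close> of the Bayes rule of N(0, \<tau>) is the tangent of
  \<open>phi\<close> at \<tau>, evaluated at \<open>t^2\<close>, so that its prior average is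
  exactly \<open>phi\<close>. And \<open>phi\<close> is concave with value 0 at 0, so that shrinking
  the variances by a factor costs at most that factor of the risk. The number \<open>K\<close> of
  discarded initial blocks and the slack \<eta> are fixed before \<epsilon> tends to 0.\<close>

lemma nn_integral_density_neg_ln_le:
  fixes f :: "'a \<Rightarrow> real"
  assumes "prob_space Q" and [measurable]: "f \<in> borel_measurable Q" and f0: "\<And>y. 0 \<le> f y"
  shows "(\<integral>\<^sup>+ y. ennreal (- ln (f y)) \<partial>density Q (\<lambda>y. ennreal (f y))) \<le> 1"
proof -
  interpret prob_space Q by fact
  have "f y * (- ln (f y)) \<le> 1" for y
  proof (cases "f y > 0")
    case True
    have "ln (1 / f y) \<le> 1 / f y - 1" using True by (intro ln_le_minus_one) auto
    then have "f y * (- ln (f y)) \<le> f y * (1 / f y - 1)" using True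
      by (intro mult_left_mono) (auto simp: ln_div)
    also have "\<dots> \<le> 1" using True by (simp add: field_simps)
    finally show ?thesis .
  qed (use f0[of y] in auto)
  then have "(\<integral>\<^sup>+ y. ennreal (f y) * ennreal (- ln (f y)) \<partial>Q) \<le> (\<integral>\<^sup>+ y. 1 \<partial>Q)"
    by (intro nn_integral_mono) (metis ennreal_leI ennreal_mult' ennreal_1 f0)
  then show ?thesis by (simp add: nn_integral_density emeasure_space_1)
qed

text \<open>Since \<open>- f * ln f\<close> is at most 1, the negative part of the log density is
  always finite, and a finite positive part already gives integrability. The \<open>ennreal\<close>
  difference in \<open>KL_loss\<close> then is a genuine integral.\<close>

lemma integrable_ln_density:
  fixes f :: "'a \<Rightarrow> real"
  assumes "prob_space Q" and [measurable]: "f \<in> borel_measurable Q" and f0: "\<And>y. 0 \<le> f y"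
    and fin: "(\<integral>\<^sup>+ y. ennreal (ln (f y)) \<partial>density Q (\<lambda>y. ennreal (f y))) < \<infinity>"
  shows "integrable (density Q (\<lambda>y. ennreal (f y))) (\<lambda>y. ln (f y))"
    and "(\<integral>\<^sup>+ y. ennreal (ln (f y)) \<partial>density Q (\<lambda>y. ennreal (f y)))
         - (\<integral>\<^sup>+ y. ennreal (- ln (f y)) \<partial>density Q (\<lambda>y. ennreal (f y)))
       = ennreal (\<integral> y. ln (f y) \<partial>density Q (\<lambda>y. ennreal (f y)))"
proof -
  let ?P = "density Q (\<lambda>y. ennreal (f y))"
  have neg: "(\<integral>\<^sup>+ y. ennreal (- ln (f y)) \<partial>?P) < \<infinity>"
    using nn_integral_density_neg_ln_le[OF assms(1-3)] by (simp add: le_less_trans)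
  show I: "integrable ?P (\<lambda>y. ln (f y))"
    using fin neg by (subst real_integrable_def) auto
  show "(\<integral>\<^sup>+ y. ennreal (ln (f y)) \<partial>?P) - (\<integral>\<^sup>+ y. ennreal (- ln (f y)) \<partial>?P)
       = ennreal (\<integral> y. ln (f y) \<partial>?P)"
    using fin neg by (subst real_lebesgue_integral_def[OF I])
      (simp add: ennreal_minus[symmetric] ennreal_enn2real less_top[symmetric])
qed

text \<open>\<open>RN_deriv\<close> is determined up to \<open>Q\<close>-null sets, which are also
  \<open>P\<close>-null; the maxima with 0 disappear because \<open>ennreal\<close> truncates
  negative reals by itself.\<close>

lemma KL_loss_density:
  fixes f :: "rseq \<Rightarrow> real"
  assumes "prob_space Q" and [measurable]: "f \<in> borel_measurable Q" and f0: "\<And>y. 0 \<le> f y"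
    and P: "P = density Q (\<lambda>y. ennreal (f y))"
  shows "KL_loss P Q = (\<integral>\<^sup>+ y. ennreal (ln (f y)) \<partial>P) - (\<integral>\<^sup>+ y. ennreal (- ln (f y)) \<partial>P)"
proof -
  interpret prob_space Q by fact
  have ac: "absolutely_continuous Q P"
    unfolding P by (rule absolutely_continuousI_density) simp
  have "AE y in Q. ennreal (f y) = RN_deriv Q P y"
    by (rule RN_deriv_unique) (auto simp: P)
  then have ae: "AE y in P. enn2real (RN_deriv Q P y) = f y"
    unfolding P
  proof (subst AE_density)
    assume "AE y in Q. ennreal (f y) = RN_deriv Q (density Q (\<lambda>y. ennreal (f y))) y"
    then show "AE y in Q. 0 < ennreal (f y) \<longrightarrow>
        enn2real (RN_deriv Q (density Q (\<lambda>y. ennreal (f y))) y) = f y"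
      by eventually_elim (metis enn2real_ennreal f0)
  qed simp
  have [simp]: "ennreal (max 0 x) = ennreal x" for x :: real
    by (auto simp: max_def ennreal_neg)
  have "(\<integral>\<^sup>+ y. ennreal (ln (enn2real (RN_deriv Q P y))) \<partial>P) = (\<integral>\<^sup>+ y. ennreal (ln (f y)) \<partial>P)"
    and "(\<integral>\<^sup>+ y. ennreal (- ln (enn2real (RN_deriv Q P y))) \<partial>P) = (\<integral>\<^sup>+ y. ennreal (- ln (f y)) \<partial>P)"
    using ae by (auto intro!: nn_integral_cong_AE)
  then show ?thesis using ac by (simp add: KL_loss_def)
qed

lemma AE_density_pos:
  fixes f :: "'a \<Rightarrow> real"
  assumes [measurable]: "f \<in> borel_measurable Q" and f0: "\<And>y. 0 \<le> f y"
  shows "AE y in density Q (\<lambda>y. ennreal (f y)). 0 < f y"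
  by (subst AE_density) auto

text \<open>An explicit majorant is easier to integrate than the log density. The sign of its mean
  follows from \<open>ln f \<ge> 1 - 1 / f\<close> and the bound 1 on the \<open>P\<close>-mean of
  \<open>1 / f\<close>; it later allows an outer integral of \<open>ennreal\<close> values to be
  read as a Bochner integral.\<close>

lemma KL_loss_le:
  fixes f V :: "rseq \<Rightarrow> real"
  assumes "prob_space Q" and [measurable]: "f \<in> borel_measurable Q" and f0: "\<And>y. 0 \<le> f y"
    and P: "P = density Q (\<lambda>y. ennreal (f y))" and "prob_space P"
    and V: "integrable P V" and le: "AE y in P. ln (f y) \<le> V y"
  shows "0 \<le> (\<integral> y. V y \<partial>P)" and "KL_loss P Q \<le> ennreal (\<integral> y. V y \<partial>P)"
proof -
  interpret Q: prob_space Q by fact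
  interpret P: prob_space P by fact
  have [measurable]: "f \<in> borel_measurable P" by (simp add: P)
  have "(\<integral>\<^sup>+ y. ennreal (ln (f y)) \<partial>P) \<le> (\<integral>\<^sup>+ y. ennreal (norm (V y)) \<partial>P)"
    using le by (intro nn_integral_mono_AE) (auto elim!: eventually_mono intro!: ennreal_leI)
  also have "\<dots> < \<infinity>" using V by (simp add: integrable_iff_bounded)
  finally have fin: "(\<integral>\<^sup>+ y. ennreal (ln (f y)) \<partial>P) < \<infinity>" .
  have I: "integrable P (\<lambda>y. ln (f y))"
    and eq: "KL_loss P Q = ennreal (\<integral> y. ln (f y) \<partial>P)"
    using integrable_ln_density[OF assms(1-3), folded P, OF fin] KL_loss_density[OF assms(1-4)] by auto
  have le2: "(\<integral> y. ln (f y) \<partial>P) \<le> (\<integral> y. V y \<partial>P)"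
    by (rule integral_mono_AE[OF I V le])
  then show "KL_loss P Q \<le> ennreal (\<integral> y. V y \<partial>P)" unfolding eq by (rule ennreal_leI)
  have "(\<integral>\<^sup>+ y. ennreal (1 / f y) \<partial>P) = (\<integral>\<^sup>+ y. ennreal (f y) * ennreal (1 / f y) \<partial>Q)"
    unfolding P by (subst nn_integral_density) auto
  also have "\<dots> \<le> (\<integral>\<^sup>+ y. 1 \<partial>Q)"
    by (intro nn_integral_mono) (auto simp: ennreal_mult'[symmetric] f0)
  finally have n1: "(\<integral>\<^sup>+ y. ennreal (1 / f y) \<partial>P) \<le> 1" by (simp add: Q.emeasure_space_1)
  then have I1: "integrable P (\<lambda>y. 1 / f y)"
    by (subst integrable_iff_bounded) (auto simp: f0 le_less_trans)
  have "ennreal (\<integral> y. 1 / f y \<partial>P) \<le> 1"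
    using n1 by (subst nn_integral_eq_integral[symmetric]) (use I1 in \<open>auto simp: f0\<close>)
  then have "(\<integral> y. 1 / f y \<partial>P) \<le> 1" by simp
  then have "0 \<le> (\<integral> y. 1 - 1 / f y \<partial>P)"
    by (subst Bochner_Integration.integral_diff) (use I1 in \<open>auto simp: P.prob_space\<close>)
  also have "\<dots> \<le> (\<integral> y. ln (f y) \<partial>P)"
  proof (rule integral_mono_AE)
    have "AE y in P. 0 < f y" unfolding P by (rule AE_density_pos) (auto simp: f0)
    then show "AE y in P. 1 - 1 / f y \<le> ln (f y)"
    proof (rule eventually_mono)
      fix y assume "0 < f y"
      then show "1 - 1 / f y \<le> ln (f y)"
        using ln_le_minus_one[of "1 / f y"] by (auto simp: ln_div)
    qed
  qed (use I I1 in auto)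
  finally show "0 \<le> (\<integral> y. V y \<partial>P)" using le2 by simp
qed

lemma ennreal_add_le: "0 \<le> b \<Longrightarrow> ennreal (a + b) \<le> ennreal a + ennreal b"
  by (cases "0 \<le> a") (auto simp: ennreal_neg intro!: ennreal_leI)

text \<open>A linearised Donsker--Varadhan inequality: it follows from
  \<open>ln f \<ge> g + 1 - exp g / f\<close>, and its right-hand side is measurable in \<open>Q\<close> up to the loss itself.\<close>

lemma KL_loss_ge:
  fixes g :: "rseq \<Rightarrow> real"
  assumes "prob_space Q" and "prob_space P" and sets: "sets P = sets Q" and g: "integrable P g"
  shows "ennreal ((\<integral> y. g y \<partial>P) + 1) \<le> KL_loss P Q + (\<integral>\<^sup>+ y. ennreal (exp (g y)) \<partial>Q)"
proof (cases "absolutely_continuous Q P \<and> (\<integral>\<^sup>+ y. ennreal (exp (g y)) \<partial>Q) < \<infinity>")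
  case False
  then show ?thesis by (auto simp: KL_loss_def less_top[symmetric])
next
  case True
  interpret Q: prob_space Q by fact
  interpret P: prob_space P by fact
  note [measurable_cong] = sets
  define f where "f y = enn2real (RN_deriv Q P y)" for y
  have f0: "0 \<le> f y" for y by (simp add: f_def)
  have fm[measurable]: "f \<in> borel_measurable Q" unfolding f_def[abs_def] by measurable
  have [measurable]: "g \<in> borel_measurable Q" using g by (simp cong: measurable_cong_sets)
  have "AE y in Q. RN_deriv Q P y \<noteq> \<infinity>"
    using True sets by (intro Q.RN_deriv_finite) (auto simp: P.sigma_finite_measure_axioms)
  then have "AE y in Q. RN_deriv Q P y = ennreal (f y)"
    by eventually_elim (simp add: f_def ennreal_enn2real less_top)
  then have "density Q (RN_deriv Q P) = density Q (\<lambda>y. ennreal (f y))"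
    by (intro density_cong) auto
  then have P: "P = density Q (\<lambda>y. ennreal (f y))"
    using Q.density_RN_deriv[of P] True sets by simp
  have KL: "KL_loss P Q = (\<integral>\<^sup>+ y. ennreal (ln (f y)) \<partial>P) - (\<integral>\<^sup>+ y. ennreal (- ln (f y)) \<partial>P)"
    by (rule KL_loss_density[OF assms(1) fm f0 P])
  show ?thesis
  proof (cases "(\<integral>\<^sup>+ y. ennreal (ln (f y)) \<partial>P) < \<infinity>")
    case False
    have "(\<integral>\<^sup>+ y. ennreal (- ln (f y)) \<partial>P) \<le> 1"
      using nn_integral_density_neg_ln_le[OF assms(1) fm f0] P by simp
    then have "(\<integral>\<^sup>+ y. ennreal (- ln (f y)) \<partial>P) \<noteq> \<top>" by (auto simp: top_unique)
    then have "KL_loss P Q = \<infinity>" using False unfolding KL by (auto simp: less_top[symmetric])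
    then show ?thesis by simp
  next
    case fin: True
    have I: "integrable P (\<lambda>y. ln (f y))"
      and eq: "KL_loss P Q = ennreal (\<integral> y. ln (f y) \<partial>P)"
      using integrable_ln_density[OF assms(1) fm f0, folded P, OF fin] KL by auto
    let ?W = "\<integral>\<^sup>+ y. ennreal (exp (g y)) \<partial>Q"
    have "(\<integral>\<^sup>+ y. ennreal (exp (g y) / f y) \<partial>P) = (\<integral>\<^sup>+ y. ennreal (f y) * ennreal (exp (g y) / f y) \<partial>Q)"
      by (subst P, subst nn_integral_density) auto
    \<comment> \<open>Where \<open>f\<close> vanishes the quotient is 0 by the convention for
      division, so the change of measure is only an inequality.\<close>
    also have "\<dots> \<le> ?W"
    proof (intro nn_integral_mono)
      show "ennreal (f y) * ennreal (exp (g y) / f y) \<le> ennreal (exp (g y))" for y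
        using f0[of y] by (cases "f y = 0") (auto simp: ennreal_mult'[symmetric])
    qed
    finally have n1: "(\<integral>\<^sup>+ y. ennreal (exp (g y) / f y) \<partial>P) \<le> ?W" .
    then have I1: "integrable P (\<lambda>y. exp (g y) / f y)"
      using True by (subst integrable_iff_bounded) (auto simp: f0 le_less_trans)
    have n2: "ennreal (\<integral> y. exp (g y) / f y \<partial>P) \<le> ?W"
      using n1 by (subst nn_integral_eq_integral[symmetric]) (use I1 in \<open>auto simp: f0\<close>)
    have "(\<integral> y. g y + 1 - exp (g y) / f y \<partial>P) \<le> (\<integral> y. ln (f y) \<partial>P)"
    proof (rule integral_mono_AE)
      have "AE y in P. 0 < f y" unfolding P by (rule AE_density_pos) (auto simp: f0)
      then show "AE y in P. g y + 1 - exp (g y) / f y \<le> ln (f y)"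
      proof (rule eventually_mono)
        fix y assume "0 < f y"
        then show "g y + 1 - exp (g y) / f y \<le> ln (f y)"
          using ln_le_minus_one[of "exp (g y) / f y"] by (auto simp: ln_div)
      qed
    qed (use I I1 g in auto)
    then have "(\<integral> y. g y \<partial>P) + 1 \<le> (\<integral> y. ln (f y) \<partial>P) + (\<integral> y. exp (g y) / f y \<partial>P)"
      using I1 g by (simp add: P.prob_space)
    then have "ennreal ((\<integral> y. g y \<partial>P) + 1) \<le> ennreal ((\<integral> y. ln (f y) \<partial>P) + (\<integral> y. exp (g y) / f y \<partial>P))"
      by (rule ennreal_leI)
    also have "\<dots> \<le> ennreal (\<integral> y. ln (f y) \<partial>P) + ennreal (\<integral> y. exp (g y) / f y \<partial>P)"
      by (rule ennreal_add_le) (auto simp: f0)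
    also have "\<dots> \<le> KL_loss P Q + ?W" unfolding eq using n2 by (rule add_left_mono)
    finally show ?thesis .
  qed
qed

section \<open>Products of Gaussian measures\<close>

text \<open>Each coordinate has its own scale, so that the same measure serves as noise (constant
  scale) and as prior (scale \<open>sqrt (\<tau> i)\<close>).\<close>

definition gauss_prod :: "rseq \<Rightarrow> rseq \<Rightarrow> rseq measure" where
  "gauss_prod m s = PiM UNIV (\<lambda>i. gauss (m i) (s i))"

lemma gauss_seq_eq: "gauss_seq \<theta> s = gauss_prod \<theta> (\<lambda>_. s)"
  by (simp add: gauss_seq_def gauss_prod_def)

lemma sets_gauss [simp, measurable_cong]: "sets (gauss m s) = sets borel"
  by (simp add: gauss_def)

lemma space_gauss [simp]: "space (gauss m s) = UNIV"
  by (simp add: gauss_def)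

lemma prob_space_gauss: "0 < s \<Longrightarrow> prob_space (gauss m s)"
  unfolding gauss_def by (rule prob_space_normal_density)

lemma sets_gauss_prod [simp, measurable_cong]: "sets (gauss_prod m s) = sets Rinf"
  unfolding gauss_prod_def Rinf_def by (intro sets_PiM_cong) auto

lemma space_Rinf [simp]: "space Rinf = UNIV"
  by (auto simp: Rinf_def space_PiM)

lemma space_gauss_prod [simp]: "space (gauss_prod m s) = UNIV"
  by (auto simp: gauss_prod_def space_PiM)

lemma measurable_Rinf_component [measurable (raw)]: "(\<lambda>x. x i) \<in> borel_measurable Rinf"
  unfolding Rinf_def by measurable

lemma measurable_Rinf_component' [measurable_dest]:
  assumes "f \<in> N \<rightarrow>\<^sub>M Rinf" and "g \<in> L \<rightarrow>\<^sub>M N"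
  shows "(\<lambda>x. f (g x) i) \<in> borel_measurable L"
  using measurable_compose[OF measurable_compose[OF assms(2,1)] measurable_Rinf_component] .

lemma nn_integral_density_prob:
  assumes "prob_space (density M f)" and [measurable]: "f \<in> borel_measurable M"
  shows "(\<integral>\<^sup>+ x. f x \<partial>M) = 1"
proof -
  have "(\<integral>\<^sup>+ x. f x \<partial>M) = (\<integral>\<^sup>+ x. f x * indicator (space M) x \<partial>M)"
    by (intro nn_integral_cong) auto
  also have "\<dots> = emeasure (density M f) (space M)" by (simp add: emeasure_density)
  finally show ?thesis using prob_space.emeasure_space_1[OF assms(1)] by simp
qed

lemma prob_space_gauss_prod: "(\<And>i. 0 < s i) \<Longrightarrow> prob_space (gauss_prod m s)"
  unfolding gauss_prod_def by (intro prob_space_PiM prob_space_gauss)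

text \<open>The integrand sees only the coordinates in \<open>J\<close>, so the integral reduces to
  the marginal on \<open>J\<close>, a finite product.\<close>

lemma nn_integral_PiM_prod:
  fixes g :: "'i \<Rightarrow> 'a \<Rightarrow> ennreal"
  assumes M: "\<And>i. prob_space (M i)" and J: "finite J"
    and [measurable]: "\<And>i. i \<in> J \<Longrightarrow> g i \<in> borel_measurable (M i)"
  shows "(\<integral>\<^sup>+ x. (\<Prod>i\<in>J. g i (x i)) \<partial>PiM UNIV M) = (\<Prod>i\<in>J. \<integral>\<^sup>+ x. g i x \<partial>M i)"
proof -
  interpret product_prob_space M UNIV
    unfolding product_prob_space_def product_prob_space_axioms_def product_sigma_finite_def
    using M by (auto simp: prob_space_imp_sigma_finite)
  have "(\<integral>\<^sup>+ x. (\<Prod>i\<in>J. g i (x i)) \<partial>PiM UNIV M)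
      = (\<integral>\<^sup>+ x. (\<Prod>i\<in>J. g i (restrict x J i)) \<partial>PiM UNIV M)"
    by (intro nn_integral_cong prod.cong) auto
  also have "\<dots> = (\<integral>\<^sup>+ x. (\<Prod>i\<in>J. g i (x i)) \<partial>distr (PiM UNIV M) (PiM J M) (\<lambda>x. restrict x J))"
    by (subst nn_integral_distr) auto
  also have "\<dots> = (\<Prod>i\<in>J. \<integral>\<^sup>+ x. g i x \<partial>M i)"
    by (subst distr_PiM_restrict_finite) (auto simp: J product_nn_integral_prod)
  finally show ?thesis .
qed

lemma
  fixes g :: "'i \<Rightarrow> 'a \<Rightarrow> real"
  assumes M: "\<And>i. prob_space (M i)" and J: "finite J"
    and g: "\<And>i. i \<in> J \<Longrightarrow> integrable (M i) (g i)"
  shows integrable_PiM_prod: "integrable (PiM UNIV M) (\<lambda>x. \<Prod>i\<in>J. g i (x i))"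
    and integral_PiM_prod: "(\<integral> x. (\<Prod>i\<in>J. g i (x i)) \<partial>PiM UNIV M) = (\<Prod>i\<in>J. \<integral> x. g i x \<partial>M i)"
proof -
  interpret product_prob_space M UNIV
    unfolding product_prob_space_def product_prob_space_axioms_def product_sigma_finite_def
    using M by (auto simp: prob_space_imp_sigma_finite)
  have [measurable]: "\<And>i. i \<in> J \<Longrightarrow> g i \<in> borel_measurable (M i)" using g by auto
  have e: "(\<lambda>x. \<Prod>i\<in>J. g i (x i)) = (\<lambda>x. \<Prod>i\<in>J. g i (restrict x J i))"
    by (intro ext prod.cong) auto
  have "integrable (distr (PiM UNIV M) (PiM J M) (\<lambda>x. restrict x J)) (\<lambda>x. \<Prod>i\<in>J. g i (x i))"
    by (subst distr_PiM_restrict_finite) (auto simp: J g product_integrable_prod)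
  then show "integrable (PiM UNIV M) (\<lambda>x. \<Prod>i\<in>J. g i (x i))"
    unfolding e by (subst (asm) integrable_distr_eq) auto
  have "(\<integral> x. (\<Prod>i\<in>J. g i (x i)) \<partial>PiM UNIV M)
    = (\<integral> x. (\<Prod>i\<in>J. g i (x i)) \<partial>distr (PiM UNIV M) (PiM J M) (\<lambda>x. restrict x J))"
    unfolding e by (subst integral_distr) auto
  also have "\<dots> = (\<Prod>i\<in>J. \<integral> x. g i x \<partial>M i)"
    by (subst distr_PiM_restrict_finite) (auto simp: J product_integral_prod g)
  finally show "(\<integral> x. (\<Prod>i\<in>J. g i (x i)) \<partial>PiM UNIV M) = (\<Prod>i\<in>J. \<integral> x. g i x \<partial>M i)" .
qed

text \<open>Both sides have the same mass on cylinder sets, and these determine an infinite product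
  measure.\<close>

lemma PiM_density_finite:
  fixes f :: "'i \<Rightarrow> 'a \<Rightarrow> ennreal"
  assumes M: "\<And>i. prob_space (M i)" and F: "finite F"
    and f[measurable]: "\<And>i. i \<in> F \<Longrightarrow> f i \<in> borel_measurable (M i)"
    and N: "\<And>i. i \<in> F \<Longrightarrow> N i = density (M i) (f i)" "\<And>i. i \<notin> F \<Longrightarrow> N i = M i"
    and PN: "\<And>i. prob_space (N i)"
  shows "PiM UNIV N = density (PiM UNIV M) (\<lambda>x. \<Prod>i\<in>F. f i (x i))"
proof -
  interpret product_prob_space N UNIV
    unfolding product_prob_space_def product_prob_space_axioms_def product_sigma_finite_def
    using PN by (auto simp: prob_space_imp_sigma_finite)
  have sets: "sets (N i) = sets (M i)" for i by (cases "i \<in> F") (auto simp: N)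
  have sets_P: "sets (PiM UNIV N) = sets (PiM UNIV M)" by (intro sets_PiM_cong) (auto simp: sets)
  have sp: "space (N i) = space (M i)" for i using sets by (rule sets_eq_imp_space_eq)
  show ?thesis
  proof (rule PiM_eq[symmetric])
    fix J A assume J: "finite J" and A: "\<And>j. j \<in> J \<Longrightarrow> A j \<in> sets (N j)"
    \<comment> \<open>The cylinder and the density may concern different coordinates; on the union
      of both index sets the integrand is a product of one-coordinate functions.\<close>
    define K where "K = J \<union> F"
    define A' where "A' i = (if i \<in> J then A i else space (M i))" for i
    define g where "g i x = (if i \<in> F then f i x else 1) * indicator (A' i) x" for i x
    have K: "finite K" using J F by (simp add: K_def)
    have A'[measurable]: "A' i \<in> sets (M i)" for i using A by (auto simp: A'_def sets)
    have gm[measurable]: "g i \<in> borel_measurable (M i)" for i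
      unfolding g_def by (cases "i \<in> F") auto
    let ?E = "prod_emb UNIV N J (\<Pi>\<^sub>E j\<in>J. A j)"
    have E: "?E \<in> sets (PiM UNIV M)" unfolding sets_P[symmetric] using J A by (intro sets_PiM_I) auto
    have eq: "(\<Prod>i\<in>F. f i (x i)) * indicator ?E x = (\<Prod>i\<in>K. g i (x i))"
      if "x \<in> space (PiM UNIV M)" for x
    proof -
      have "(\<Prod>i\<in>K. g i (x i)) = (\<Prod>i\<in>K. (if i \<in> F then f i (x i) else 1)) * (\<Prod>i\<in>K. indicator (A' i) (x i))"
        by (simp add: g_def prod.distrib)
      also have "(\<Prod>i\<in>K. (if i \<in> F then f i (x i) else 1)) = (\<Prod>i\<in>F. f i (x i))"
        using K by (subst prod.inter_restrict[symmetric]) (auto simp: K_def Int_absorb1 intro!: prod.cong)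
      also have "(\<Prod>i\<in>K. indicator (A' i) (x i)) = (\<Prod>i\<in>J. indicator (A i) (x i) :: ennreal)"
        using K that by (intro prod.mono_neutral_cong_right) (auto simp: K_def A'_def space_PiM PiE_iff)
      also have "\<dots> = indicator ?E x"
        using that J by (auto simp: prod_emb_def space_PiM indicator_def sp Pi_iff intro!: prod.neutral)
      finally show ?thesis by simp
    qed
    have "emeasure (density (PiM UNIV M) (\<lambda>x. \<Prod>i\<in>F. f i (x i))) ?E
      = (\<integral>\<^sup>+ x. (\<Prod>i\<in>K. g i (x i)) \<partial>PiM UNIV M)"
      using E by (subst emeasure_density) (auto simp: eq intro!: nn_integral_cong)
    also have "\<dots> = (\<Prod>i\<in>K. \<integral>\<^sup>+ x. g i x \<partial>M i)"
      by (rule nn_integral_PiM_prod[OF M K gm])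
    also have "\<dots> = (\<Prod>i\<in>K. emeasure (N i) (A' i))"
    proof (intro prod.cong refl)
      fix i assume "i \<in> K"
      show "(\<integral>\<^sup>+ x. g i x \<partial>M i) = emeasure (N i) (A' i)"
        by (cases "i \<in> F") (auto simp: N g_def emeasure_density)
    qed
    also have "\<dots> = (\<Prod>j\<in>J. emeasure (N j) (A j))"
      using K by (intro prod.mono_neutral_cong_right)
        (auto simp: K_def A'_def sp[symmetric] prob_space.emeasure_space_1[OF PN])
    finally show "emeasure (density (PiM UNIV M) (\<lambda>x. \<Prod>i\<in>F. f i (x i))) ?E
      = (\<Prod>j\<in>J. emeasure (N j) (A j))" .
  qed (simp add: sets_P)
qed

text \<open>Order four suffices: the polynomials integrated later are quadratic in a coordinate or
  squares of such expressions.\<close>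

lemma gauss_moments:
  assumes s: "0 < s"
  shows "has_bochner_integral (gauss m s) (\<lambda>x. (x - m)) 0"
    and "has_bochner_integral (gauss m s) (\<lambda>x. (x - m)^2) (s^2)"
    and "has_bochner_integral (gauss m s) (\<lambda>x. (x - m)^3) 0"
    and "has_bochner_integral (gauss m s) (\<lambda>x. (x - m)^4) (3 * s^4)"
    and "has_bochner_integral (gauss m s) (\<lambda>x. c :: real) c"
proof -
  have *: "has_bochner_integral (gauss m s) f c"
    if "has_bochner_integral lborel (\<lambda>x. normal_density m s x * f x) c" "f \<in> borel_measurable borel" for f c
    using that unfolding gauss_def by (intro has_bochner_integral_density) auto
  show "has_bochner_integral (gauss m s) (\<lambda>x. (x - m)) 0"
    using normal_moment_odd[OF s, of m 0] by (intro *) auto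
  show "has_bochner_integral (gauss m s) (\<lambda>x. (x - m)^2) (s^2)"
    using normal_moment_even[OF s, of m 1] by (intro *) auto
  show "has_bochner_integral (gauss m s) (\<lambda>x. (x - m)^3) 0"
    using normal_moment_odd[OF s, of m 1] by (intro *) (auto simp: numeral_3_eq_3)
  show "has_bochner_integral (gauss m s) (\<lambda>x. (x - m)^4) (3 * s^4)"
    using normal_moment_even[OF s, of m 2] by (intro *) (auto simp: fact_numeral power_divide field_simps)
  interpret prob_space "gauss m s" by (rule prob_space_gauss[OF s])
  show "has_bochner_integral (gauss m s) (\<lambda>x. c) c"
    using prob_space by (simp add: has_bochner_integral_iff)
qed

lemma gauss_quadratic:
  assumes s: "0 < s"
  shows "has_bochner_integral (gauss m s) (\<lambda>x. a * x\<^sup>2 + b * x + c) (a * (m\<^sup>2 + s\<^sup>2) + b * m + c)"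
proof -
  have "has_bochner_integral (gauss m s) (\<lambda>x. a * (x - m)^2 + (2 * a * m + b) * (x - m) + (a * m\<^sup>2 + b * m + c))
      (a * s^2 + (2 * a * m + b) * 0 + (a * m\<^sup>2 + b * m + c))"
    by (intro has_bochner_integral_add has_bochner_integral_mult_right gauss_moments s)
  then show ?thesis
    by (simp add: power2_eq_square algebra_simps)
qed

text \<open>The variance of a noncentral chi-square variable, from the expansion in powers of
  \<open>x - m\<close>.\<close>

lemma gauss_square_variance:
  assumes s: "0 < s"
  shows "has_bochner_integral (gauss m s) (\<lambda>x. (x\<^sup>2 - (m\<^sup>2 + s\<^sup>2))\<^sup>2) (2 * s^4 + 4 * m\<^sup>2 * s\<^sup>2)"
proof -
  have "has_bochner_integral (gauss m s)
     (\<lambda>x. (x - m)^4 + 4 * m * (x - m)^3 + (4 * m^2 - 2 * s^2) * (x - m)^2 + (- 4 * m * s^2) * (x - m) + s^4)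
      (3 * s^4 + 4 * m * 0 + (4 * m^2 - 2 * s^2) * s^2 + (- 4 * m * s^2) * 0 + s^4)"
    by (intro has_bochner_integral_add has_bochner_integral_mult_right gauss_moments s)
  moreover have "(x - m)^4 + 4 * m * (x - m)^3 + (4 * m^2 - 2 * s^2) * (x - m)^2 + (- 4 * m * s^2) * (x - m) + s^4
     = (x\<^sup>2 - (m\<^sup>2 + s\<^sup>2))\<^sup>2" for x :: real by algebra
  moreover have "3 * s^4 + 4 * m * 0 + (4 * m^2 - 2 * s^2) * s^2 + (- 4 * m * s^2) * 0 + s^4
     = 2 * s^4 + 4 * m\<^sup>2 * s\<^sup>2" by algebra
  ultimately show ?thesis by (simp only:)
qed

lemma gauss_prod_component:
  fixes f :: "real \<Rightarrow> real"
  assumes s: "\<And>i. 0 < s i" and f: "has_bochner_integral (gauss (m i) (s i)) f c"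
  shows "has_bochner_integral (gauss_prod m s) (\<lambda>x. f (x i)) c"
proof -
  have d: "distr (gauss_prod m s) (gauss (m i) (s i)) (\<lambda>x. x i) = gauss (m i) (s i)"
    unfolding gauss_prod_def by (rule distr_PiM_component) (auto intro: prob_space_gauss s)
  have [measurable]: "f \<in> borel_measurable borel"
    using borel_measurable_has_bochner_integral[OF f] by (simp cong: measurable_cong_sets)
  have m: "(\<lambda>x. x i) \<in> gauss_prod m s \<rightarrow>\<^sub>M gauss (m i) (s i)"
    unfolding gauss_prod_def by (rule measurable_component_singleton) simp
  have f': "f \<in> borel_measurable (gauss (m i) (s i))"
    using f by (rule borel_measurable_has_bochner_integral)
  have "has_bochner_integral (distr (gauss_prod m s) (gauss (m i) (s i)) (\<lambda>x. x i)) f c"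
    using f by (simp add: d)
  then show ?thesis
    by (simp add: has_bochner_integral_iff integrable_distr_eq[OF m f'] integral_distr[OF m f'])
qed

lemma gauss_prod_sum:
  fixes f :: "nat \<Rightarrow> real \<Rightarrow> real"
  assumes s: "\<And>i. 0 < s i" and f: "\<And>i. i \<in> F \<Longrightarrow> has_bochner_integral (gauss (m i) (s i)) (f i) (c i)"
  shows "has_bochner_integral (gauss_prod m s) (\<lambda>x. \<Sum>i\<in>F. f i (x i)) (\<Sum>i\<in>F. c i)"
  by (intro has_bochner_integral_sum gauss_prod_component s f)

text \<open>Centred functions of distinct coordinates are independent, so the cross terms vanish and
  the variances add.\<close>

lemma gauss_prod_sum_variance:
  fixes f :: "nat \<Rightarrow> real \<Rightarrow> real"
  assumes s: "\<And>i. 0 < s i" and F: "finite F"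
    and f: "\<And>i. i \<in> F \<Longrightarrow> has_bochner_integral (gauss (m i) (s i)) (f i) 0"
    and v: "\<And>i. i \<in> F \<Longrightarrow> has_bochner_integral (gauss (m i) (s i)) (\<lambda>x. (f i x)\<^sup>2) (v i)"
  shows "has_bochner_integral (gauss_prod m s) (\<lambda>x. (\<Sum>i\<in>F. f i (x i))\<^sup>2) (\<Sum>i\<in>F. v i)"
proof -
  have "has_bochner_integral (gauss_prod m s) (\<lambda>x. f i (x i) * f j (x j)) (if i = j then v i else 0)"
    if "i \<in> F" "j \<in> F" for i j
  proof (cases "i = j")
    case True
    then show ?thesis
      using gauss_prod_component[of s m i, OF s v[OF that(1)]] True by (simp flip: power2_eq_square)
  next
    case False
    have int: "integrable (gauss (m k) (s k)) (f k)" "(\<integral>x. f k x \<partial>gauss (m k) (s k)) = 0" if "k \<in> F" for k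
      using f[OF that] by (auto simp: has_bochner_integral_iff)
    have e: "f i (x i) * f j (x j) = (\<Prod>k\<in>{i,j}. f k (x k))" for x using False by simp
    show ?thesis
      unfolding e gauss_prod_def has_bochner_integral_iff using False that
      integrable_PiM_prod[of "\<lambda>i. gauss (m i) (s i)" "{i, j}" f, OF prob_space_gauss[OF s] _ int(1)]
      by (subst integral_PiM_prod) (auto simp: int prob_space_gauss s)
  qed
  then have "has_bochner_integral (gauss_prod m s) (\<lambda>x. \<Sum>i\<in>F. \<Sum>j\<in>F. f i (x i) * f j (x j))
     (\<Sum>i\<in>F. \<Sum>j\<in>F. if i = j then v i else 0)"
    by (intro has_bochner_integral_sum)
  then show ?thesis using F
    by (simp add: power2_eq_square sum_product)
qed

section \<open>Cameron--Martin densities for shifts of an infinite Gaussian product\<close>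

definition shift_ratio :: "real \<Rightarrow> real \<Rightarrow> real \<Rightarrow> real" where
  "shift_ratio s m y = exp (m * y / s\<^sup>2 - m\<^sup>2 / (2 * s\<^sup>2))"

lemma measurable_shift_ratio [measurable]: "shift_ratio s m \<in> borel_measurable borel"
  unfolding shift_ratio_def by measurable

lemma shift_ratio_pos: "0 < shift_ratio s m y"
  by (simp add: shift_ratio_def)

lemma normal_density_shift:
  "0 < s \<Longrightarrow> normal_density 0 s y * shift_ratio s m y = normal_density m s y"
  unfolding normal_density_def shift_ratio_def
  by (simp add: exp_add[symmetric] power2_eq_square field_simps)

text \<open>Squaring the likelihood ratio doubles the shift up to a constant, which puts its second
  moment in closed form.\<close>

lemma normal_density_shift_sq:
  "0 < s \<Longrightarrow> normal_density 0 s y * (shift_ratio s m y * shift_ratio s m y)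
     = exp (m\<^sup>2 / s\<^sup>2) * normal_density (2 * m) s y"
  unfolding normal_density_def shift_ratio_def
  by (simp add: exp_add[symmetric] power2_eq_square field_simps)

lemma gauss_shift: "0 < s \<Longrightarrow> gauss m s = density (gauss 0 s) (\<lambda>y. ennreal (shift_ratio s m y))"
  unfolding gauss_def
  by (subst density_density_eq)
     (auto simp: ennreal_mult'[symmetric] normal_density_shift less_imp_le[OF shift_ratio_pos])

lemma shift_ratio_sq:
  assumes "0 < s"
  shows "(\<integral>\<^sup>+ y. ennreal (shift_ratio s m y * shift_ratio s m y) \<partial>gauss 0 s) = ennreal (exp (m\<^sup>2 / s\<^sup>2))"
proof -
  have "(\<integral>\<^sup>+ y. ennreal (shift_ratio s m y * shift_ratio s m y) \<partial>gauss 0 s)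
    = (\<integral>\<^sup>+ y. ennreal (exp (m\<^sup>2 / s\<^sup>2)) * ennreal (normal_density (2 * m) s y) \<partial>lborel)"
    unfolding gauss_def
    by (subst nn_integral_density) (auto simp: ennreal_mult'[symmetric] normal_density_shift_sq assms)
  also have "\<dots> = ennreal (exp (m\<^sup>2 / s\<^sup>2))"
    using prob_space.emeasure_space_1[OF prob_space_normal_density[OF assms, of "2 * m"]]
    by (subst nn_integral_cmult) (auto simp: emeasure_density)
  finally show ?thesis .
qed

text \<open>The limiting density may vanish, so passing to the limit in the entropy integrand
  requires continuity at 0 as well.\<close>

lemma continuous_on_x_ln_x: "continuous_on {0..} (\<lambda>x::real. x * ln x)"
  unfolding continuous_on_def
proof
  fix x :: real assume x: "x \<in> {0..}"
  show "((\<lambda>x. x * ln x) \<longlongrightarrow> x * ln x) (at x within {0..})"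
  proof (cases "x = 0")
    case True
    have "((\<lambda>x::real. x * ln x) \<longlongrightarrow> 0) (at_right 0)" by real_asymp
    then show ?thesis using True
      by (simp add: at_within_Ici_at_right)
  next
    case False
    with x have "isCont (\<lambda>x. x * ln x) x" by (intro continuous_intros) auto
    then show ?thesis by (auto simp: isCont_def intro: tendsto_within_subset)
  qed
qed

text \<open>Adding 1 makes the entropy integrand nonnegative, as Fatou's lemma requires.\<close>

lemma x_ln_x_ge: "0 \<le> x \<Longrightarrow> 0 \<le> x * ln x + (1::real)"
proof (cases "x = 0")
  case False
  assume "0 \<le> x"
  with False have x: "0 < x" by simp
  have "ln (1 / x) \<le> 1 / x - 1" using x by (intro ln_le_minus_one) auto
  then have "x * (- ln x) \<le> x * (1 / x - 1)" using x
    by (intro mult_left_mono) (auto simp: ln_div)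
  also have "x * (1 / x - 1) = 1 - x" using x by (simp add: field_simps)
  finally show ?thesis using x by simp
qed simp

lemma gauss_prod_shift_finite:
  fixes s :: real
  assumes s: "0 < s"
  shows "gauss_prod (\<lambda>i. if i < n then \<theta> i else 0) (\<lambda>_. s)
     = density (gauss_prod (\<lambda>_. 0) (\<lambda>_. s)) (\<lambda>y. ennreal (\<Prod>i<n. shift_ratio s (\<theta> i) (y i)))"
proof -
  have "gauss_prod (\<lambda>i. if i < n then \<theta> i else 0) (\<lambda>_. s)
     = density (gauss_prod (\<lambda>_. 0) (\<lambda>_. s)) (\<lambda>y. \<Prod>i<n. ennreal (shift_ratio s (\<theta> i) (y i)))"
    unfolding gauss_prod_def
  proof (rule PiM_density_finite)
    show "(\<lambda>y. ennreal (shift_ratio s (\<theta> i) y)) \<in> borel_measurable (gauss 0 s)" for i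
      by measurable
  qed (auto simp: gauss_shift[OF s, symmetric] prob_space_gauss s)
  then show ?thesis
    by (simp add: prod_ennreal less_imp_le[OF shift_ratio_pos])
qed

text \<open>The martingale property in L2: ratios of the coordinates from \<open>m\<close> to
  \<open>n - 1\<close> occur once and integrate to 1, those below \<open>m\<close> occur
  squared.\<close>

lemma shift_ratio_prod_inner:
  fixes s :: real
  assumes s: "0 < s" and mn: "m \<le> n"
  shows "has_bochner_integral (gauss_prod (\<lambda>_. 0) (\<lambda>_. s))
     (\<lambda>y. (\<Prod>i<n. shift_ratio s (\<theta> i) (y i)) * (\<Prod>i<m. shift_ratio s (\<theta> i) (y i)))
     (exp ((\<Sum>i<m. (\<theta> i)\<^sup>2) / s\<^sup>2))"
proof -
  let ?r = "\<lambda>i. shift_ratio s (\<theta> i)"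
  have eq: "(\<Prod>i<n. ?r i (y i)) * (\<Prod>i<m. ?r i (y i))
      = (\<Prod>i<n. if i < m then ?r i (y i) * ?r i (y i) else ?r i (y i))" for y
  proof -
    have "(\<Prod>i<m. ?r i (y i)) = (\<Prod>i<n. if i < m then ?r i (y i) else 1)"
      using mn by (subst prod.mono_neutral_right[of "{..<n}" "{..<m}"]) auto
    then show ?thesis by (auto simp: prod.distrib[symmetric] intro!: prod.cong)
  qed
  have nn: "0 \<le> (\<Prod>i<n. if i < m then ?r i (y i) * ?r i (y i) else ?r i (y i))" for y
    by (intro prod_nonneg) (auto simp: less_imp_le[OF shift_ratio_pos])
  have one: "(\<integral>\<^sup>+ y. ennreal (?r i y) \<partial>gauss 0 s) = 1" for i
    by (rule nn_integral_density_prob) (auto simp: gauss_shift[OF s, symmetric] prob_space_gauss s)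
  have "(\<integral>\<^sup>+ y. ennreal (\<Prod>i<n. if i < m then ?r i (y i) * ?r i (y i) else ?r i (y i)) \<partial>gauss_prod (\<lambda>_. 0) (\<lambda>_. s))
    = (\<integral>\<^sup>+ y. (\<Prod>i<n. ennreal (if i < m then ?r i (y i) * ?r i (y i) else ?r i (y i))) \<partial>gauss_prod (\<lambda>_. 0) (\<lambda>_. s))"
    by (intro nn_integral_cong) (subst prod_ennreal, auto simp: less_imp_le[OF shift_ratio_pos])
  also have "\<dots> = (\<Prod>i<n. \<integral>\<^sup>+ y. ennreal (if i < m then ?r i y * ?r i y else ?r i y) \<partial>gauss 0 s)"
    unfolding gauss_prod_def
    by (rule nn_integral_PiM_prod) (auto simp: prob_space_gauss s)
  also have "\<dots> = (\<Prod>i<n. if i < m then ennreal (exp ((\<theta> i)\<^sup>2 / s\<^sup>2)) else 1)"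
    by (intro prod.cong) (auto simp: shift_ratio_sq s one)
  also have "\<dots> = (\<Prod>i<m. ennreal (exp ((\<theta> i)\<^sup>2 / s\<^sup>2)))"
    using mn by (subst prod.mono_neutral_right[of "{..<n}" "{..<m}"]) auto
  also have "\<dots> = ennreal (exp ((\<Sum>i<m. (\<theta> i)\<^sup>2) / s\<^sup>2))"
    by (simp add: prod_ennreal exp_sum[symmetric] sum_divide_distrib)
  finally show ?thesis
    unfolding eq by (intro has_bochner_integral_nn_integral) (auto simp: nn)
qed

text \<open>By the inner products above, the squared L2 distance is the difference of the two
  exponentials; \<open>\<bar>f\<bar> \<le> \<delta> / 2 + f^2 / (2 * \<delta>)\<close> turns a bound
  on it into one in L1.\<close>

lemma shift_ratio_prod_L1:
  fixes s :: real
  defines "G \<equiv> gauss_prod (\<lambda>_. 0) (\<lambda>_. s)"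
  defines "D \<equiv> \<lambda>\<theta> n y. (\<Prod>i<n::nat. shift_ratio s (\<theta> i) (y i))"
  assumes s: "0 < s" and mn: "m \<le> n" and d: "0 < \<delta>"
    and le: "exp ((\<Sum>i<n. (\<theta> i)\<^sup>2) / s\<^sup>2) - exp ((\<Sum>i<m. (\<theta> i)\<^sup>2) / s\<^sup>2) \<le> \<delta>\<^sup>2"
  shows "integrable G (\<lambda>y. D \<theta> n y - D \<theta> m y)" (is "integrable _ ?f")
    and "(\<integral> y. \<bar>D \<theta> n y - D \<theta> m y\<bar> \<partial>G) \<le> \<delta>"
proof -
  interpret prob_space G unfolding G_def by (intro prob_space_gauss_prod s)
  let ?D = "D \<theta>"
  have [measurable]: "D \<theta> n \<in> borel_measurable G" for n unfolding G_def D_def by measurable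
  let ?e = "\<lambda>n. exp ((\<Sum>i<n. (\<theta> i)\<^sup>2) / s\<^sup>2)"
  have "has_bochner_integral G (\<lambda>y. ?D n y * ?D n y + (?D m y * ?D m y - 2 * (?D n y * ?D m y)))
     (?e n + (?e m - 2 * ?e m))"
    unfolding G_def D_def
    by (intro has_bochner_integral_add has_bochner_integral_diff has_bochner_integral_mult_right
         shift_ratio_prod_inner s mn order.refl)
  also have "(\<lambda>y. ?D n y * ?D n y + (?D m y * ?D m y - 2 * (?D n y * ?D m y))) = (\<lambda>y. (?f y)\<^sup>2)"
    by (auto simp: power2_eq_square algebra_simps)
  finally have h: "has_bochner_integral G (\<lambda>y. (?f y)\<^sup>2) (?e n - ?e m)" by simp
  have b: "\<bar>?f y\<bar> \<le> \<delta> / 2 + 1 / (2 * \<delta>) * (?f y)\<^sup>2" for y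
  proof -
    have "0 \<le> (\<bar>?f y\<bar> - \<delta>)\<^sup>2" by simp
    then have "2 * \<delta> * \<bar>?f y\<bar> \<le> \<delta>\<^sup>2 + (?f y)\<^sup>2"
      by (simp add: power2_diff[of "\<bar>?f y\<bar>"] algebra_simps)
    then show ?thesis using d by (simp add: field_simps power2_eq_square)
  qed
  have int: "integrable G (\<lambda>y. \<delta> / 2 + 1 / (2 * \<delta>) * (?f y)\<^sup>2)"
    using h by (auto simp: has_bochner_integral_iff)
  show I: "integrable G ?f"
    by (rule Bochner_Integration.integrable_bound[OF int])
       (use b d in \<open>auto intro!: AE_I2 order.trans[OF b]\<close>)
  have "(\<integral> y. \<bar>?f y\<bar> \<partial>G) \<le> (\<integral> y. \<delta> / 2 + 1 / (2 * \<delta>) * (?f y)\<^sup>2 \<partial>G)"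
    using I int b by (intro integral_mono) auto
  also have "\<dots> = \<delta> / 2 + 1 / (2 * \<delta>) * (?e n - ?e m)"
    using h by (subst Bochner_Integration.integral_add) (auto simp: has_bochner_integral_iff prob_space)
  also have "\<dots> \<le> \<delta> / 2 + 1 / (2 * \<delta>) * \<delta>\<^sup>2"
    using le d by (intro add_left_mono mult_left_mono) auto
  also have "\<dots> = \<delta>" using d by (simp add: power2_eq_square)
  finally show "(\<integral> y. \<bar>D \<theta> n y - D \<theta> m y\<bar> \<partial>G) \<le> \<delta>" .
qed

text \<open>The finite products of shift ratios form a martingale whose second moments
  \<open>e n\<close> converge, because \<theta> is square summable. Hence they are Cauchy in L1; the
  limit has the right mass on every cylinder, and Fatou's lemma carries the entropy bound over to
  it.\<close>

theorem cameron_martin: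
  fixes s :: real and \<theta> :: rseq
  assumes s: "0 < s" and sum: "summable (\<lambda>i. (\<theta> i)\<^sup>2)"
  obtains D :: "rseq \<Rightarrow> real" where "D \<in> borel_measurable Rinf" "\<And>y. 0 \<le> D y"
    "gauss_seq \<theta> s = density (gauss_seq (\<lambda>_. 0) s) (\<lambda>y. ennreal (D y))"
    "integrable (gauss_seq \<theta> s) (\<lambda>y. ln (D y))"
    "(\<integral> y. ln (D y) \<partial>gauss_seq \<theta> s) \<le> (\<Sum>i. (\<theta> i)\<^sup>2) / (2 * s\<^sup>2)"
proof -
  define G where "G = gauss_prod (\<lambda>_. 0) (\<lambda>_. s)"
  define P where "P = gauss_prod \<theta> (\<lambda>_. s)"
  define Dn where "Dn n y = (\<Prod>i<n. shift_ratio s (\<theta> i) (y i))" for n y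
  define S where "S n = (\<Sum>i<n. (\<theta> i)\<^sup>2)" for n
  define e where "e n = exp (S n / s\<^sup>2)" for n
  interpret G: prob_space G unfolding G_def by (intro prob_space_gauss_prod s)
  have [simp, measurable_cong]: "sets G = sets Rinf" "sets P = sets Rinf" by (simp_all add: G_def P_def)
  have [measurable]: "Dn n \<in> borel_measurable Rinf" for n unfolding Dn_def by measurable
  have Dn_pos: "0 < Dn n y" for n y by (auto simp: Dn_def intro!: prod_pos shift_ratio_pos)
  have dens: "gauss_prod (\<lambda>i. if i < n then \<theta> i else 0) (\<lambda>_. s) = density G (\<lambda>y. ennreal (Dn n y))" for n
    unfolding G_def Dn_def by (rule gauss_prod_shift_finite[OF s])
  have nn1: "(\<integral>\<^sup>+ y. ennreal (Dn n y) \<partial>G) = 1" for n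
    using prob_space_gauss_prod[of "\<lambda>_. s" "\<lambda>i. if i < n then \<theta> i else 0"] s
    by (intro nn_integral_density_prob) (auto simp: dens)
  have intD: "integrable G (Dn n)" for n
    by (subst integrable_iff_bounded) (simp add: less_imp_le[OF Dn_pos] nn1)
  have L1: "(\<integral> y. \<bar>Dn n y - Dn m y\<bar> \<partial>G) \<le> \<delta>" if "m \<le> n" "0 < \<delta>" "e n - e m \<le> \<delta>\<^sup>2" for m n \<delta>
    using shift_ratio_prod_L1(2)[OF s that(1,2), of \<theta>] that(3)
    unfolding G_def Dn_def e_def S_def by simp
  have "S \<longlonglongrightarrow> (\<Sum>i. (\<theta> i)\<^sup>2)" unfolding S_def by (rule summable_LIMSEQ[OF sum])
  then have "e \<longlonglongrightarrow> exp ((\<Sum>i. (\<theta> i)\<^sup>2) / s\<^sup>2)" unfolding e_def using s by (intro tendsto_intros) auto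
  then have "Cauchy e" by (rule LIMSEQ_imp_Cauchy)
  have cauchy: "\<exists>N. \<forall>i\<ge>N. \<forall>j\<ge>N. (\<integral> y. norm (Dn i y - Dn j y) \<partial>G) < \<epsilon>" if "0 < \<epsilon>" for \<epsilon>
  proof -
    from that have "0 < (\<epsilon> / 2)\<^sup>2" by simp
    with \<open>Cauchy e\<close> obtain N where N: "\<And>i j. i \<ge> N \<Longrightarrow> j \<ge> N \<Longrightarrow> norm (e i - e j) < (\<epsilon> / 2)\<^sup>2"
      unfolding Cauchy_iff by blast
    have *: "(\<integral> y. \<bar>Dn i y - Dn j y\<bar> \<partial>G) < \<epsilon>" if "i \<ge> N" "j \<ge> N" "j \<le> i" for i j
      using L1[of j i "\<epsilon> / 2"] N[of i j] that \<open>0 < \<epsilon>\<close> by fastforce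
    have "(\<integral> y. \<bar>Dn i y - Dn j y\<bar> \<partial>G) < \<epsilon>" if "i \<ge> N" "j \<ge> N" for i j
      using *[of i j] *[of j i] that by (cases "j \<le> i") (auto simp: abs_minus_commute)
    then show ?thesis by auto
  qed
  obtain r where r: "strict_mono r" and ae: "AE y in G. Cauchy (\<lambda>k. Dn (r k) y)"
    using cauchy_L1_AE_cauchy_subseq[OF intD cauchy] by blast
  \<comment> \<open>The maximum makes \<open>D\<close> nonnegative also on the null set where the
    subsequence fails to converge.\<close>
  define D where "D y = max 0 (lim (\<lambda>k. Dn (r k) y))" for y
  have [measurable]: "D \<in> borel_measurable Rinf" unfolding D_def by measurable
  have D0: "0 \<le> D y" for y by (simp add: D_def)
  have lim: "AE y in G. (\<lambda>k. Dn (r k) y) \<longlonglongrightarrow> D y"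
    using ae
  proof eventually_elim
    fix y assume "Cauchy (\<lambda>k. Dn (r k) y)"
    then have l: "(\<lambda>k. Dn (r k) y) \<longlonglongrightarrow> lim (\<lambda>k. Dn (r k) y)"
      by (simp add: Cauchy_convergent_iff convergent_LIMSEQ_iff)
    moreover have "0 \<le> lim (\<lambda>k. Dn (r k) y)"
      by (rule LIMSEQ_le_const[OF l]) (auto simp: less_imp_le[OF Dn_pos])
    ultimately show "(\<lambda>k. Dn (r k) y) \<longlonglongrightarrow> D y" by (simp add: D_def)
  qed
  have L1lim: "\<exists>N. \<forall>k\<ge>N. (\<integral>\<^sup>+ y. ennreal \<bar>D y - Dn (r k) y\<bar> \<partial>G) \<le> ennreal \<epsilon>" if e0: "0 < \<epsilon>" for \<epsilon>
  proof -
    obtain N where N: "\<And>i j. i \<ge> N \<Longrightarrow> j \<ge> N \<Longrightarrow> (\<integral> y. norm (Dn i y - Dn j y) \<partial>G) < \<epsilon>"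
      using cauchy[OF e0] by blast
    have "(\<integral>\<^sup>+ y. ennreal \<bar>D y - Dn (r k) y\<bar> \<partial>G) \<le> ennreal \<epsilon>" if "k \<ge> N" for k
    proof -
      have "(\<integral>\<^sup>+ y. ennreal \<bar>D y - Dn (r k) y\<bar> \<partial>G)
        = (\<integral>\<^sup>+ y. liminf (\<lambda>j. ennreal \<bar>Dn (r j) y - Dn (r k) y\<bar>) \<partial>G)"
        using lim
      proof (intro nn_integral_cong_AE, eventually_elim)
        fix y assume "(\<lambda>k. Dn (r k) y) \<longlonglongrightarrow> D y"
        then have "(\<lambda>j. ennreal \<bar>Dn (r j) y - Dn (r k) y\<bar>) \<longlonglongrightarrow> ennreal \<bar>D y - Dn (r k) y\<bar>"
          by (intro tendsto_intros)
        then show "ennreal \<bar>D y - Dn (r k) y\<bar> = liminf (\<lambda>j. ennreal \<bar>Dn (r j) y - Dn (r k) y\<bar>)"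
          by (intro lim_imp_Liminf[symmetric]) auto
      qed
      also have "\<dots> \<le> liminf (\<lambda>j. \<integral>\<^sup>+ y. ennreal \<bar>Dn (r j) y - Dn (r k) y\<bar> \<partial>G)"
        by (rule nn_integral_liminf) measurable
      also have "\<dots> \<le> ennreal \<epsilon>"
      proof (rule Liminf_le)
        show "\<forall>\<^sub>F j in sequentially. (\<integral>\<^sup>+ y. ennreal \<bar>Dn (r j) y - Dn (r k) y\<bar> \<partial>G) \<le> ennreal \<epsilon>"
          using eventually_ge_at_top[of N]
        proof eventually_elim
          fix j assume "N \<le> j"
          then have "(\<integral> y. norm (Dn (r j) y - Dn (r k) y) \<partial>G) < \<epsilon>"
            using that seq_suble[OF r, of j] seq_suble[OF r, of k] by (intro N) auto
          then show "(\<integral>\<^sup>+ y. ennreal \<bar>Dn (r j) y - Dn (r k) y\<bar> \<partial>G) \<le> ennreal \<epsilon>"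
            by (subst nn_integral_eq_integral) (auto intro!: ennreal_leI intD)
        qed
      qed simp
      finally show ?thesis .
    qed
    then show ?thesis by blast
  qed
  have ID: "integrable G D"
  proof -
    obtain k where k: "(\<integral>\<^sup>+ y. ennreal \<bar>D y - Dn (r k) y\<bar> \<partial>G) \<le> ennreal 1"
      using L1lim[of 1] by auto
    have "integrable G (\<lambda>y. D y - Dn (r k) y)"
      using le_less_trans[OF k] by (subst integrable_iff_bounded) simp
    from Bochner_Integration.integrable_add[OF this intD[of "r k"]] show ?thesis by simp
  qed
  have eq: "density G (\<lambda>y. ennreal (D y)) = P"
  proof -
    interpret product_prob_space "\<lambda>i. gauss (\<theta> i) s" UNIV
      unfolding product_prob_space_def product_prob_space_axioms_def product_sigma_finite_def
      using prob_space_gauss[OF s] by (auto simp: prob_space_imp_sigma_finite)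
    show ?thesis unfolding P_def gauss_prod_def
    proof (rule PiM_eq)
      show "sets (density G (\<lambda>y. ennreal (D y))) = sets (PiM UNIV (\<lambda>i. gauss (\<theta> i) s))"
        using sets_gauss_prod[of \<theta> "\<lambda>_. s"] by (simp add: gauss_prod_def)
      fix J A assume J: "finite J" and A: "\<And>j. j \<in> J \<Longrightarrow> A j \<in> sets (gauss (\<theta> j) s)"
      let ?E = "prod_emb UNIV (\<lambda>i. gauss (\<theta> i) s) J (\<Pi>\<^sub>E j\<in>J. A j)"
      let ?c = "\<Prod>j\<in>J. emeasure (gauss (\<theta> j) s) (A j)"
      have E: "?E \<in> sets Rinf"
        using sets_PiM_I[of J UNIV A "\<lambda>i. gauss (\<theta> i) s"] J A sets_gauss_prod[of \<theta> "\<lambda>_. s"]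
        by (auto simp: gauss_prod_def)
      have E': "?E = prod_emb UNIV (\<lambda>i. gauss (if i < n then \<theta> i else 0) s) J (\<Pi>\<^sub>E j\<in>J. A j)" for n
        by (auto simp: prod_emb_def)
      \<comment> \<open>Beyond every index of the cylinder all partial densities give it its exact
        mass, and convergence in L1 transfers this mass to \<open>D\<close>.\<close>
      obtain n where n: "\<And>j. j \<in> J \<Longrightarrow> j < n" using J finite_nat_set_iff_bounded by auto
      have En: "emeasure (density G (\<lambda>y. ennreal (Dn m y))) ?E = ?c" if "n \<le> m" for m
      proof -
        have "emeasure (density G (\<lambda>y. ennreal (Dn m y))) ?E
          = emeasure (PiM UNIV (\<lambda>i. gauss (if i < m then \<theta> i else 0) s)) ?E"
          by (simp add: dens[symmetric] gauss_prod_def)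
        also have "\<dots> = (\<Prod>j\<in>J. emeasure (gauss (if j < m then \<theta> j else 0) s) (A j))"
          unfolding E'[of m] by (rule Infinite_Product_Measure.emeasure_PiM_emb) (use J A s in \<open>auto simp: prob_space_gauss\<close>)
        also have "\<dots> = ?c" using n that by (intro prod.cong) (auto dest: less_le_trans)
        finally show ?thesis .
      qed
      have Ed: "emeasure (density G (\<lambda>y. ennreal (f y))) ?E = ennreal (\<integral> y. f y * indicator ?E y \<partial>G)"
        if f: "integrable G f" "\<And>y. 0 \<le> f y" for f
      proof -
        have [measurable]: "f \<in> borel_measurable Rinf" using f(1) by (simp cong: measurable_cong_sets)
        have "integrable G (\<lambda>y. f y * indicator ?E y)"
          using E by (intro integrable_real_mult_indicator f) auto
        then show ?thesis using E f
          by (subst emeasure_density)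
            (auto simp: nn_integral_eq_integral[symmetric] ennreal_mult' intro!: nn_integral_cong split: split_indicator)
      qed
      have c: "(\<integral> y. Dn m y * indicator ?E y \<partial>G) = enn2real ?c" if "n \<le> m" for m
      proof -
        have "ennreal (\<integral> y. Dn m y * indicator ?E y \<partial>G) = ?c"
          using Ed[OF intD[of m]] En[OF that] less_imp_le[OF Dn_pos] by simp
        moreover have "0 \<le> (\<integral> y. Dn m y * indicator ?E y \<partial>G)"
          by (intro integral_nonneg_AE AE_I2 mult_nonneg_nonneg less_imp_le[OF Dn_pos]) simp
        ultimately show ?thesis by (metis enn2real_ennreal)
      qed
      have IE: "integrable G (\<lambda>y. f y * indicator ?E y)" if "integrable G f" for f :: "rseq \<Rightarrow> real"
        using E that by (intro integrable_real_mult_indicator) auto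
      have "\<bar>(\<integral> y. D y * indicator ?E y \<partial>G) - enn2real ?c\<bar> \<le> \<epsilon>" if e: "0 < \<epsilon>" for \<epsilon>
      proof -
        obtain N where N: "\<And>k. k \<ge> N \<Longrightarrow> (\<integral>\<^sup>+ y. ennreal \<bar>D y - Dn (r k) y\<bar> \<partial>G) \<le> ennreal \<epsilon>"
          using L1lim[OF e] by blast
        define k where "k = max N n"
        have "n \<le> r k" using seq_suble[OF r, of k] by (simp add: k_def)
        have I: "integrable G (\<lambda>y. \<bar>D y - Dn (r k) y\<bar>)" using ID intD by auto
        have "\<bar>(\<integral> y. D y * indicator ?E y \<partial>G) - enn2real ?c\<bar>
           = \<bar>\<integral> y. D y * indicator ?E y - Dn (r k) y * indicator ?E y \<partial>G\<bar>"
          using IE[OF ID] IE[OF intD[of "r k"]] c[OF \<open>n \<le> r k\<close>] by simp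
        also have "\<dots> \<le> (\<integral> y. \<bar>D y - Dn (r k) y\<bar> \<partial>G)"
          using IE[OF ID] IE[OF intD[of "r k"]] I
          by (intro order.trans[OF integral_abs_bound] integral_mono) (auto split: split_indicator)
        also have "\<dots> \<le> \<epsilon>"
        proof -
          have "ennreal (\<integral> y. \<bar>D y - Dn (r k) y\<bar> \<partial>G) \<le> ennreal \<epsilon>"
            using N[of k] I by (subst nn_integral_eq_integral[symmetric]) (auto simp: k_def)
          then show ?thesis using e by simp
        qed
        finally show ?thesis .
      qed
      then have "\<bar>(\<integral> y. D y * indicator ?E y \<partial>G) - enn2real ?c\<bar> \<le> 0"
        by (rule field_le_epsilon[of _ 0, simplified])
      then have "(\<integral> y. D y * indicator ?E y \<partial>G) = enn2real ?c" by simp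
      moreover have "?c < \<top>"
        unfolding En[OF order.refl, symmetric] Ed[OF intD[of n] less_imp_le[OF Dn_pos]]
        by (rule ennreal_less_top)
      ultimately show "emeasure (density G (\<lambda>y. ennreal (D y))) ?E = ?c"
        using Ed[OF ID D0] by (simp add: ennreal_enn2real)
    qed
  qed
  \<comment> \<open>Under the law shifted in the first \<open>n\<close> coordinates,
    \<open>ln (Dn n y)\<close> is affine in \<open>y\<close> and has mean
    \<open>S n / (2 * s^2)\<close>.\<close>
  have ent: "(\<integral>\<^sup>+ y. ennreal (Dn n y * ln (Dn n y) + 1) \<partial>G) = ennreal (S n / (2 * s\<^sup>2) + 1)" for n
  proof -
    let ?m = "\<lambda>i. if i < n then \<theta> i else 0"
    let ?Pn = "gauss_prod ?m (\<lambda>_. s)"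
    have ln: "ln (Dn n y) = (\<Sum>i<n. 0 * (y i)\<^sup>2 + \<theta> i / s\<^sup>2 * y i + (- (\<theta> i)\<^sup>2 / (2 * s\<^sup>2)))" for y
      unfolding Dn_def by (subst ln_prod) (auto simp: shift_ratio_def)
    have "has_bochner_integral ?Pn (\<lambda>y. ln (Dn n y))
       (\<Sum>i<n. 0 * ((?m i)\<^sup>2 + s\<^sup>2) + \<theta> i / s\<^sup>2 * ?m i + (- (\<theta> i)\<^sup>2 / (2 * s\<^sup>2)))"
      unfolding ln by (intro gauss_prod_sum gauss_quadratic s)
    also have "(\<Sum>i<n. 0 * ((?m i)\<^sup>2 + s\<^sup>2) + \<theta> i / s\<^sup>2 * ?m i + (- (\<theta> i)\<^sup>2 / (2 * s\<^sup>2))) = S n / (2 * s\<^sup>2)"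
      unfolding S_def sum_divide_distrib by (intro sum.cong) (auto simp: power2_eq_square field_simps)
    finally have h: "integrable ?Pn (\<lambda>y. ln (Dn n y))" "(\<integral> y. ln (Dn n y) \<partial>?Pn) = S n / (2 * s\<^sup>2)"
      by (auto simp: has_bochner_integral_iff)
    have i: "integrable G (\<lambda>y. Dn n y * ln (Dn n y))"
      using h(1) unfolding dens by (subst (asm) integrable_density) (auto simp: less_imp_le[OF Dn_pos])
    have "(\<integral> y. Dn n y * ln (Dn n y) \<partial>G) = S n / (2 * s\<^sup>2)"
      using h(2) unfolding dens by (subst (asm) integral_density) (auto simp: less_imp_le[OF Dn_pos])
    then have "(\<integral> y. Dn n y * ln (Dn n y) + 1 \<partial>G) = S n / (2 * s\<^sup>2) + 1"
      using i by (simp add: G.prob_space)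
    then show ?thesis using i x_ln_x_ge[OF less_imp_le[OF Dn_pos]]
      by (subst nn_integral_eq_integral) auto
  qed
  let ?K = "(\<Sum>i. (\<theta> i)\<^sup>2) / (2 * s\<^sup>2)"
  have SK: "S n / (2 * s\<^sup>2) \<le> ?K" for n
    unfolding S_def by (intro divide_right_mono sum_le_suminf sum) auto
  have "(\<integral>\<^sup>+ y. ennreal (D y * ln (D y) + 1) \<partial>G)
     = (\<integral>\<^sup>+ y. liminf (\<lambda>k. ennreal (Dn (r k) y * ln (Dn (r k) y) + 1)) \<partial>G)"
    using lim
  proof (intro nn_integral_cong_AE, eventually_elim)
    fix y assume l: "(\<lambda>k. Dn (r k) y) \<longlonglongrightarrow> D y"
    have "(\<lambda>k. Dn (r k) y * ln (Dn (r k) y)) \<longlonglongrightarrow> D y * ln (D y)"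
      using continuous_on_tendsto_compose[OF continuous_on_x_ln_x l] D0 less_imp_le[OF Dn_pos] by simp
    then have "(\<lambda>k. ennreal (Dn (r k) y * ln (Dn (r k) y) + 1)) \<longlonglongrightarrow> ennreal (D y * ln (D y) + 1)"
      by (intro tendsto_ennrealI tendsto_add tendsto_const)
    then show "ennreal (D y * ln (D y) + 1) = liminf (\<lambda>k. ennreal (Dn (r k) y * ln (Dn (r k) y) + 1))"
      by (intro lim_imp_Liminf[symmetric]) auto
  qed
  also have "\<dots> \<le> liminf (\<lambda>k. \<integral>\<^sup>+ y. ennreal (Dn (r k) y * ln (Dn (r k) y) + 1) \<partial>G)"
    by (rule nn_integral_liminf) measurable
  also have "\<dots> \<le> ennreal (?K + 1)"
    unfolding ent by (intro Liminf_le[OF sequentially_bot] always_eventually allI ennreal_leI add_right_mono SK)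
  finally have fin: "(\<integral>\<^sup>+ y. ennreal (D y * ln (D y) + 1) \<partial>G) \<le> ennreal (?K + 1)" .
  then have i1: "integrable G (\<lambda>y. D y * ln (D y) + 1)"
    using x_ln_x_ge[OF D0] by (subst integrable_iff_bounded) (auto intro: le_less_trans)
  from Bochner_Integration.integrable_diff[OF this, of "\<lambda>_. 1"]
  have i2: "integrable G (\<lambda>y. D y * ln (D y))" by simp
  have "ennreal (\<integral> y. D y * ln (D y) + 1 \<partial>G) \<le> ennreal (?K + 1)"
    using fin i1 x_ln_x_ge[OF D0] by (subst nn_integral_eq_integral[symmetric]) auto
  moreover have "0 \<le> ?K" by (intro divide_nonneg_nonneg suminf_nonneg sum) auto
  then have "0 \<le> ?K + 1" by simp
  ultimately have "(\<integral> y. D y * ln (D y) + 1 \<partial>G) \<le> ?K + 1" by (simp only: ennreal_le_iff)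
  then have le: "(\<integral> y. D y * ln (D y) \<partial>G) \<le> ?K"
    using i2 by (simp add: G.prob_space)
  show ?thesis
  proof (rule that[of D])
    show "gauss_seq \<theta> s = density (gauss_seq (\<lambda>_. 0) s) (\<lambda>y. ennreal (D y))"
      using eq by (simp add: gauss_seq_eq P_def G_def)
    show "integrable (gauss_seq \<theta> s) (\<lambda>y. ln (D y))"
      using i2 D0 unfolding gauss_seq_eq P_def[symmetric] eq[symmetric] by (subst integrable_density) auto
    show "(\<integral> y. ln (D y) \<partial>gauss_seq \<theta> s) \<le> ?K"
      using le D0 unfolding gauss_seq_eq P_def[symmetric] eq[symmetric] by (subst integral_density) auto
  qed (auto simp: D0)
qed

section \<open>Gaussian prediction in one coordinate\<close>

text \<open>The centred normal density, indexed by the variance because variances add under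
  convolution.\<close>

definition vnd :: "real \<Rightarrow> real \<Rightarrow> real" where
  "vnd V z = exp (- z\<^sup>2 / (2 * V)) / sqrt (2 * pi * V)"

lemma measurable_vnd [measurable]: "vnd V \<in> borel_measurable borel"
  unfolding vnd_def by measurable

lemma vnd_pos: "0 < V \<Longrightarrow> 0 < vnd V z"
  by (simp add: vnd_def)

lemma normal_density_eq_vnd: "normal_density m s x = vnd (s\<^sup>2) (x - m)"
  by (simp add: normal_density_def vnd_def)

lemma vnd_eq_normal_density: "0 < V \<Longrightarrow> vnd V z = normal_density 0 (sqrt V) z"
  by (simp add: normal_density_eq_vnd)

lemma vnd_minus: "vnd V (a - b) = vnd V (b - a)"
  by (simp add: vnd_def power2_commute)

lemma ln_vnd: "0 < V \<Longrightarrow> ln (vnd V z) = - ln (2 * pi * V) / 2 - z\<^sup>2 / (2 * V)"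
  by (simp add: vnd_def ln_div ln_sqrt ln_mult field_simps)

lemma nn_integral_vnd: "0 < V \<Longrightarrow> (\<integral>\<^sup>+ t. ennreal (vnd V (z - t)) \<partial>lborel) = 1"
  using prob_space.emeasure_space_1[OF prob_space_normal_density[of "sqrt V" z]]
  by (simp add: emeasure_density normal_density_eq_vnd vnd_minus[of V z])

lemma nn_integral_vnd_conv:
  assumes "0 < a" "0 < b"
  shows "(\<integral>\<^sup>+ t. ennreal (vnd a (x - t)) * ennreal (vnd b t) \<partial>lborel) = ennreal (vnd (a + b) x)"
  using conv_normal_density_zero_mean[of "sqrt a" "sqrt b", THEN fun_cong, of x] assms
  by (simp add: vnd_eq_normal_density ennreal_mult'[symmetric])

text \<open>The inverse of \<open>1 / v + 1 / u\<close>, the variance of the precision-weighted mean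
  \<open>pool\<close> of two observations of the same parameter.\<close>

definition pooled :: "real \<Rightarrow> real \<Rightarrow> real" where "pooled v u = v * u / (v + u)"

definition pool :: "real \<Rightarrow> real \<Rightarrow> real \<Rightarrow> real \<Rightarrow> real" where
  "pool v u x y = (u * x + v * y) / (v + u)"

lemma pooled_pos: "0 < v \<Longrightarrow> 0 < u \<Longrightarrow> 0 < pooled v u"
  by (simp add: pooled_def)

lemma pooled_less: "0 < v \<Longrightarrow> 0 < u \<Longrightarrow> pooled v u < v"
  by (simp add: pooled_def field_simps add_pos_pos)

lemma measurable_pool [measurable (raw)]:
  assumes [measurable]: "f \<in> borel_measurable M" "g \<in> borel_measurable M"
  shows "(\<lambda>z. pool v u (f z) (g z)) \<in> borel_measurable M"
  unfolding pool_def by measurable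

text \<open>Completing the square in \<open>t\<close>: the difference \<open>x - y\<close> carries
  no information about \<open>t\<close>, and the weighted mean is sufficient.\<close>

lemma vnd_pair:
  assumes v: "0 < v" and u: "0 < u"
  shows "vnd v (x - t) * vnd u (y - t) = vnd (v + u) (x - y) * vnd (pooled v u) (pool v u x y - t)"
proof -
  have vu: "v + u > 0" using v u by simp
  have e: "(x - t)\<^sup>2 / (2 * v) + (y - t)\<^sup>2 / (2 * u)
    = (x - y)\<^sup>2 / (2 * (v + u)) + (pool v u x y - t)\<^sup>2 / (2 * pooled v u)"
    using v u vu unfolding pooled_def pool_def
    by (simp add: divide_simps power2_eq_square) algebra
  have c: "sqrt (2 * pi * v) * sqrt (2 * pi * u) = sqrt (2 * pi * (v + u)) * sqrt (2 * pi * pooled v u)"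
    using vu by (simp add: real_sqrt_mult[symmetric] pooled_def)
  have "vnd v (x - t) * vnd u (y - t)
     = exp (- ((x - t)\<^sup>2 / (2 * v) + (y - t)\<^sup>2 / (2 * u))) / (sqrt (2 * pi * v) * sqrt (2 * pi * u))"
    by (simp add: vnd_def mult_exp_exp)
  also have "\<dots> = vnd (v + u) (x - y) * vnd (pooled v u) (pool v u x y - t)"
    unfolding e c by (simp add: vnd_def mult_exp_exp)
  finally show ?thesis .
qed

lemma nn_integral_vnd_pair:
  assumes v: "0 < v" and u: "0 < u" and \<tau>: "0 < \<tau>"
  shows "(\<integral>\<^sup>+ t. ennreal (vnd \<tau> t * (vnd v (x - t) * vnd u (y - t))) \<partial>lborel)
    = ennreal (vnd (v + u) (x - y) * vnd (pooled v u + \<tau>) (pool v u x y))"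
proof -
  have "(\<integral>\<^sup>+ t. ennreal (vnd \<tau> t * (vnd v (x - t) * vnd u (y - t))) \<partial>lborel)
    = (\<integral>\<^sup>+ t. ennreal (vnd (v + u) (x - y)) * (ennreal (vnd (pooled v u) (pool v u x y - t)) * ennreal (vnd \<tau> t)) \<partial>lborel)"
  proof (intro nn_integral_cong)
    fix t
    have "vnd \<tau> t * (vnd v (x - t) * vnd u (y - t))
      = vnd (v + u) (x - y) * (vnd (pooled v u) (pool v u x y - t) * vnd \<tau> t)"
      by (simp add: vnd_pair[OF v u])
    then show "ennreal (vnd \<tau> t * (vnd v (x - t) * vnd u (y - t))) = ennreal (vnd (v + u) (x - y))
        * (ennreal (vnd (pooled v u) (pool v u x y - t)) * ennreal (vnd \<tau> t))"
      using assms pooled_pos[OF v u] by (simp add: vnd_pos less_imp_le ennreal_mult'[symmetric])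
  qed
  also have "\<dots> = ennreal (vnd (v + u) (x - y)) * ennreal (vnd (pooled v u + \<tau>) (pool v u x y))"
    using assms pooled_pos[OF v u] by (subst nn_integral_cmult) (auto simp: nn_integral_vnd_conv)
  finally show ?thesis using assms pooled_pos[OF v u]
    by (simp add: vnd_pos less_imp_le ennreal_mult'[symmetric])
qed

text \<open>Equal to \<open>ln (1 + w / u) / 2\<close> with the posterior variance
  \<open>w = \<tau> * v / (\<tau> + v)\<close>: the Bayes risk of predicting one coordinate under
  the prior N(0, \<tau>). This form isolates the dependence on \<tau> in one quotient.\<close>

definition phi :: "real \<Rightarrow> real \<Rightarrow> real \<Rightarrow> real" where
  "phi v u \<tau> = (ln ((v + u) / u) + ln ((\<tau> + pooled v u) / (\<tau> + v))) / 2"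

definition dphi :: "real \<Rightarrow> real \<Rightarrow> real \<Rightarrow> real" where
  "dphi v u \<tau> = (1 / (\<tau> + pooled v u) - 1 / (\<tau> + v)) / 2"

context
  fixes v u :: real
  assumes v: "0 < v" and u: "0 < u"
begin

lemma phi_0: "phi v u 0 = 0"
proof -
  have "ln ((v + u) / u) + ln ((0 + pooled v u) / (0 + v)) = ln ((v + u) / u * ((0 + pooled v u) / (0 + v)))"
    using v u pooled_pos[OF v u] by (subst ln_mult) auto
  also have "(v + u) / u * ((0 + pooled v u) / (0 + v)) = 1"
    using v u add_pos_pos[OF v u] by (simp add: pooled_def)
  finally show ?thesis by (simp add: phi_def)
qed

lemma dphi_eq: "0 \<le> \<tau> \<Longrightarrow> dphi v u \<tau> = (v - pooled v u) / ((\<tau> + pooled v u) * (\<tau> + v)) / 2"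
  using v pooled_pos[OF v u] by (simp add: dphi_def divide_simps)

lemma dphi_nonneg: "0 \<le> \<tau> \<Longrightarrow> 0 \<le> dphi v u \<tau>"
  using v pooled_pos[OF v u] pooled_less[OF v u] by (simp add: dphi_eq)

text \<open>Concavity, from \<open>ln R \<le> R - 1\<close>. Replacing \<open>t + v\<close> by
  \<open>s + v\<close> in the denominator raises the quotient for either sign of
  \<open>t - s\<close>, whence the two cases.\<close>

lemma phi_tangent:
  assumes s: "0 \<le> s" and t: "0 \<le> t"
  shows "phi v u t \<le> phi v u s + dphi v u s * (t - s)"
proof -
  let ?p = "pooled v u"
  have p: "0 < ?p" "?p < v" using pooled_pos[OF v u] pooled_less[OF v u] .
  let ?R = "((t + ?p) / (t + v)) / ((s + ?p) / (s + v))"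
  have "ln ((t + ?p) / (t + v)) - ln ((s + ?p) / (s + v)) = ln ?R"
    using s t p v by (simp add: ln_div ln_mult)
  also have "\<dots> \<le> ?R - 1" using s t p v by (intro ln_le_minus_one) auto
  also have "\<dots> = (t - s) * (v - ?p) / ((s + ?p) * (t + v))"
    using s t p v by (simp add: divide_simps) (simp add: algebra_simps)
  also have "\<dots> \<le> (t - s) * (v - ?p) / ((s + ?p) * (s + v))"
  proof (cases "s \<le> t")
    case True
    then show ?thesis using s t p v by (intro divide_left_mono mult_left_mono mult_nonneg_nonneg mult_pos_pos) auto
  next
    case False
    have "(s - t) * (v - ?p) / ((s + ?p) * (s + v)) \<le> (s - t) * (v - ?p) / ((s + ?p) * (t + v))"
      using False s t p v by (intro divide_left_mono mult_left_mono mult_nonneg_nonneg mult_pos_pos) auto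
    moreover have "(t - s) * (v - ?p) / X = - ((s - t) * (v - ?p) / X)" for X
      by (simp add: minus_divide_left algebra_simps)
    ultimately show ?thesis by simp
  qed
  also have "\<dots> = 2 * (dphi v u s * (t - s))" using s by (simp add: dphi_eq)
  finally show ?thesis unfolding phi_def by argo
qed

lemma phi_mono:
  assumes "0 \<le> s" "s \<le> t" shows "phi v u s \<le> phi v u t"
  using phi_tangent[of t s] dphi_nonneg[of t] assms
    mult_nonneg_nonneg[of "dphi v u t" "t - s"] by (simp add: algebra_simps)

lemma phi_nonneg: "0 \<le> t \<Longrightarrow> 0 \<le> phi v u t"
  using phi_mono[of 0 t] by (simp add: phi_0)

lemma dphi_mult_le: "0 \<le> t \<Longrightarrow> t * dphi v u t \<le> phi v u t"
  using phi_tangent[of t 0] by (simp add: phi_0 algebra_simps)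

text \<open>Combined with \<open>dphi_mult_le\<close> this gives
  \<open>2 * (t * dphi v u t)^2 \<le> phi v u t\<close>, by which a prior variance is bounded by the
  Bayes risk itself.\<close>

lemma dphi_mult_le_half: "0 \<le> t \<Longrightarrow> 2 * (t * dphi v u t) \<le> 1"
proof -
  assume t: "0 \<le> t"
  have p: "0 < pooled v u" using pooled_pos[OF v u] .
  have "2 * (t * dphi v u t) = t / (t + pooled v u) - t / (t + v)"
    by (simp add: dphi_def right_diff_distrib mult.commute)
  also have "\<dots> \<le> 1 - 0" using t v p by (intro diff_mono) auto
  finally show ?thesis by simp
qed

text \<open>Concavity and \<open>phi_0\<close>: the tangent at \<open>c * t\<close> is combined with
  \<open>dphi_mult_le\<close>. A shrinkage of prior variances thus costs no more than its own
  factor.\<close>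

lemma phi_scale:
  assumes "0 \<le> t" "0 \<le> c" "c \<le> 1" shows "c * phi v u t \<le> phi v u (c * t)"
proof -
  have "phi v u t \<le> phi v u (c * t) + dphi v u (c * t) * (t - c * t)"
    using assms by (intro phi_tangent) auto
  then have "c * phi v u t \<le> c * (phi v u (c * t) + dphi v u (c * t) * (t - c * t))"
    using assms by (intro mult_left_mono) auto
  also have "\<dots> = c * phi v u (c * t) + (1 - c) * (c * t * dphi v u (c * t))"
    by (simp add: algebra_simps)
  also have "\<dots> \<le> c * phi v u (c * t) + (1 - c) * phi v u (c * t)"
    using assms by (intro add_left_mono mult_left_mono dphi_mult_le) auto
  finally show ?thesis by (simp add: algebra_simps)
qed

lemma phi_le_linear: "0 \<le> t \<Longrightarrow> phi v u t \<le> t / (2 * u)"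
proof -
  assume "0 \<le> t"
  moreover have "dphi v u 0 = 1 / (2 * u)" using v u by (simp add: dphi_def pooled_def field_simps)
  ultimately show ?thesis using phi_tangent[of 0 t] by (simp add: phi_0)
qed

lemma phi_le_const: "0 \<le> t \<Longrightarrow> phi v u t \<le> ln ((v + u) / u) / 2"
  using v pooled_pos[OF v u] pooled_less[OF v u] by (simp add: phi_def)

end

section \<open>The minimax lower bound\<close>

lemma gauss_prod_shift_finite_set:
  fixes s :: real
  assumes s: "0 < s" and F: "finite F"
  shows "gauss_prod (\<lambda>i. if i \<in> F then \<theta> i else 0) (\<lambda>_. s)
     = density (gauss_prod (\<lambda>_. 0) (\<lambda>_. s)) (\<lambda>y. ennreal (\<Prod>i\<in>F. shift_ratio s (\<theta> i) (y i)))"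
proof -
  have "gauss_prod (\<lambda>i. if i \<in> F then \<theta> i else 0) (\<lambda>_. s)
     = density (gauss_prod (\<lambda>_. 0) (\<lambda>_. s)) (\<lambda>y. \<Prod>i\<in>F. ennreal (shift_ratio s (\<theta> i) (y i)))"
    unfolding gauss_prod_def
  proof (rule PiM_density_finite)
    show "(\<lambda>y. ennreal (shift_ratio s (\<theta> i) y)) \<in> borel_measurable (gauss 0 s)" for i
      by measurable
  qed (auto simp: gauss_shift[OF s, symmetric] prob_space_gauss s F)
  then show ?thesis
    by (simp add: prod_ennreal less_imp_le[OF shift_ratio_pos])
qed

lemma gauss_centered_square:
  assumes s: "0 < s"
  shows "has_bochner_integral (gauss m s) (\<lambda>x. p * (x - q)\<^sup>2) (p * ((m - q)\<^sup>2 + s\<^sup>2))"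
  using gauss_quadratic[OF s, of m p "- 2 * p * q" "p * q\<^sup>2"]
  by (simp add: power2_eq_square algebra_simps)

text \<open>The logarithm of the ratio between the true density of a future coordinate \<open>y\<close> and its
  posterior predictive density given \<open>x\<close> under the prior \<open>N(0, \<tau>)\<close>.\<close>

definition log_ratio :: "real \<Rightarrow> real \<Rightarrow> real \<Rightarrow> real \<Rightarrow> real \<Rightarrow> real \<Rightarrow> real" where
  "log_ratio v u \<tau> t x y = ln (vnd u (y - t)) - ln (vnd (v + u) (x - y))
     - ln (vnd (pooled v u + \<tau>) (pool v u x y)) + ln (vnd (v + \<tau>) x)"

text \<open>The mean of \<open>log_ratio\<close> over \<open>y\<close> with mean \<open>t\<close>
  and variance \<open>u\<close>. The \<open>- 1\<close> comes from \<open>(y - t)^2 / u\<close>, and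
  \<open>t + u * x / v\<close> is, up to the factor \<open>v / (v + u)\<close>, the mean of
  \<open>pool v u x y\<close>.\<close>

definition log_ratio_mean :: "real \<Rightarrow> real \<Rightarrow> real \<Rightarrow> real \<Rightarrow> real \<Rightarrow> real" where
  "log_ratio_mean v u \<tau> t x =
     (ln (2 * pi * (v + u)) - ln (2 * pi * u) + ln (2 * pi * (pooled v u + \<tau>)) - ln (2 * pi * (v + \<tau>)) - 1) / 2
     + ((x - t)\<^sup>2 + u) / (2 * (v + u))
     + ((v / (v + u))\<^sup>2 * ((t + u * x / v)\<^sup>2 + u)) / (2 * (pooled v u + \<tau>)) - x\<^sup>2 / (2 * (v + \<tau>))"

lemma pool_sq:
  assumes "0 < v" "0 < u"
  shows "(pool v u x y)\<^sup>2 = (v / (v + u))\<^sup>2 * (y - (- (u * x / v)))\<^sup>2"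
proof -
  have "pool v u x y = v / (v + u) * (y - (- (u * x / v)))"
  proof -
    have "v * (y - (- (u * x / v))) = u * x + v * y" using assms by (simp add: distrib_left)
    then show ?thesis by (simp add: pool_def)
  qed
  then show ?thesis by (simp add: power_mult_distrib power_divide)
qed

lemma log_ratio_integral_y:
  fixes e e2 t x \<tau> :: real
  assumes e: "0 < e" and e2: "0 < e2" and \<tau>: "0 < \<tau>"
  defines "v \<equiv> e\<^sup>2" and "u \<equiv> e2\<^sup>2"
  shows "has_bochner_integral (gauss t e2) (log_ratio v u \<tau> t x) (log_ratio_mean v u \<tau> t x)"
proof -
  have v: "0 < v" and u: "0 < u" using e e2 by (auto simp: v_def u_def)
  have p: "0 < pooled v u" using pooled_pos[OF v u] .
  let ?c = "(ln (2 * pi * (v + u)) - ln (2 * pi * u) + ln (2 * pi * (pooled v u + \<tau>)) - ln (2 * pi * (v + \<tau>))) / 2 - x\<^sup>2 / (2 * (v + \<tau>))"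
  let ?a = "- 1 / (2 * u)" and ?b = "1 / (2 * (v + u))" and ?d = "(v / (v + u))\<^sup>2 / (2 * (pooled v u + \<tau>))"
  have "has_bochner_integral (gauss t e2)
     (\<lambda>y. ?a * (y - t)\<^sup>2 + (?b * (y - x)\<^sup>2 + (?d * (y - (- (u * x / v)))\<^sup>2 + ?c)))
     (?a * ((t - t)\<^sup>2 + e2\<^sup>2) + (?b * ((t - x)\<^sup>2 + e2\<^sup>2) + (?d * ((t - (- (u * x / v)))\<^sup>2 + e2\<^sup>2) + ?c)))"
    by (intro has_bochner_integral_add gauss_centered_square gauss_moments(5) e2)
  also have "(\<lambda>y. ?a * (y - t)\<^sup>2 + (?b * (y - x)\<^sup>2 + (?d * (y - (- (u * x / v)))\<^sup>2 + ?c)))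
    = log_ratio v u \<tau> t x"
  proof
    fix y
    show "?a * (y - t)\<^sup>2 + (?b * (y - x)\<^sup>2 + (?d * (y - (- (u * x / v)))\<^sup>2 + ?c)) = log_ratio v u \<tau> t x y"
      using v u p \<tau> pool_sq[OF v u, of x y]
      by (simp add: log_ratio_def ln_vnd power2_commute[of x y] diff_divide_distrib add_divide_distrib)
  qed
  also have "?a * ((t - t)\<^sup>2 + e2\<^sup>2) + (?b * ((t - x)\<^sup>2 + e2\<^sup>2) + (?d * ((t - (- (u * x / v)))\<^sup>2 + e2\<^sup>2) + ?c))
     = log_ratio_mean v u \<tau> t x"
    using v u p \<tau> unfolding u_def[symmetric]
    by (simp add: log_ratio_mean_def power2_commute[of x t] diff_divide_distrib add_divide_distrib)
  finally show ?thesis .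
qed

text \<open>The second moment of \<open>pool\<close> when \<open>x\<close> and \<open>y\<close> have
  the common mean \<open>t\<close>, in the shape left by integrating first over \<open>y\<close> and
  then over \<open>x\<close>.\<close>

lemma pooled_variance:
  assumes v: "0 < v" and u: "0 < (u::real)"
  shows "(v / (v + u))\<^sup>2 * ((u / v)\<^sup>2 * ((t - (- (v * t / u)))\<^sup>2 + v) + u) = t\<^sup>2 + pooled v u"
proof -
  have vu: "v + u \<noteq> 0" using v u by simp
  have "t - (- (v * t / u)) = t * (v + u) / u" using u by (simp add: field_simps)
  then have "(u / v)\<^sup>2 * ((t - (- (v * t / u)))\<^sup>2 + v) = (t\<^sup>2 * (v + u)\<^sup>2 + u\<^sup>2 * v) / v\<^sup>2"
    using u v by (simp add: power_divide power_mult_distrib field_simps) (simp add: power2_eq_square algebra_simps)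
  then have "(v / (v + u))\<^sup>2 * ((u / v)\<^sup>2 * ((t - (- (v * t / u)))\<^sup>2 + v) + u)
     = v\<^sup>2 * ((t\<^sup>2 * (v + u)\<^sup>2 + u\<^sup>2 * v) / v\<^sup>2 + u) / (v + u)\<^sup>2"
    by (simp only: power_divide times_divide_eq_left)
  also have "v\<^sup>2 * ((t\<^sup>2 * (v + u)\<^sup>2 + u\<^sup>2 * v) / v\<^sup>2 + u) = t\<^sup>2 * (v + u)\<^sup>2 + (u\<^sup>2 * v + u * v\<^sup>2)"
    using v by (simp add: field_simps)
  also have "u\<^sup>2 * v + u * v\<^sup>2 = v * u * (v + u)" by (simp add: power2_eq_square algebra_simps)
  also have "(t\<^sup>2 * (v + u)\<^sup>2 + v * u * (v + u)) / (v + u)\<^sup>2 = t\<^sup>2 + pooled v u"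
    using vu by (simp add: pooled_def add_divide_distrib power2_eq_square)
  finally show ?thesis .
qed

text \<open>All quadratic terms have explicit means, and the risk at \<open>t\<close> of the Bayes
  rule of N(0, \<tau>) turns out to be affine in \<open>t^2\<close>: the tangent of
  \<open>phi\<close> at \<tau>.\<close>

lemma log_ratio_integral_x:
  fixes e e2 t \<tau> :: real
  assumes e: "0 < e" and e2: "0 < e2" and \<tau>: "0 < \<tau>"
  defines "v \<equiv> e\<^sup>2" and "u \<equiv> e2\<^sup>2"
  shows "has_bochner_integral (gauss t e) (log_ratio_mean v u \<tau> t) (phi v u \<tau> + dphi v u \<tau> * (t\<^sup>2 - \<tau>))"
proof -
  have v: "0 < v" and u: "0 < u" using e e2 by (auto simp: v_def u_def)
  have p: "0 < pooled v u" using pooled_pos[OF v u] .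
  have vu: "0 < v + u" using v u by simp
  define C where "C = (ln (2 * pi * (v + u)) - ln (2 * pi * u) + ln (2 * pi * (pooled v u + \<tau>)) - ln (2 * pi * (v + \<tau>)) - 1) / 2"
  define b where "b = 1 / (2 * (v + u))"
  define k where "k = 1 / (2 * (pooled v u + \<tau>))"
  define r where "r = (v / (v + u))\<^sup>2"
  define l where "l = 1 / (2 * (v + \<tau>))"
  have "has_bochner_integral (gauss t e)
     (\<lambda>x. b * (x - t)\<^sup>2 + (k * r * (u / v)\<^sup>2 * (x - (- (v * t / u)))\<^sup>2 + ((- l) * (x - 0)\<^sup>2 + (C + b * u + k * r * u))))
     (b * ((t - t)\<^sup>2 + e\<^sup>2) + (k * r * (u / v)\<^sup>2 * ((t - (- (v * t / u)))\<^sup>2 + e\<^sup>2)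
       + ((- l) * ((t - 0)\<^sup>2 + e\<^sup>2) + (C + b * u + k * r * u))))"
    by (intro has_bochner_integral_add gauss_centered_square gauss_moments(5) e)
  also have "(\<lambda>x. b * (x - t)\<^sup>2 + (k * r * (u / v)\<^sup>2 * (x - (- (v * t / u)))\<^sup>2 + ((- l) * (x - 0)\<^sup>2 + (C + b * u + k * r * u))))
    = log_ratio_mean v u \<tau> t"
  proof
    fix x
    have "t + u * x / v = u / v * (x - (- (v * t / u)))" using v u by (simp add: field_simps)
    then have "(t + u * x / v)\<^sup>2 = (u / v)\<^sup>2 * (x - (- (v * t / u)))\<^sup>2" by (simp add: power_mult_distrib power_divide)
    then show "b * (x - t)\<^sup>2 + (k * r * (u / v)\<^sup>2 * (x - (- (v * t / u)))\<^sup>2 + ((- l) * (x - 0)\<^sup>2 + (C + b * u + k * r * u)))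
        = log_ratio_mean v u \<tau> t x"
      unfolding log_ratio_mean_def C_def[symmetric] r_def[symmetric]
      by (simp add: b_def k_def l_def diff_divide_distrib add_divide_distrib distrib_left)
  qed
  also have "b * ((t - t)\<^sup>2 + e\<^sup>2) + (k * r * (u / v)\<^sup>2 * ((t - (- (v * t / u)))\<^sup>2 + e\<^sup>2)
       + ((- l) * ((t - 0)\<^sup>2 + e\<^sup>2) + (C + b * u + k * r * u)))
     = C + b * (v + u) + k * (r * ((u / v)\<^sup>2 * ((t - (- (v * t / u)))\<^sup>2 + v) + u)) - l * (t\<^sup>2 + v)"
    unfolding v_def[symmetric] by (simp add: algebra_simps)
  also have "\<dots> = C + 1 / 2 + k * (t\<^sup>2 + pooled v u) - l * (t\<^sup>2 + v)"
    unfolding r_def pooled_variance[OF v u] using vu by (simp add: b_def)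
  also have "\<dots> = phi v u \<tau> + dphi v u \<tau> * (t\<^sup>2 - \<tau>)"
  proof -
    have "C = phi v u \<tau> - 1 / 2"
    proof -
      have l: "ln (2 * pi * z) = ln (2 * pi) + ln z" if "0 < z" for z :: real
        using that by (simp add: ln_mult)
      have "ln ((v + u) / u) = ln (v + u) - ln u"
        "ln ((\<tau> + pooled v u) / (\<tau> + v)) = ln (pooled v u + \<tau>) - ln (v + \<tau>)"
        using v u p \<tau> vu by (auto simp: ln_div add.commute)
      then show ?thesis
        using l[OF vu] l[OF u] l[of "pooled v u + \<tau>"] l[of "v + \<tau>"] v p \<tau>
        unfolding C_def phi_def by simp
    qed
    moreover have "k * (t\<^sup>2 + pooled v u) = k * (t\<^sup>2 - \<tau>) + 1 / 2"
      using p \<tau> by (simp add: k_def divide_simps) (simp add: algebra_simps)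
    moreover have "l * (t\<^sup>2 + v) = l * (t\<^sup>2 - \<tau>) + 1 / 2"
      using v \<tau> by (simp add: l_def divide_simps) (simp add: algebra_simps)
    moreover have "dphi v u \<tau> = k - l" by (simp add: dphi_def k_def l_def add.commute diff_divide_distrib mult.commute[of _ 2])
    ultimately show ?thesis by (simp add: left_diff_distrib)
  qed
  finally show ?thesis .
qed

lemma exp_log_ratio:
  assumes v: "0 < v" and u: "0 < u" and \<tau>: "0 < \<tau>"
  shows "exp (log_ratio v u \<tau> t x y) = vnd u (y - t) * vnd (v + \<tau>) x
      / (vnd (v + u) (x - y) * vnd (pooled v u + \<tau>) (pool v u x y))"
  using v u \<tau> pooled_pos[OF v u]
  by (simp add: log_ratio_def exp_add exp_diff vnd_pos add_pos_pos)

text \<open>Bayes' rule: averaging the density of \<open>y\<close> against likelihood and prior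
  gives the joint marginal of \<open>x\<close> and \<open>y\<close>, and division by the predictive
  density leaves the marginal of \<open>x\<close>. The result is free of \<open>y\<close>, hence
  indifferent to the competing predictive law.\<close>

lemma log_ratio_integral_prior:
  fixes e e2 x y \<tau> :: real
  assumes e: "0 < e" and e2: "0 < e2" and \<tau>: "0 < \<tau>"
  defines "v \<equiv> e\<^sup>2" and "u \<equiv> e2\<^sup>2"
  shows "(\<integral>\<^sup>+ t. ennreal (shift_ratio e t x * exp (log_ratio v u \<tau> t x y)) \<partial>gauss 0 (sqrt \<tau>))
     = ennreal (vnd (v + \<tau>) x / vnd v x)"
proof -
  have v: "0 < v" and u: "0 < u" using e e2 by (auto simp: v_def u_def)
  have p: "0 < pooled v u" using pooled_pos[OF v u] .
  let ?A = "vnd (v + \<tau>) x / (vnd v x * vnd (v + u) (x - y) * vnd (pooled v u + \<tau>) (pool v u x y))"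
  have pos: "0 < vnd v x" "0 < vnd (v + \<tau>) x" "0 < vnd (v + u) (x - y)" "0 < vnd (pooled v u + \<tau>) (pool v u x y)"
    using v u \<tau> p by (auto intro!: vnd_pos)
  have sr: "shift_ratio e t x = vnd v (x - t) / vnd v x" for t
    using normal_density_shift[OF e, of x t] pos(1) by (simp add: normal_density_eq_vnd v_def field_simps)
  have [measurable]: "(\<lambda>t. shift_ratio e t x * exp (log_ratio v u \<tau> t x y)) \<in> borel_measurable borel"
    unfolding shift_ratio_def log_ratio_def by measurable
  have "(\<integral>\<^sup>+ t. ennreal (shift_ratio e t x * exp (log_ratio v u \<tau> t x y)) \<partial>gauss 0 (sqrt \<tau>))
    = (\<integral>\<^sup>+ t. ennreal (vnd \<tau> t) * ennreal (shift_ratio e t x * exp (log_ratio v u \<tau> t x y)) \<partial>lborel)"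
    unfolding gauss_def using \<tau> by (subst nn_integral_density) (auto simp: normal_density_eq_vnd)
  also have "\<dots> = (\<integral>\<^sup>+ t. ennreal ?A * ennreal (vnd \<tau> t * (vnd v (x - t) * vnd u (y - t))) \<partial>lborel)"
  proof (intro nn_integral_cong)
    fix t
    have "vnd \<tau> t * (shift_ratio e t x * exp (log_ratio v u \<tau> t x y)) = ?A * (vnd \<tau> t * (vnd v (x - t) * vnd u (y - t)))"
      unfolding exp_log_ratio[OF v u \<tau>] sr by (simp add: ac_simps)
    then show "ennreal (vnd \<tau> t) * ennreal (shift_ratio e t x * exp (log_ratio v u \<tau> t x y))
        = ennreal ?A * ennreal (vnd \<tau> t * (vnd v (x - t) * vnd u (y - t)))"
      using pos \<tau> by (subst (1 2) ennreal_mult'[symmetric]) (auto simp: vnd_pos less_imp_le)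
  qed
  also have "\<dots> = ennreal ?A * ennreal (vnd (v + u) (x - y) * vnd (pooled v u + \<tau>) (pool v u x y))"
    by (subst nn_integral_cmult) (auto simp: nn_integral_vnd_pair[OF v u \<tau>])
  also have "\<dots> = ennreal (vnd (v + \<tau>) x / vnd v x)"
    using pos by (subst ennreal_mult'[symmetric]) (auto simp: field_simps)
  finally show ?thesis .
qed

lemma nn_integral_vnd_ratio:
  fixes e \<tau> :: real
  assumes e: "0 < e" and \<tau>: "0 < \<tau>"
  shows "(\<integral>\<^sup>+ x. ennreal (vnd (e\<^sup>2 + \<tau>) x / vnd (e\<^sup>2) x) \<partial>gauss 0 e) = 1"
proof -
  have "(\<integral>\<^sup>+ x. ennreal (vnd (e\<^sup>2 + \<tau>) x / vnd (e\<^sup>2) x) \<partial>gauss 0 e)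
     = (\<integral>\<^sup>+ x. ennreal (vnd (e\<^sup>2) x) * ennreal (vnd (e\<^sup>2 + \<tau>) x / vnd (e\<^sup>2) x) \<partial>lborel)"
    unfolding gauss_def by (subst nn_integral_density) (auto simp: normal_density_eq_vnd)
  also have "\<dots> = (\<integral>\<^sup>+ x. ennreal (vnd (e\<^sup>2 + \<tau>) (0 - x)) \<partial>lborel)"
  proof (intro nn_integral_cong)
    fix x
    have "0 < vnd (e\<^sup>2) x" using e by (intro vnd_pos) simp
    moreover have "vnd (e\<^sup>2 + \<tau>) (0 - x) = vnd (e\<^sup>2 + \<tau>) x" by (simp add: vnd_def)
    ultimately show "ennreal (vnd (e\<^sup>2) x) * ennreal (vnd (e\<^sup>2 + \<tau>) x / vnd (e\<^sup>2) x) = ennreal (vnd (e\<^sup>2 + \<tau>) (0 - x))"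
      by (subst ennreal_mult'[symmetric]) auto
  qed
  also have "\<dots> = 1" using e \<tau> by (intro nn_integral_vnd) (auto intro: add_pos_pos)
  finally show ?thesis .
qed

lemma ennreal_integral_le_nn_integral:
  assumes f: "integrable M f"
  shows "ennreal (\<integral>x. f x \<partial>M) \<le> (\<integral>\<^sup>+ x. ennreal (f x) \<partial>M)"
proof -
  have "ennreal (\<integral>x. f x \<partial>M) \<le> ennreal (\<integral>x. max 0 (f x) \<partial>M)"
    using f by (intro ennreal_leI integral_mono) auto
  also have "\<dots> = (\<integral>\<^sup>+ x. ennreal (max 0 (f x)) \<partial>M)"
    using f by (subst nn_integral_eq_integral) auto
  also have "\<dots> = (\<integral>\<^sup>+ x. ennreal (f x) \<partial>M)"
    by (intro nn_integral_cong) (auto simp: max_def ennreal_neg)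
  finally show ?thesis .
qed

text \<open>Zeroing the coordinates outside a finite set makes draws from the prior square summable
  and their likelihood a finite product.\<close>

definition restrict_seq :: "nat set \<Rightarrow> rseq \<Rightarrow> rseq" where
  "restrict_seq F \<theta> = (\<lambda>i. if i \<in> F then \<theta> i else 0)"

context
  fixes e e2 v u :: real and F :: "nat set" and \<tau> :: rseq
  assumes e: "0 < e" and e2: "0 < e2" and F: "finite F" and \<tau>: "\<And>i. 0 < \<tau> i"
    and v_def: "v = e\<^sup>2" and u_def: "u = e2\<^sup>2"
begin

text \<open>\<open>KL_loss_ge\<close> with the Gaussian log ratio as test function, applied at each
  \<open>x\<close> and then integrated over \<open>x\<close>.\<close>

lemma risk_plus_prior_term_ge:
  fixes Qh :: "rseq \<Rightarrow> rseq measure"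
  assumes Qh: "Qh \<in> pred_rules"
  shows "ennreal ((\<Sum>i\<in>F. phi v u (\<tau> i) + dphi v u (\<tau> i) * ((\<theta> i)\<^sup>2 - \<tau> i)) + 1)
    \<le> risk e e2 \<theta> Qh + (\<integral>\<^sup>+ x. \<integral>\<^sup>+ y. ennreal (exp (\<Sum>i\<in>F. log_ratio v u (\<tau> i) (\<theta> i) (x i) (y i))) \<partial>Qh x \<partial>gauss_seq \<theta> e)"
proof -
  let ?P = "gauss_seq \<theta> e" and ?Q = "gauss_seq \<theta> e2"
  define g where "g x y = (\<Sum>i\<in>F. log_ratio v u (\<tau> i) (\<theta> i) (x i) (y i))" for x y :: rseq
  define a where "a x = (\<Sum>i\<in>F. log_ratio_mean v u (\<tau> i) (\<theta> i) (x i))" for x :: rseq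
  define W where "W x = (\<integral>\<^sup>+ y. ennreal (exp (g x y)) \<partial>Qh x)" for x
  have [measurable]: "Qh \<in> Rinf \<rightarrow>\<^sub>M prob_algebra Rinf" using Qh by (simp add: pred_rules_def)
  have Qh_sub[measurable]: "Qh \<in> Rinf \<rightarrow>\<^sub>M subprob_algebra Rinf" by (rule measurable_prob_algebraD) fact
  have Qx: "prob_space (Qh x)" "sets (Qh x) = sets Rinf" for x
    using measurable_space[of Qh Rinf "prob_algebra Rinf" x] by (auto simp: space_prob_algebra)
  interpret P: prob_space ?P unfolding gauss_seq_eq by (intro prob_space_gauss_prod e)
  interpret Q: prob_space ?Q unfolding gauss_seq_eq by (intro prob_space_gauss_prod e2)
  have [measurable_cong]: "sets ?P = sets Rinf" by (simp add: gauss_seq_eq)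
  have [measurable]: "(\<lambda>(x, y). ennreal (exp (g x y))) \<in> borel_measurable (Rinf \<Otimes>\<^sub>M Rinf)"
    unfolding g_def log_ratio_def by measurable
  have [measurable]: "W \<in> borel_measurable Rinf"
    unfolding W_def by (rule nn_integral_measurable_subprob_algebra2[OF _ Qh_sub]) measurable
  have hy: "has_bochner_integral ?Q (g x) (a x)" for x
    unfolding g_def a_def gauss_seq_eq v_def u_def
    by (intro gauss_prod_sum log_ratio_integral_y e e2 \<tau>)
  have hx: "has_bochner_integral ?P a (\<Sum>i\<in>F. phi v u (\<tau> i) + dphi v u (\<tau> i) * ((\<theta> i)\<^sup>2 - \<tau> i))"
    unfolding a_def gauss_seq_eq v_def u_def
    by (intro gauss_prod_sum log_ratio_integral_x e e2 \<tau>)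
  have KL: "ennreal (a x + 1) \<le> KL_loss ?Q (Qh x) + W x" for x
    using KL_loss_ge[of "Qh x" ?Q "g x"] hy[of x] Qx[of x] Q.prob_space_axioms
    by (auto simp: W_def has_bochner_integral_iff gauss_seq_eq)
  have [measurable]: "a \<in> borel_measurable Rinf"
    unfolding a_def log_ratio_mean_def by measurable
  have Ia: "integrable ?P (\<lambda>x. a x + 1)" and Ia': "(\<integral>x. a x + 1 \<partial>?P) = (\<Sum>i\<in>F. phi v u (\<tau> i) + dphi v u (\<tau> i) * ((\<theta> i)\<^sup>2 - \<tau> i)) + 1"
    using hx by (auto simp: has_bochner_integral_iff P.prob_space)
  have "ennreal (\<integral>x. a x + 1 \<partial>?P) \<le> (\<integral>\<^sup>+ x. ennreal (a x + 1) \<partial>?P)"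
    by (rule ennreal_integral_le_nn_integral[OF Ia])
  \<comment> \<open>The loss is not known to be measurable in \<open>x\<close>, so the integral is
    split for its measurable lower bound \<open>ennreal (a x + 1) - W x\<close>; truncated
    subtraction makes this an inequality.\<close>
  also have "\<dots> \<le> (\<integral>\<^sup>+ x. (ennreal (a x + 1) - W x) + W x \<partial>?P)"
    by (intro nn_integral_mono) (metis add.commute ennreal_minus_le_iff order_refl add_diff_self_ennreal le_cases diff_eq_0_ennreal zero_le add_increasing)
  also have "\<dots> = (\<integral>\<^sup>+ x. (ennreal (a x + 1) - W x) \<partial>?P) + (\<integral>\<^sup>+ x. W x \<partial>?P)"
    by (intro nn_integral_add) measurable
  also have "\<dots> \<le> (\<integral>\<^sup>+ x. KL_loss ?Q (Qh x) \<partial>?P) + (\<integral>\<^sup>+ x. W x \<partial>?P)"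
    using KL by (intro add_right_mono nn_integral_mono) (simp add: ennreal_minus_le_iff add.commute)
  finally show ?thesis
    unfolding Ia' risk_def W_def g_def .
qed

text \<open>After a change to centred noise, Tonelli brings the prior integral innermost, where
  \<open>log_ratio_integral_prior\<close> removes \<open>y\<close> coordinate by coordinate. The
  exponential term of a competitor thus averages to exactly 1, whatever \<open>Qh\<close>
  is.\<close>

lemma nn_integral_prior_term:
  fixes Qh :: "rseq \<Rightarrow> rseq measure"
  assumes Qh: "Qh \<in> pred_rules"
  defines "W \<equiv> \<lambda>\<theta>. (\<integral>\<^sup>+ x. \<integral>\<^sup>+ y. ennreal (exp (\<Sum>i\<in>F. log_ratio v u (\<tau> i) (\<theta> i) (x i) (y i))) \<partial>Qh x \<partial>gauss_seq \<theta> e)"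
  shows "(\<lambda>\<theta>. W (restrict_seq F \<theta>)) \<in> borel_measurable Rinf"
    and "(\<integral>\<^sup>+ \<theta>. W (restrict_seq F \<theta>) \<partial>gauss_prod (\<lambda>_. 0) (\<lambda>i. sqrt (\<tau> i))) = 1"
proof -
  let ?\<pi> = "gauss_prod (\<lambda>_. 0) (\<lambda>i. sqrt (\<tau> i))" and ?G = "gauss_prod (\<lambda>_. 0) (\<lambda>_. e)"
  have [measurable]: "Qh \<in> Rinf \<rightarrow>\<^sub>M prob_algebra Rinf" using Qh by (simp add: pred_rules_def)
  have Qh_sub[measurable]: "Qh \<in> Rinf \<rightarrow>\<^sub>M subprob_algebra Rinf" by (rule measurable_prob_algebraD) fact
  have Qx: "prob_space (Qh x)" "sets (Qh x) = sets Rinf" for x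
    using measurable_space[of Qh Rinf "prob_algebra Rinf" x] by (auto simp: space_prob_algebra)
  interpret p: prob_space ?\<pi> by (intro prob_space_gauss_prod) (simp add: \<tau>)
  interpret G: prob_space ?G by (intro prob_space_gauss_prod e)
  interpret pG: pair_sigma_finite ?\<pi> ?G ..
  define f where "f \<theta> x y = (\<Prod>i\<in>F. shift_ratio e (\<theta> i) (x i) * exp (log_ratio v u (\<tau> i) (\<theta> i) (x i) (y i)))"
    for \<theta> x y :: rseq
  have f_meas: "(\<lambda>z. ennreal (f (fst (fst z)) (snd (fst z)) (snd z))) \<in> borel_measurable ((Rinf \<Otimes>\<^sub>M Rinf) \<Otimes>\<^sub>M Rinf)"
    unfolding f_def log_ratio_def shift_ratio_def by measurable
  have f_meas_y: "(\<lambda>y. ennreal (f \<theta> x y)) \<in> borel_measurable Rinf" for \<theta> x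
    unfolding f_def log_ratio_def shift_ratio_def by measurable
  have f_meas_ty: "(\<lambda>(\<theta>, y). ennreal (f \<theta> x y)) \<in> borel_measurable (Rinf \<Otimes>\<^sub>M Rinf)" for x
    unfolding f_def log_ratio_def shift_ratio_def by measurable
  have Y_meas: "(\<lambda>(\<theta>, x). \<integral>\<^sup>+ y. ennreal (f \<theta> x y) \<partial>Qh x) \<in> borel_measurable (Rinf \<Otimes>\<^sub>M Rinf)"
  proof -
    have "(\<lambda>z. \<integral>\<^sup>+ y. ennreal (f (fst z) (snd z) y) \<partial>Qh (snd z)) \<in> borel_measurable (Rinf \<Otimes>\<^sub>M Rinf)"
      by (rule nn_integral_measurable_subprob_algebra2[where N=Rinf])
        (use f_meas in \<open>auto simp: split_beta'\<close>)
    then show ?thesis by (simp add: split_beta')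
  qed
  have W: "W (restrict_seq F \<theta>) = (\<integral>\<^sup>+ x. \<integral>\<^sup>+ y. ennreal (f \<theta> x y) \<partial>Qh x \<partial>?G)" for \<theta>
  proof -
    have d: "gauss_prod (restrict_seq F \<theta>) (\<lambda>_. e)
        = density ?G (\<lambda>y. ennreal (\<Prod>i\<in>F. shift_ratio e (\<theta> i) (y i)))"
      using gauss_prod_shift_finite_set[OF e F] by (simp add: restrict_seq_def)
    have m: "(\<lambda>x. \<integral>\<^sup>+ y. ennreal (exp (\<Sum>i\<in>F. log_ratio v u (\<tau> i) (restrict_seq F \<theta> i) (x i) (y i))) \<partial>Qh x) \<in> borel_measurable Rinf"
      by (rule nn_integral_measurable_subprob_algebra2[OF _ Qh_sub]) (unfold log_ratio_def, measurable)
    have m2: "(\<lambda>y. ennreal (exp (\<Sum>i\<in>F. log_ratio v u (\<tau> i) (restrict_seq F \<theta> i) (x i) (y i)))) \<in> borel_measurable (Qh x)" for x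
      unfolding log_ratio_def measurable_cong_sets[OF Qx(2) refl] by measurable
    have "W (restrict_seq F \<theta>) = (\<integral>\<^sup>+ x. ennreal (\<Prod>i\<in>F. shift_ratio e (\<theta> i) (x i)) *
       (\<integral>\<^sup>+ y. ennreal (exp (\<Sum>i\<in>F. log_ratio v u (\<tau> i) (restrict_seq F \<theta> i) (x i) (y i))) \<partial>Qh x) \<partial>?G)"
      unfolding W_def gauss_seq_eq
      unfolding d by (subst nn_integral_density) (use m in \<open>auto cong: measurable_cong_sets\<close>)
    also have "\<dots> = (\<integral>\<^sup>+ x. \<integral>\<^sup>+ y. ennreal (f \<theta> x y) \<partial>Qh x \<partial>?G)"
    proof (intro nn_integral_cong)
      fix x
      have "ennreal (\<Prod>i\<in>F. shift_ratio e (\<theta> i) (x i)) *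
        (\<integral>\<^sup>+ y. ennreal (exp (\<Sum>i\<in>F. log_ratio v u (\<tau> i) (restrict_seq F \<theta> i) (x i) (y i))) \<partial>Qh x)
        = (\<integral>\<^sup>+ y. ennreal (\<Prod>i\<in>F. shift_ratio e (\<theta> i) (x i)) *
           ennreal (exp (\<Sum>i\<in>F. log_ratio v u (\<tau> i) (restrict_seq F \<theta> i) (x i) (y i))) \<partial>Qh x)"
        by (rule nn_integral_cmult[OF m2, symmetric])
      also have "\<dots> = (\<integral>\<^sup>+ y. ennreal (f \<theta> x y) \<partial>Qh x)"
        by (intro nn_integral_cong)
          (simp add: ennreal_mult'[symmetric] prod_nonneg less_imp_le[OF shift_ratio_pos] f_def exp_sum[OF F] prod.distrib restrict_seq_def)
      finally show "ennreal (\<Prod>i\<in>F. shift_ratio e (\<theta> i) (x i)) *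
        (\<integral>\<^sup>+ y. ennreal (exp (\<Sum>i\<in>F. log_ratio v u (\<tau> i) (restrict_seq F \<theta> i) (x i) (y i))) \<partial>Qh x)
        = (\<integral>\<^sup>+ y. ennreal (f \<theta> x y) \<partial>Qh x)" .
    qed
    finally show ?thesis .
  qed
  have Y_meas': "(\<lambda>(\<theta>, x). \<integral>\<^sup>+ y. ennreal (f \<theta> x y) \<partial>Qh x) \<in> borel_measurable (?\<pi> \<Otimes>\<^sub>M ?G)"
    using Y_meas by (simp cong: measurable_cong_sets sets_pair_measure_cong)
  show "(\<lambda>\<theta>. W (restrict_seq F \<theta>)) \<in> borel_measurable Rinf"
  proof -
    have "(\<lambda>\<theta>. \<integral>\<^sup>+ x. (\<integral>\<^sup>+ y. ennreal (f \<theta> x y) \<partial>Qh x) \<partial>?G) \<in> borel_measurable ?\<pi>"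
      using G.borel_measurable_nn_integral[OF Y_meas'] by simp
    then show ?thesis unfolding W by (simp cong: measurable_cong_sets)
  qed
  have "(\<integral>\<^sup>+ \<theta>. W (restrict_seq F \<theta>) \<partial>?\<pi>) = (\<integral>\<^sup>+ x. \<integral>\<^sup>+ \<theta>. \<integral>\<^sup>+ y. ennreal (f \<theta> x y) \<partial>Qh x \<partial>?\<pi> \<partial>?G)"
    unfolding W using pG.Fubini[OF Y_meas'] by simp
  also have "\<dots> = (\<integral>\<^sup>+ x. \<integral>\<^sup>+ y. (\<Prod>i\<in>F. ennreal (vnd (v + \<tau> i) (x i) / vnd v (x i))) \<partial>Qh x \<partial>?G)"
  proof (intro nn_integral_cong)
    fix x
    interpret Q: prob_space "Qh x" by (rule Qx)
    interpret pQ: pair_sigma_finite ?\<pi> "Qh x" ..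
    have "(\<lambda>(\<theta>, y). ennreal (f \<theta> x y)) \<in> borel_measurable (?\<pi> \<Otimes>\<^sub>M Qh x)"
      using f_meas_ty by (simp add: Qx(2) cong: measurable_cong_sets sets_pair_measure_cong)
    from pQ.Fubini[OF this]
    have "(\<integral>\<^sup>+ \<theta>. \<integral>\<^sup>+ y. ennreal (f \<theta> x y) \<partial>Qh x \<partial>?\<pi>) = (\<integral>\<^sup>+ y. \<integral>\<^sup>+ \<theta>. ennreal (f \<theta> x y) \<partial>?\<pi> \<partial>Qh x)" by simp
    also have "\<dots> = (\<integral>\<^sup>+ y. (\<Prod>i\<in>F. ennreal (vnd (v + \<tau> i) (x i) / vnd v (x i))) \<partial>Qh x)"
    proof (intro nn_integral_cong)
      fix y
      have "(\<integral>\<^sup>+ \<theta>. ennreal (f \<theta> x y) \<partial>?\<pi>)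
        = (\<integral>\<^sup>+ \<theta>. (\<Prod>i\<in>F. ennreal (shift_ratio e (\<theta> i) (x i) * exp (log_ratio v u (\<tau> i) (\<theta> i) (x i) (y i)))) \<partial>?\<pi>)"
        unfolding f_def by (simp add: prod_ennreal less_imp_le[OF shift_ratio_pos])
      also have "\<dots> = (\<Prod>i\<in>F. \<integral>\<^sup>+ t. ennreal (shift_ratio e t (x i) * exp (log_ratio v u (\<tau> i) t (x i) (y i))) \<partial>gauss 0 (sqrt (\<tau> i)))"
        unfolding gauss_prod_def
      proof (rule nn_integral_PiM_prod)
        show "(\<lambda>t. ennreal (shift_ratio e t (x i) * exp (log_ratio v u (\<tau> i) t (x i) (y i)))) \<in> borel_measurable (gauss 0 (sqrt (\<tau> i)))" for i
          unfolding log_ratio_def shift_ratio_def by measurable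
      qed (auto simp: prob_space_gauss \<tau> F)
      also have "\<dots> = (\<Prod>i\<in>F. ennreal (vnd (v + \<tau> i) (x i) / vnd v (x i)))"
        unfolding v_def u_def by (intro prod.cong refl log_ratio_integral_prior e e2 \<tau>)
      finally show "(\<integral>\<^sup>+ \<theta>. ennreal (f \<theta> x y) \<partial>?\<pi>) = (\<Prod>i\<in>F. ennreal (vnd (v + \<tau> i) (x i) / vnd v (x i)))" .
    qed
    finally show "(\<integral>\<^sup>+ \<theta>. \<integral>\<^sup>+ y. ennreal (f \<theta> x y) \<partial>Qh x \<partial>?\<pi>)
       = (\<integral>\<^sup>+ y. (\<Prod>i\<in>F. ennreal (vnd (v + \<tau> i) (x i) / vnd v (x i))) \<partial>Qh x)" .
  qed
  also have "\<dots> = (\<integral>\<^sup>+ x. (\<Prod>i\<in>F. ennreal (vnd (v + \<tau> i) (x i) / vnd v (x i))) \<partial>?G)"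
    by (intro nn_integral_cong) (simp add: prob_space.emeasure_space_1[OF Qx(1)])
  also have "\<dots> = (\<Prod>i\<in>F. \<integral>\<^sup>+ x. ennreal (vnd (v + \<tau> i) x / vnd v x) \<partial>gauss 0 e)"
    unfolding gauss_prod_def
  proof (rule nn_integral_PiM_prod)
    show "(\<lambda>x. ennreal (vnd (v + \<tau> i) x / vnd v x)) \<in> borel_measurable (gauss 0 e)" for i
      by measurable
  qed (auto simp: prob_space_gauss e F)
  also have "\<dots> = 1"
    unfolding v_def by (simp add: nn_integral_vnd_ratio e \<tau>)
  finally show "(\<integral>\<^sup>+ \<theta>. W (restrict_seq F \<theta>) \<partial>?\<pi>) = 1" .
qed

end

lemma restrict_seq_sobolev:
  assumes F: "finite F" and le: "(\<Sum>i\<in>F. real (Suc i) powr (2 * \<alpha>) * (\<theta> i)\<^sup>2) \<le> B"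
  shows "restrict_seq F \<theta> \<in> sobolev \<alpha> B"
proof -
  have "(\<Sum>i. real (Suc i) powr (2 * \<alpha>) * (restrict_seq F \<theta> i)\<^sup>2)
     = (\<Sum>i\<in>F. real (Suc i) powr (2 * \<alpha>) * (restrict_seq F \<theta> i)\<^sup>2)"
    by (rule suminf_finite[OF F]) (auto simp: restrict_seq_def)
  also have "\<dots> \<le> B" using le by (simp add: restrict_seq_def)
  finally show ?thesis
    unfolding sobolev_def
    by (auto intro!: summable_finite[OF F] simp: restrict_seq_def)
qed

lemma gauss_scaled_square:
  assumes \<tau>: "0 < \<tau>"
  shows "has_bochner_integral (gauss 0 (sqrt \<tau>)) (\<lambda>x. c * (x\<^sup>2 - \<tau>)) 0"
    and "has_bochner_integral (gauss 0 (sqrt \<tau>)) (\<lambda>x. (c * (x\<^sup>2 - \<tau>))\<^sup>2) (2 * (c * \<tau>)\<^sup>2)"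
proof -
  show "has_bochner_integral (gauss 0 (sqrt \<tau>)) (\<lambda>x. c * (x\<^sup>2 - \<tau>)) 0"
    using gauss_quadratic[of "sqrt \<tau>" 0 c 0 "- c * \<tau>"] \<tau> by (simp add: algebra_simps)
  have "(sqrt \<tau>) ^ 4 = \<tau>\<^sup>2" using \<tau>
    by (metis less_imp_le numeral_Bit0 power2_eq_square power_add real_sqrt_pow2)
  then show "has_bochner_integral (gauss 0 (sqrt \<tau>)) (\<lambda>x. (c * (x\<^sup>2 - \<tau>))\<^sup>2) (2 * (c * \<tau>)\<^sup>2)"
    using has_bochner_integral_mult_right[OF gauss_square_variance[of "sqrt \<tau>" 0], of "c\<^sup>2"] \<tau>
    by (simp add: power_mult_distrib mult_ac)
qed

text \<open>The prior \<open>N(0, \<tau> i)\<close> leaves the ellipsoid with small probability; that event is absorbed by a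
  quadratic penalty, so that a single polynomial lower bound \<open>H\<close> has to be integrated.\<close>

lemma minimax_lower_bound:
  fixes e e2 \<alpha> B \<eta> \<mu> :: real and \<tau> :: rseq and F :: "nat set"
  assumes e: "0 < e" and e2: "0 < e2" and B: "0 < B" and \<eta>: "0 < \<eta>" and F: "finite F"
    and \<tau>: "\<And>i. i \<in> F \<Longrightarrow> 0 < \<tau> i"
    and sum: "(\<Sum>i\<in>F. real (Suc i) powr (2 * \<alpha>) * \<tau> i) \<le> (1 - \<eta>) * B"
    and \<mu>: "\<And>i. i \<in> F \<Longrightarrow> real (Suc i) powr (2 * \<alpha>) * \<tau> i \<le> \<mu>" "0 \<le> \<mu>"
    and Qh: "Qh \<in> pred_rules"
  defines "A \<equiv> \<Sum>i\<in>F. phi (e\<^sup>2) (e2\<^sup>2) (\<tau> i)"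
  shows "ennreal (A - (A + 1) * (2 * \<mu> / (\<eta>\<^sup>2 * B)) - \<eta> * A - 1 / (4 * \<eta>))
    \<le> (SUP \<theta>\<in>sobolev \<alpha> B. risk e e2 \<theta> Qh)" (is "_ \<le> ?M")
proof -
  define v u where "v = e\<^sup>2" and "u = e2\<^sup>2"
  have v: "0 < v" and u: "0 < u" using e e2 by (auto simp: v_def u_def)
  \<comment> \<open>Outside \<open>F\<close> the variance 1 is a placeholder that keeps the prior a
    product of proper Gaussians.\<close>
  define t where "t i = (if i \<in> F then \<tau> i else 1)" for i
  have t: "0 < t i" for i using \<tau> by (simp add: t_def)
  define a where "a i = real (Suc i) powr (2 * \<alpha>)" for i
  have a0: "0 \<le> a i" for i by (simp add: a_def)
  have A: "A = (\<Sum>i\<in>F. phi v u (t i))" by (simp add: A_def v_def u_def t_def)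
  have A0: "0 \<le> A" unfolding A using t by (intro sum_nonneg phi_nonneg v u) (auto intro: less_imp_le)
  have sum': "(\<Sum>i\<in>F. a i * t i) \<le> (1 - \<eta>) * B" using sum by (simp add: a_def t_def)
  let ?\<pi> = "gauss_prod (\<lambda>_. 0) (\<lambda>i. sqrt (t i))"
  interpret p: prob_space ?\<pi> by (intro prob_space_gauss_prod) (simp add: t)
  define T where "T \<theta> = (\<Sum>i\<in>F. dphi v u (t i) * ((\<theta> i)\<^sup>2 - t i))" for \<theta> :: rseq
  define Z where "Z \<theta> = (\<Sum>i\<in>F. a i * ((\<theta> i)\<^sup>2 - t i))" for \<theta> :: rseq
  define VT where "VT = (\<Sum>i\<in>F. 2 * (dphi v u (t i) * t i)\<^sup>2)"
  define VZ where "VZ = (\<Sum>i\<in>F. 2 * (a i * t i)\<^sup>2)"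
  \<comment> \<open>Off the ellipsoid \<open>Z \<theta>\<close> is at least
    \<open>\<eta> * B\<close>, so the penalty in \<open>Z\<close> cancels \<open>A + 1\<close>, the
    1 being the price of the exponential term. The terms in \<open>T\<close> complete a negative
    square, so that there \<open>T\<close> contributes at most 0.\<close>
  define H where "H \<theta> = A + T \<theta> - (A + 1) / (\<eta> * B)\<^sup>2 * (Z \<theta>)\<^sup>2 - \<eta> * (T \<theta>)\<^sup>2 - 1 / (4 * \<eta>)" for \<theta>
  define W where "W \<theta> = (\<integral>\<^sup>+ x. \<integral>\<^sup>+ y. ennreal (exp (\<Sum>i\<in>F. log_ratio v u (t i) (\<theta> i) (x i) (y i))) \<partial>Qh x \<partial>gauss_seq \<theta> e)" for \<theta>
  have hT: "has_bochner_integral ?\<pi> T (\<Sum>i\<in>F. 0)" and hZ2: "has_bochner_integral ?\<pi> (\<lambda>\<theta>. (Z \<theta>)\<^sup>2) VZ"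
    and hT2: "has_bochner_integral ?\<pi> (\<lambda>\<theta>. (T \<theta>)\<^sup>2) VT"
    unfolding T_def Z_def VT_def VZ_def using t
    by (intro gauss_prod_sum gauss_prod_sum_variance gauss_scaled_square F; simp)+
  have hH: "has_bochner_integral ?\<pi> (\<lambda>\<theta>. H \<theta> + 1)
      (A + (\<Sum>i\<in>F. 0) - (A + 1) / (\<eta> * B)\<^sup>2 * VZ - \<eta> * VT - 1 / (4 * \<eta>) + 1)"
    unfolding H_def
    by (intro has_bochner_integral_add has_bochner_integral_diff has_bochner_integral_mult_right hT hZ2 hT2)
      (use p.prob_space in \<open>simp_all add: has_bochner_integral_iff\<close>)
  \<comment> \<open>The variance of \<open>T\<close> is paid for by \<open>A\<close>, through the
    two bounds on \<open>t * dphi\<close>.\<close>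
  have VT: "VT \<le> A"
    unfolding VT_def A
  proof (intro sum_mono)
    fix i assume "i \<in> F"
    have t0: "0 \<le> t i" using t[of i] by simp
    have "2 * (dphi v u (t i) * t i)\<^sup>2 = (2 * (t i * dphi v u (t i))) * (t i * dphi v u (t i))"
      by (simp add: power2_eq_square)
    also have "\<dots> \<le> 1 * (t i * dphi v u (t i))"
      using t0 by (intro mult_right_mono dphi_mult_le_half v u mult_nonneg_nonneg dphi_nonneg)
    also have "\<dots> \<le> phi v u (t i)" using dphi_mult_le[OF v u t0] by simp
    finally show "2 * (dphi v u (t i) * t i)\<^sup>2 \<le> phi v u (t i)" .
  qed
  \<comment> \<open>A sum of squares is small when each term is at most \<open>\<mu>\<close> and the
    sum at most \<open>B\<close>: the weighted variances must be spread over many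
    coordinates.\<close>
  have VZ: "VZ \<le> 2 * \<mu> * B"
  proof -
    have "VZ \<le> (\<Sum>i\<in>F. 2 * \<mu> * (a i * t i))"
      unfolding VZ_def
    proof (intro sum_mono)
      fix i assume i: "i \<in> F"
      have "(a i * t i) * (a i * t i) \<le> \<mu> * (a i * t i)"
        using \<mu>(1)[OF i] i a0[of i] t[of i] by (intro mult_right_mono) (auto simp: a_def t_def)
      then show "2 * (a i * t i)\<^sup>2 \<le> 2 * \<mu> * (a i * t i)" by (simp add: power2_eq_square)
    qed
    also have "\<dots> = 2 * \<mu> * (\<Sum>i\<in>F. a i * t i)" by (simp add: sum_distrib_left)
    also have "\<dots> \<le> 2 * \<mu> * B"
    proof (intro mult_left_mono)
      have "0 \<le> \<eta> * B" using \<eta> B by simp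
      then show "(\<Sum>i\<in>F. a i * t i) \<le> B" using sum' by (simp add: algebra_simps)
    qed (use \<mu> in simp)
    finally show ?thesis .
  qed
  have pt: "ennreal (H \<theta> + 1) \<le> ?M + W (restrict_seq F \<theta>)" for \<theta>
  proof -
    have q: "T \<theta> - \<eta> * (T \<theta>)\<^sup>2 - 1 / (4 * \<eta>) = - \<eta> * (T \<theta> - 1 / (2 * \<eta>))\<^sup>2"
      using \<eta> by (simp add: power2_eq_square field_simps)
    have pen: "0 \<le> (A + 1) / (\<eta> * B)\<^sup>2 * (Z \<theta>)\<^sup>2" using A0 by simp
    show ?thesis
    proof (cases "(\<Sum>i\<in>F. a i * (\<theta> i)\<^sup>2) \<le> B")
      case True
      then have \<theta>: "restrict_seq F \<theta> \<in> sobolev \<alpha> B"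
        by (intro restrict_seq_sobolev F) (simp add: a_def)
      have "H \<theta> + 1 \<le> A + T \<theta> + 1"
      proof -
        have "0 \<le> \<eta> * (T \<theta>)\<^sup>2" "0 \<le> 1 / (4 * \<eta>)" using \<eta> by simp_all
        then show ?thesis using pen unfolding H_def by linarith
      qed
      also have "A + T \<theta> = (\<Sum>i\<in>F. phi v u (t i) + dphi v u (t i) * ((restrict_seq F \<theta> i)\<^sup>2 - t i))"
        unfolding A T_def sum.distrib[symmetric] by (intro sum.cong) (auto simp: restrict_seq_def)
      finally have "ennreal (H \<theta> + 1) \<le> risk e e2 (restrict_seq F \<theta>) Qh + W (restrict_seq F \<theta>)"
        unfolding W_def
        using risk_plus_prior_term_ge[OF e e2 F t v_def u_def Qh, where \<theta> = "restrict_seq F \<theta>"]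
        by (meson ennreal_leI order.trans)
      also have "\<dots> \<le> ?M + W (restrict_seq F \<theta>)"
        using \<theta> by (intro add_right_mono SUP_upper)
      finally show ?thesis .
    next
      case False
      have "Z \<theta> = (\<Sum>i\<in>F. a i * (\<theta> i)\<^sup>2) - (\<Sum>i\<in>F. a i * t i)"
        by (simp add: Z_def right_diff_distrib sum_subtractf)
      with False sum' have "\<eta> * B \<le> Z \<theta>" by (simp add: algebra_simps)
      then have "(\<eta> * B)\<^sup>2 \<le> (Z \<theta>)\<^sup>2" using \<eta> B by (intro power_mono) auto
      then have "1 \<le> (Z \<theta>)\<^sup>2 / (\<eta> * B)\<^sup>2" using \<eta> B by simp
      then have "(A + 1) * 1 \<le> (A + 1) * ((Z \<theta>)\<^sup>2 / (\<eta> * B)\<^sup>2)" using A0 by (intro mult_left_mono) auto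
      moreover have "0 \<le> \<eta> * (T \<theta> - 1 / (2 * \<eta>))\<^sup>2" using \<eta> by simp
      ultimately have "H \<theta> + 1 \<le> 0" using q unfolding H_def by simp
      then show ?thesis by (simp add: ennreal_neg)
    qed
  qed
  have W: "(\<lambda>\<theta>. W (restrict_seq F \<theta>)) \<in> borel_measurable Rinf" "(\<integral>\<^sup>+ \<theta>. W (restrict_seq F \<theta>) \<partial>?\<pi>) = 1"
    unfolding W_def by (rule nn_integral_prior_term[OF e e2 F t v_def u_def Qh])+
  let ?E = "A - (A + 1) / (\<eta> * B)\<^sup>2 * VZ - \<eta> * VT - 1 / (4 * \<eta>)"
  have "ennreal (?E + 1) = ennreal (\<integral>\<theta>. H \<theta> + 1 \<partial>?\<pi>)"
    using hH by (simp add: has_bochner_integral_iff)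
  also have "\<dots> \<le> (\<integral>\<^sup>+ \<theta>. ennreal (H \<theta> + 1) \<partial>?\<pi>)"
    using hH by (intro ennreal_integral_le_nn_integral) (simp add: has_bochner_integral_iff)
  also have "\<dots> \<le> (\<integral>\<^sup>+ \<theta>. ?M + W (restrict_seq F \<theta>) \<partial>?\<pi>)" by (intro nn_integral_mono pt)
  also have "\<dots> = ?M + 1"
    using W by (subst nn_integral_add) (use p.emeasure_space_1 in \<open>auto cong: measurable_cong_sets\<close>)
  finally have fin: "ennreal (?E + 1) \<le> ?M + 1" .
  have "(A + 1) / (\<eta> * B)\<^sup>2 * VZ \<le> (A + 1) / (\<eta> * B)\<^sup>2 * (2 * \<mu> * B)"
    using VZ A0 by (intro mult_left_mono) auto
  also have "\<dots> = (A + 1) * (2 * \<mu> / (\<eta>\<^sup>2 * B))" using B by (simp add: power2_eq_square)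
  finally have "A - (A + 1) * (2 * \<mu> / (\<eta>\<^sup>2 * B)) - \<eta> * A - 1 / (4 * \<eta>) \<le> ?E"
    using mult_left_mono[OF VT less_imp_le[OF \<eta>]] by simp
  then have "ennreal (A - (A + 1) * (2 * \<mu> / (\<eta>\<^sup>2 * B)) - \<eta> * A - 1 / (4 * \<eta>)) \<le> ennreal ?E"
    by (rule ennreal_leI)
  also have "ennreal ?E \<le> ?M"
  proof (cases "0 \<le> ?E")
    case True
    then have "1 + ennreal ?E \<le> 1 + ?M" using fin by (simp add: add.commute)
    then show ?thesis unfolding ennreal_add_left_cancel_le by simp
  qed (simp add: ennreal_neg)
  finally show ?thesis .
qed

section \<open>The Stein prior as a mixture of Gaussians\<close>

lemma measurable_vnd' [measurable (raw)]:
  assumes [measurable]: "f \<in> borel_measurable M" "g \<in> borel_measurable M"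
  shows "(\<lambda>x. vnd (f x) (g x)) \<in> borel_measurable M"
  unfolding vnd_def by measurable

lemma ln_two_pi_mult: "0 < x \<Longrightarrow> ln (2 * pi * x) = ln (2 * pi) + ln x"
  by (simp add: ln_mult)

lemma prod_vnd:
  assumes B: "finite B" and \<tau>: "0 < \<tau>"
  shows "(\<Prod>i\<in>B. vnd \<tau> (z i)) = exp (- (real (card B) / 2) * ln (2 * pi * \<tau>) - (\<Sum>i\<in>B. (z i)\<^sup>2) / (2 * \<tau>))"
proof -
  have "vnd \<tau> x = exp (- ln (2 * pi * \<tau>) / 2 - x\<^sup>2 / (2 * \<tau>))" for x
    using ln_vnd[OF \<tau>, of x] vnd_pos[OF \<tau>, of x] by (metis exp_ln)
  then have "(\<Prod>i\<in>B. vnd \<tau> (z i)) = exp (\<Sum>i\<in>B. - ln (2 * pi * \<tau>) / 2 - (z i)\<^sup>2 / (2 * \<tau>))"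
    using B by (simp add: exp_sum)
  also have "(\<Sum>i\<in>B. - ln (2 * pi * \<tau>) / 2 - (z i)\<^sup>2 / (2 * \<tau>))
      = - (real (card B) / 2) * ln (2 * pi * \<tau>) - (\<Sum>i\<in>B. (z i)\<^sup>2) / (2 * \<tau>)"
    by (simp add: sum_subtractf sum_divide_distrib)
  finally show ?thesis .
qed

text \<open>The right side minus the left has derivative \<open>(x - 1) * (1 / x - 1 / U)\<close>,
  which on \<open>0 < x \<le> U\<close> has the sign of \<open>x - 1\<close>; so the minimum is the
  value 0 at 1.\<close>

lemma ln_le_quadratic:
  fixes r U :: real
  assumes r: "0 < r" "r \<le> U" and U: "1 \<le> U"
  shows "ln r \<le> (r - 1) - (r - 1)\<^sup>2 / (2 * U)"
proof -
  define f where "f x = (x - 1) - (x - 1)\<^sup>2 / (2 * U) - ln x" for x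
  have D: "(f has_real_derivative (x - 1) * (1 / x - 1 / U)) (at x)" if "0 < x" for x
    unfolding f_def using that U
    by (auto intro!: derivative_eq_intros simp: field_simps power2_eq_square)
  have "0 \<le> f r"
  proof (cases "1 \<le> r")
    case True
    have "f 1 \<le> f r"
    proof (rule DERIV_nonneg_imp_nondecreasing[OF True])
      fix x assume x: "1 \<le> x" "x \<le> r"
      then have "0 \<le> (x - 1) * (1 / x - 1 / U)"
        using r U by (intro mult_nonneg_nonneg) (auto simp: field_simps)
      then show "\<exists>y. (f has_real_derivative y) (at x) \<and> 0 \<le> y" using D[of x] x by auto
    qed
    then show ?thesis by (simp add: f_def)
  next
    case False
    have "f 1 \<le> f r"
    proof (rule DERIV_nonpos_imp_nonincreasing[of r 1 f])
      show "r \<le> 1" using False by simp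
      fix x assume x: "r \<le> x" "x \<le> 1"
      then have "(x - 1) * (1 / x - 1 / U) \<le> 0"
        using r U by (intro mult_nonpos_nonneg) (auto simp: field_simps)
      then show "\<exists>y. (f has_real_derivative y) (at x) \<and> y \<le> 0" using D[of x] x r by auto
    qed
    then show ?thesis by (simp add: f_def)
  qed
  then show ?thesis by (simp add: f_def)
qed

text \<open>The exponent \<open>- c ln t - n / (2 t)\<close> is maximal at \<open>t = n / (2 c)\<close>; replacing that point by
  the fixed point \<open>m / (2 c)\<close> costs only a variance term, uniformly in \<open>t \<ge> s\<close>.\<close>

lemma exponent_bound:
  fixes s t c m n :: real
  assumes s: "0 < s" "s \<le> t" and c: "0 < c" and m: "2 * c * s \<le> m"
  shows "- c * ln t - n / (2 * t) \<le> - c * ln (m / (2 * c)) - n / (2 * (m / (2 * c))) + (n - m)\<^sup>2 / (4 * s * m)"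
proof -
  define t0 where "t0 = m / (2 * c)"
  define r where "r = t0 / t"
  define U where "U = t0 / s"
  define d where "d = (n - m) / m"
  have m0: "0 < m" using m s c by (smt (verit) mult_pos_pos)
  have t0: "0 < t0" "s \<le> t0" using m c m0 by (auto simp: t0_def field_simps)
  have t: "0 < t" using s by simp
  have r: "0 < r" "r \<le> U" using t0 t s by (auto simp: r_def U_def intro!: divide_left_mono mult_pos_pos)
  have U: "1 \<le> U" using t0 s by (simp add: U_def)
  have mt: "m = 2 * c * t0" using c by (simp add: t0_def)
  have nd: "n = m * (1 + d)" using m0 by (simp add: d_def field_simps)
  \<comment> \<open>This square absorbs the cross term between \<open>d\<close>, the relative
    deviation of \<open>n\<close> from \<open>m\<close>, and \<open>r - 1\<close> into the quadratic
    gain of \<open>ln_le_quadratic\<close>.\<close>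
  have "0 \<le> (r - 1 + U * d)\<^sup>2 / (2 * U)" using U by simp
  also have "\<dots> = (r - 1)\<^sup>2 / (2 * U) + d * (r - 1) + U * d\<^sup>2 / 2"
    using U by (simp add: field_simps power2_eq_square)
  finally have "ln r - (1 + d) * (r - 1) \<le> U * d\<^sup>2 / 2"
    using ln_le_quadratic[OF r U] by (simp add: algebra_simps)
  then have "c * (ln r - (1 + d) * (r - 1)) \<le> c * (U * d\<^sup>2 / 2)" using c by (intro mult_left_mono) auto
  moreover have "ln r = ln t0 - ln t" using t0 t by (simp add: r_def ln_div)
  moreover have "c * (1 + d) * (r - 1) = n / (2 * t) - n / (2 * t0)"
    unfolding nd mt r_def using t0 t c by (simp add: field_simps)
  moreover have "c * (U * d\<^sup>2 / 2) = (n - m)\<^sup>2 / (4 * s * m)"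
  proof -
    have "(n - m)\<^sup>2 = d\<^sup>2 * m\<^sup>2" using m0 by (simp add: d_def power_divide)
    then have "(n - m)\<^sup>2 / (4 * s * m) = d\<^sup>2 * m / (4 * s)" using m0 by (simp add: power2_eq_square)
    also have "\<dots> = c * (U * d\<^sup>2 / 2)" unfolding mt U_def using s by simp
    finally show ?thesis by simp
  qed
  ultimately show ?thesis unfolding t0_def[symmetric] by (simp add: algebra_simps)
qed

text \<open>The density at \<open>z\<close> of a block whose prior is the Lebesgue mixture over
  \<open>t\<close> of N(0, t I), seen through noise of variance \<open>s\<close>; noise 0 gives the
  prior itself. It is \<open>ennreal\<close>-valued because it can be infinite at noise 0.\<close>

definition stein_mix :: "nat set \<Rightarrow> real \<Rightarrow> rseq \<Rightarrow> ennreal" where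
  "stein_mix B s z = (\<integral>\<^sup>+ t. ennreal (\<Prod>i\<in>B. vnd (t + s) (z i)) * indicator {0<..} t \<partial>lborel)"

lemma nn_integral_powr_tail:
  fixes s :: real
  assumes s: "0 < s"
  shows "(\<integral>\<^sup>+ t. ennreal ((t + s) powr (- 5 / 4)) * indicator {0..} t \<partial>lborel) = ennreal (4 * s powr (- 1 / 4))"
proof -
  have "(\<integral>\<^sup>+ t. ennreal ((t + s) powr (- 5 / 4)) * indicator {0..} t \<partial>lborel)
     = ennreal (0 - (- 4 * (0 + s) powr (- 1 / 4)))"
  proof (rule nn_integral_FTC_atLeast)
    show "((\<lambda>t. - 4 * (t + s) powr (- 1 / 4)) \<longlongrightarrow> 0) at_top"
      by real_asymp
    fix x :: real assume "0 \<le> x"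
    then show "((\<lambda>t. - 4 * (t + s) powr (- 1 / 4)) has_real_derivative (x + s) powr (- 5 / 4)) (at x)"
      using s by (auto intro!: derivative_eq_intros simp: powr_diff[symmetric])
  qed auto
  then show ?thesis by simp
qed

text \<open>Of the exponent \<open>b / 2\<close> the part 5/4 is kept to make the integral over
  \<open>t\<close> converge, which requires more than 1; the rest \<open>c\<close> must be positive
  already for \<open>b = 3\<close>, which requires less than 3/2. On that rest
  \<open>exponent_bound\<close> is uniform in \<open>t\<close> and leaves the integral. In the
  application \<open>m\<close> is the mean of \<open>n\<close>.\<close>

lemma stein_mix_upper:
  fixes s m :: real and z :: rseq
  assumes B: "finite B" "3 \<le> card B" and s: "0 < s"
  defines "c \<equiv> real (card B) / 2 - 5 / 4" and "n \<equiv> \<Sum>i\<in>B. (z i)\<^sup>2"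
  assumes m: "2 * c * s \<le> m"
  shows "stein_mix B s z \<le> ennreal (exp (- (real (card B) / 2) * ln (2 * pi) - ln s / 4 + ln 4
     - c * ln (m / (2 * c)) - n / (2 * (m / (2 * c))) + (n - m)\<^sup>2 / (4 * s * m)))"
proof -
  have c: "0 < c" using B by (simp add: c_def)
  let ?b = "real (card B)"
  let ?E = "- c * ln (m / (2 * c)) - n / (2 * (m / (2 * c))) + (n - m)\<^sup>2 / (4 * s * m)"
  let ?C = "exp (- (?b / 2) * ln (2 * pi) + ?E)"
  have "stein_mix B s z \<le> (\<integral>\<^sup>+ t. ennreal ?C * (ennreal ((t + s) powr (- 5 / 4)) * indicator {0..} t) \<partial>lborel)"
    unfolding stein_mix_def
  proof (intro nn_integral_mono)
    fix t :: real
    show "ennreal (\<Prod>i\<in>B. vnd (t + s) (z i)) * indicator {0<..} t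
      \<le> ennreal ?C * (ennreal ((t + s) powr (- 5 / 4)) * indicator {0..} t)"
    proof (cases "0 < t")
      case True
      have ts: "0 < t + s" "s \<le> t + s" using True s by auto
      have "(\<Prod>i\<in>B. vnd (t + s) (z i)) = exp (- (?b / 2) * ln (2 * pi * (t + s)) - n / (2 * (t + s)))"
        unfolding n_def by (rule prod_vnd[OF B(1) ts(1)])
      also have "- (?b / 2) * ln (2 * pi * (t + s)) - n / (2 * (t + s))
         = - (?b / 2) * ln (2 * pi) + (- c * ln (t + s) - n / (2 * (t + s))) + (- 5 / 4) * ln (t + s)"
        unfolding ln_two_pi_mult[OF ts(1)] c_def by (simp add: algebra_simps)
      also have "\<dots> \<le> - (?b / 2) * ln (2 * pi) + ?E + (- 5 / 4) * ln (t + s)"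
        using exponent_bound[OF s ts(2) c m, of n] by simp
      finally have "(\<Prod>i\<in>B. vnd (t + s) (z i)) \<le> ?C * (t + s) powr (- 5 / 4)"
        using ts by (simp add: powr_def exp_add[symmetric])
      then show ?thesis using True
        by (simp add: ennreal_mult'[symmetric] ennreal_leI)
    qed simp
  qed
  also have "\<dots> = ennreal ?C * ennreal (4 * s powr (- 1 / 4))"
    unfolding nn_integral_powr_tail[OF s, symmetric] by (rule nn_integral_cmult) measurable
  also have "\<dots> = ennreal (?C * (4 * s powr (- 1 / 4)))" by (simp add: ennreal_mult'[symmetric])
  also have "4 * s powr (- 1 / 4) = exp (ln 4 + (- 1 / 4) * ln s)"
    using s by (subst exp_add) (simp add: powr_def)
  also have "?C * exp (ln 4 + (- 1 / 4) * ln s) = exp (- (?b / 2) * ln (2 * pi) - ln s / 4 + ln 4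
     - c * ln (m / (2 * c)) - n / (2 * (m / (2 * c))) + (n - m)\<^sup>2 / (4 * s * m))"
    unfolding mult_exp_exp by (rule arg_cong[of _ _ exp]) simp
  finally show ?thesis .
qed

text \<open>The integral is restricted to the window where \<open>t + s\<close> lies between
  \<open>t1\<close> and \<open>t1 * (1 + 1 / b)\<close>. The relative width \<open>1 / b\<close>
  changes the power \<open>- b / 2\<close> only by a bounded factor and costs \<open>ln b\<close> in
  the exponent.\<close>

lemma stein_mix_lower:
  fixes s t1 :: real and z :: rseq
  assumes B: "finite B" "3 \<le> card B" and s: "0 \<le> s" "s \<le> t1" "0 < t1"
  defines "b \<equiv> real (card B)" and "n \<equiv> \<Sum>i\<in>B. (z i)\<^sup>2"
  shows "ennreal (exp (- (b / 2) * ln (2 * pi) - (b / 2) * ln (t1 * (1 + 1 / b)) - n / (2 * t1) + ln (t1 / b)))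
    \<le> stein_mix B s z"
proof -
  have b: "3 \<le> b" using B by (simp add: b_def)
  let ?C = "exp (- (b / 2) * ln (2 * pi) - (b / 2) * ln (t1 * (1 + 1 / b)) - n / (2 * t1))"
  let ?I = "{t1 - s<..t1 - s + t1 / b}"
  have n0: "0 \<le> n" by (simp add: n_def sum_nonneg)
  have "ennreal (?C * (t1 / b)) = (\<integral>\<^sup>+ t. ennreal ?C * indicator ?I t \<partial>lborel)"
    using b s by (subst nn_integral_cmult_indicator) (auto simp: ennreal_mult'[symmetric])
  also have "\<dots> \<le> stein_mix B s z"
    unfolding stein_mix_def
  proof (intro nn_integral_mono)
    fix t :: real
    show "ennreal ?C * indicator ?I t \<le> ennreal (\<Prod>i\<in>B. vnd (t + s) (z i)) * indicator {0<..} t"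
    proof (cases "t \<in> ?I")
      case True
      have ts: "t1 \<le> t + s" "t + s \<le> t1 * (1 + 1 / b)" "0 < t + s" "0 < t"
        using True s b by (auto simp: algebra_simps)
      have "- (b / 2) * ln (2 * pi) - (b / 2) * ln (t1 * (1 + 1 / b)) - n / (2 * t1)
        \<le> - (b / 2) * ln (2 * pi) - (b / 2) * ln (t + s) - n / (2 * (t + s))"
        using ts s b n0 by (intro diff_mono mult_left_mono divide_left_mono order.refl) auto
      also have "\<dots> = - (b / 2) * ln (2 * pi * (t + s)) - n / (2 * (t + s))"
        unfolding ln_two_pi_mult[OF ts(3)] by (simp add: algebra_simps)
      finally have "?C \<le> (\<Prod>i\<in>B. vnd (t + s) (z i))"
        unfolding prod_vnd[OF B(1) ts(3)] b_def n_def by simp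
      then show ?thesis using True ts by (simp add: ennreal_leI)
    qed simp
  qed
  also have "?C * (t1 / b) = exp (- (b / 2) * ln (2 * pi) - (b / 2) * ln (t1 * (1 + 1 / b)) - n / (2 * t1) + ln (t1 / b))"
    using s b by (simp add: exp_add)
  finally show ?thesis .
qed

lemma stein_mix_pos_finite:
  assumes B: "finite B" "3 \<le> card B" and s: "0 < s"
  shows "0 < stein_mix B s z" and "stein_mix B s z < \<infinity>"
proof -
  show "0 < stein_mix B s z"
    using stein_mix_lower[OF B less_imp_le[OF s] order.refl s, of z]
    by (meson ennreal_less_zero_iff exp_gt_zero less_le_trans)
  show "stein_mix B s z < \<infinity>"
    using stein_mix_upper[OF B s order.refl, of z] by (simp add: le_less_trans)
qed

text \<open>The value of \<open>stein_mix\<close> with noise 0 at a unit vector, hence the factor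
  between the mixture and the power of the norm.\<close>

definition stein_const :: "nat \<Rightarrow> ennreal" where
  "stein_const b = (\<integral>\<^sup>+ t. ennreal (exp (- (real b / 2) * ln (2 * pi * t) - 1 / (2 * t))) * indicator {0<..} t \<partial>lborel)"

text \<open>The substitution of \<open>R * t\<close> for \<open>t\<close>, with \<open>R\<close> the
  squared norm, pulls out \<open>R powr (1 - b / 2)\<close>, which is the Stein prior of the
  block.\<close>

lemma stein_mix_0:
  assumes B: "finite B" and R: "0 < (\<Sum>i\<in>B. (z i)\<^sup>2)"
  shows "stein_mix B 0 z = ennreal ((\<Sum>i\<in>B. (z i)\<^sup>2) powr (1 - real (card B) / 2)) * stein_const (card B)"
proof -
  let ?R = "\<Sum>i\<in>B. (z i)\<^sup>2" and ?b = "real (card B)"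
  let ?f = "\<lambda>t. ennreal (exp (- (?b / 2) * ln (2 * pi * t) - ?R / (2 * t))) * indicator {0<..} t"
  have "stein_mix B 0 z = (\<integral>\<^sup>+ t. ?f t \<partial>lborel)"
    unfolding stein_mix_def by (intro nn_integral_cong) (auto simp: prod_vnd B split: split_indicator)
  also have "\<dots> = ennreal \<bar>?R\<bar> * (\<integral>\<^sup>+ t. ?f (0 + ?R * t) \<partial>lborel)"
    using R by (intro nn_integral_real_affine) auto
  also have "(\<integral>\<^sup>+ t. ?f (0 + ?R * t) \<partial>lborel)
     = (\<integral>\<^sup>+ t. ennreal (?R powr (- ?b / 2)) *
        (ennreal (exp (- (?b / 2) * ln (2 * pi * t) - 1 / (2 * t))) * indicator {0<..} t) \<partial>lborel)"
  proof (intro nn_integral_cong)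
    fix t :: real
    show "?f (0 + ?R * t) = ennreal (?R powr (- ?b / 2)) *
        (ennreal (exp (- (?b / 2) * ln (2 * pi * t) - 1 / (2 * t))) * indicator {0<..} t)"
    proof (cases "0 < t")
      case True
      have l: "ln (2 * pi * (?R * t)) = ln ?R + ln (2 * pi * t)"
        using True R by (simp add: ln_mult)
      have "- (?b / 2) * ln (2 * pi * (?R * t)) - ?R / (2 * (?R * t))
        = (- ?b / 2) * ln ?R + (- (?b / 2) * ln (2 * pi * t) - 1 / (2 * t))"
        unfolding l using True R by (simp add: algebra_simps)
      then have "exp (- (?b / 2) * ln (2 * pi * (?R * t)) - ?R / (2 * (?R * t)))
        = ?R powr (- ?b / 2) * exp (- (?b / 2) * ln (2 * pi * t) - 1 / (2 * t))"
        using R by (simp only: exp_add powr_def) simp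
      then show ?thesis using True R by (simp add: ennreal_mult' del: exp_diff)
    qed (use R in \<open>auto simp: zero_less_mult_iff\<close>)
  qed
  also have "\<dots> = ennreal (?R powr (- ?b / 2)) * stein_const (card B)"
    unfolding stein_const_def by (rule nn_integral_cmult) measurable
  also have "ennreal \<bar>?R\<bar> * (ennreal (?R powr (- ?b / 2)) * stein_const (card B))
     = ennreal (?R * ?R powr (- ?b / 2)) * stein_const (card B)"
    using R by (simp add: ennreal_mult mult.assoc)
  also have "?R * ?R powr (- ?b / 2) = ?R powr (1 - ?b / 2)"
    using R powr_add[of ?R 1 "- ?b / 2"] by simp
  finally show ?thesis .
qed

lemma stein_const_pos_finite:
  assumes b: "3 \<le> b"
  shows "0 < stein_const b" and "stein_const b < \<infinity>"
proof -
  define z :: rseq where "z = (\<lambda>i. if i = 0 then 1 else 0)"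
  have z: "(\<Sum>i\<in>{..<b}. (z i)\<^sup>2) = 1"
    using b sum.delta[of "{..<b}" 0 "\<lambda>_. 1 :: real"] by (simp add: z_def if_distrib[of "\<lambda>x. x\<^sup>2"] cong: if_cong)
  have eq: "stein_mix {..<b} 0 z = stein_const b"
    using stein_mix_0[of "{..<b}" z] by (simp add: z)
  show "0 < stein_const b"
    using stein_mix_lower[of "{..<b}" 0 1 z] b unfolding eq
    by (simp, meson ennreal_less_zero_iff exp_gt_zero less_le_trans)
  let ?f = "\<lambda>t::real. exp (- (real b / 2) * ln (2 * pi * t) - 1 / (2 * t))"
  have "((\<lambda>t. ?f t) \<longlongrightarrow> 0) (at_right 0)"
    using b by real_asymp
  then have "\<forall>\<^sub>F t in at_right 0. ?f t < 1" by (rule order_tendstoD) simp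
  then obtain h where h: "0 < h" "\<And>t. 0 < t \<Longrightarrow> t < h \<Longrightarrow> ?f t < 1"
    unfolding eventually_at_right_field by auto
  \<comment> \<open>Below \<open>h\<close> the integrand is less than 1. From \<open>h\<close> on,
    shifting \<open>t\<close> by \<open>h / 2\<close> turns it into the integrand of a mixture with
    the positive noise \<open>h / 2\<close>, which is already known to be finite.\<close>
  have "stein_const b \<le> (\<integral>\<^sup>+ t. indicator {0..h} t + (ennreal (\<Prod>i\<in>{..<b}. vnd (t - h / 2 + h / 2) (z i)) * indicator {0<..} (t - h / 2)) \<partial>lborel)"
    unfolding stein_const_def
  proof (intro nn_integral_mono)
    fix t :: real
    show "ennreal (?f t) * indicator {0<..} t
      \<le> indicator {0..h} t + (ennreal (\<Prod>i\<in>{..<b}. vnd (t - h / 2 + h / 2) (z i)) * indicator {0<..} (t - h / 2))"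
    proof (cases "0 < t \<and> t < h")
      case True
      then have "ennreal (?f t) \<le> 1" using h(2)[of t] by (simp add: ennreal_le_1)
      then show ?thesis using True by (simp add: add_increasing2)
    next
      case False
      show ?thesis
      proof (cases "0 < t")
        case True
        with False have "0 < t - h / 2" using h by simp
        then show ?thesis using True prod_vnd[of "{..<b}" t z] by (simp add: z)
      qed simp
    qed
  qed
  also have "\<dots> = ennreal h + (\<integral>\<^sup>+ t. (ennreal (\<Prod>i\<in>{..<b}. vnd (t - h / 2 + h / 2) (z i)) * indicator {0<..} (t - h / 2)) \<partial>lborel)"
    using h by (subst nn_integral_add) auto
  also have "(\<integral>\<^sup>+ t. (ennreal (\<Prod>i\<in>{..<b}. vnd (t - h / 2 + h / 2) (z i)) * indicator {0<..} (t - h / 2)) \<partial>lborel)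
     = stein_mix {..<b} (h / 2) z"
    unfolding stein_mix_def
    by (subst nn_integral_real_affine[where c = 1 and t = "h / 2"]) auto
  also have "ennreal h + stein_mix {..<b} (h / 2) z < \<infinity>"
    using stein_mix_pos_finite(2)[of "{..<b}" "h / 2" z] b h by simp
  finally show "stein_const b < \<infinity>" .
qed

text \<open>For \<open>i\<close> outside \<open>I\<close> extensionality makes the coordinate
  constant; measurability of block expressions then needs no index check.\<close>

lemma measurable_PiM_lborel_component: "(\<lambda>x. x i) \<in> borel_measurable (PiM I (\<lambda>_. lborel :: real measure))"
proof (cases "i \<in> I")
  case False
  have "(\<lambda>x. x i) \<in> borel_measurable (PiM I (\<lambda>_. lborel :: real measure))
     \<longleftrightarrow> (\<lambda>x. undefined :: real) \<in> borel_measurable (PiM I (\<lambda>_. lborel :: real measure))"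
    using False by (intro measurable_cong) (auto simp: space_PiM PiE_iff extensional_def)
  then show ?thesis by simp
qed simp

lemma measurable_Rd_component [measurable (raw)]: "(\<lambda>x. x i) \<in> borel_measurable (Rd d)"
  unfolding Rd_def by (rule measurable_PiM_lborel_component)

lemma sigma_finite_PiM_lborel: "finite I \<Longrightarrow> sigma_finite_measure (PiM I (\<lambda>_. lborel :: real measure))"
  by (intro product_sigma_finite.sigma_finite) (simp_all add: product_sigma_finite_def lborel.sigma_finite_measure_axioms)

lemma nn_integral_PiM_lborel_prod:
  assumes "finite I" "\<And>i. i \<in> I \<Longrightarrow> f i \<in> borel_measurable borel"
  shows "(\<integral>\<^sup>+ x. (\<Prod>i\<in>I. f i (x i)) \<partial>PiM I (\<lambda>_. lborel :: real measure)) = (\<Prod>i\<in>I. \<integral>\<^sup>+ x. f i x \<partial>lborel)"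
  using assms
  by (intro product_sigma_finite.product_nn_integral_prod)
     (simp_all add: product_sigma_finite_def lborel.sigma_finite_measure_axioms)

section \<open>Consecutive blocks and the marginal likelihood under the blockwise prior\<close>

lemma sum_list_take_mono:
  fixes bs :: "nat list"
  assumes "j \<le> k" shows "sum_list (take j bs) \<le> sum_list (take k bs)"
proof -
  have "take k bs = take j bs @ take (k - j) (drop j bs)"
    using assms take_add[of j "k - j" bs] by simp
  then show ?thesis by simp
qed

lemma sum_list_take_Suc: "j < length bs \<Longrightarrow> sum_list (take (Suc j) bs) = sum_list (take j bs) + bs ! j"
  for bs :: "nat list"
  by (simp add: take_Suc_conv_app_nth)

lemma finite_block [simp]: "finite (block bs j)"
  by (simp add: block_def)

lemma card_block: "j < length bs \<Longrightarrow> card (block bs j) = bs ! j"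
  by (simp add: block_def sum_list_take_Suc)

lemma block_subset: "block bs j \<subseteq> {..<sum_list bs}"
  using sum_list_take_mono[of "Suc j" "max (Suc j) (length bs)" bs] by (auto simp: block_def)

lemma block_disjoint:
  assumes "j \<noteq> k" shows "block bs j \<inter> block bs k = {}"
proof -
  have "block bs j \<inter> block bs k = {}" if "j < k" for j k
    using sum_list_take_mono[of "Suc j" k bs] that by (auto simp: block_def)
  from this[of j k] this[of k j] assms show ?thesis by (cases "j < k") auto
qed

lemma sum_blocks:
  fixes f :: "nat \<Rightarrow> real"
  shows "(\<Sum>j<length bs. \<Sum>i\<in>block bs j. f i) = (\<Sum>i<sum_list bs. f i)"
proof -
  have "(\<Sum>j<n. \<Sum>i\<in>block bs j. f i) = (\<Sum>i<sum_list (take n bs). f i)" if "n \<le> length bs" for n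
    using that
  proof (induction n)
    case (Suc n)
    have "{..<sum_list (take (Suc n) bs)} = {..<sum_list (take n bs)} \<union> block bs n"
      using sum_list_take_mono[of n "Suc n" bs] by (auto simp: block_def)
    moreover have "{..<sum_list (take n bs)} \<inter> block bs n = {}" by (auto simp: block_def)
    ultimately have "(\<Sum>i<sum_list (take (Suc n) bs). f i) = (\<Sum>i<sum_list (take n bs). f i) + (\<Sum>i\<in>block bs n. f i)"
      by (simp add: sum.union_disjoint)
    then show ?case using Suc by simp
  qed simp
  from this[of "length bs"] show ?thesis by simp
qed

text \<open>The blocks with a Stein factor; those of size at most 2 carry the flat prior.\<close>

definition big_blocks :: "nat list \<Rightarrow> nat set" where
  "big_blocks bs = {j. j < length bs \<and> bs ! j > 2}"

lemma finite_big_blocks [simp]: "finite (big_blocks bs)"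
  by (simp add: big_blocks_def)

lemma card_big_block: "j \<in> big_blocks bs \<Longrightarrow> card (block bs j) = bs ! j"
  by (simp add: big_blocks_def card_block)

lemma card_big_block_ge: "j \<in> big_blocks bs \<Longrightarrow> 3 \<le> card (block bs j)"
  by (simp add: big_blocks_def card_block)

lemma measurable_stein_mix [measurable (raw)]:
  assumes [measurable]: "\<And>i. (\<lambda>x. f x i) \<in> borel_measurable M"
  shows "(\<lambda>x. stein_mix B s (f x)) \<in> borel_measurable M"
  unfolding stein_mix_def by measurable

lemma AE_Rd_nonzero: "i < d \<Longrightarrow> AE \<theta> in Rd d. \<theta> i \<noteq> 0"
proof (rule AE_I')
  assume i: "i < d"
  let ?A = "\<lambda>j. if j = i then {0} else (UNIV :: real set)"
  have "emeasure (PiM {..<d} (\<lambda>_. lborel :: real measure)) (Pi\<^sub>E {..<d} ?A) = (\<Prod>j<d. emeasure lborel (?A j))"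
    by (intro product_sigma_finite.emeasure_PiM)
       (auto simp: product_sigma_finite_def lborel.sigma_finite_measure_axioms)
  also have "\<dots> = 0" using i by (intro prod_zero) auto
  finally show "Pi\<^sub>E {..<d} ?A \<in> null_sets (Rd d)"
    by (intro null_setsI) (auto simp: Rd_def intro!: sets_PiM_I_finite)
  show "{\<theta> \<in> space (Rd d). \<not> \<theta> i \<noteq> 0} \<subseteq> Pi\<^sub>E {..<d} ?A"
    by (auto simp: Rd_def space_PiM PiE_iff extensional_def)
qed

text \<open>The prior is improper, so this factor is mere scaling: it cancels between the posterior
  density and its normaliser.\<close>

definition stein_norm :: "nat list \<Rightarrow> real" where
  "stein_norm bs = (\<Prod>j\<in>big_blocks bs. 1 / enn2real (stein_const (bs ! j)))"

lemma stein_norm_pos: "0 < stein_norm bs"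
proof -
  have "0 < enn2real (stein_const (bs ! j))" if "j \<in> big_blocks bs" for j
    using stein_const_pos_finite[of "bs ! j"] that by (auto simp: big_blocks_def enn2real_positive_iff)
  then show ?thesis unfolding stein_norm_def by (intro prod_pos) auto
qed

lemma stein_prior_nonneg: "0 \<le> stein_prior bs \<theta>"
  by (auto simp: stein_prior_def intro!: prod_nonneg)

text \<open>The identity can fail only where a big block vanishes: there \<open>0 powr\<close> makes
  the prior 0 while the mixture is infinite. That set is null because a block has a coordinate, and
  each coordinate is almost surely nonzero.\<close>

lemma AE_stein_prior:
  assumes d: "d = sum_list bs"
  shows "AE \<theta> in Rd d. ennreal (stein_prior bs \<theta>)
     = ennreal (stein_norm bs) * (\<Prod>j\<in>big_blocks bs. stein_mix (block bs j) 0 \<theta>)"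
proof -
  have "AE \<theta> in Rd d. \<forall>j\<in>big_blocks bs. 0 < (\<Sum>i\<in>block bs j. (\<theta> i)\<^sup>2)"
    unfolding AE_ball_countable[OF countable_finite[OF finite_big_blocks]]
  proof
    fix j assume j: "j \<in> big_blocks bs"
    obtain i where i: "i \<in> block bs j" using card_big_block_ge[OF j] by fastforce
    then have "i < d" using block_subset[of bs j] by (auto simp: d)
    from AE_Rd_nonzero[OF this] show "AE \<theta> in Rd d. 0 < (\<Sum>i\<in>block bs j. (\<theta> i)\<^sup>2)"
      by eventually_elim (use i in \<open>auto intro!: sum_pos2\<close>)
  qed
  then show ?thesis
  proof eventually_elim
    fix \<theta> :: rseq assume R: "\<forall>j\<in>big_blocks bs. 0 < (\<Sum>i\<in>block bs j. (\<theta> i)\<^sup>2)"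
    have "ennreal (stein_prior bs \<theta>)
      = (\<Prod>j\<in>big_blocks bs. ennreal (sqrt (\<Sum>i\<in>block bs j. (\<theta> i)\<^sup>2) powr (2 - real (bs ! j))))"
      unfolding stein_prior_def big_blocks_def by (simp add: prod_ennreal)
    also have "\<dots> = (\<Prod>j\<in>big_blocks bs. ennreal (1 / enn2real (stein_const (bs ! j))) * stein_mix (block bs j) 0 \<theta>)"
    proof (intro prod.cong refl)
      fix j assume j: "j \<in> big_blocks bs"
      let ?R = "\<Sum>i\<in>block bs j. (\<theta> i)\<^sup>2"
      define c where "c = enn2real (stein_const (bs ! j))"
      have b: "3 \<le> bs ! j" using j by (auto simp: big_blocks_def)
      have c: "stein_const (bs ! j) = ennreal c" "0 < c"
        using stein_const_pos_finite[OF b] by (auto simp: c_def enn2real_positive_iff)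
      have R0: "0 < ?R" using R j by blast
      have "ennreal (1 / c) * stein_mix (block bs j) 0 \<theta>
        = ennreal (1 / c) * (ennreal (?R powr (1 - real (bs ! j) / 2)) * ennreal c)"
        using stein_mix_0[OF finite_block R0] c card_big_block[OF j] by simp
      also have "\<dots> = ennreal (?R powr (1 - real (bs ! j) / 2))"
        using c by (simp add: ennreal_mult'[symmetric])
      also have "?R powr (1 - real (bs ! j) / 2) = sqrt ?R powr (2 - real (bs ! j))"
        using R0 by (simp add: powr_half_sqrt[symmetric] powr_powr diff_divide_distrib)
      finally show "ennreal (sqrt ?R powr (2 - real (bs ! j)))
        = ennreal (1 / enn2real (stein_const (bs ! j))) * stein_mix (block bs j) 0 \<theta>"
        by (simp add: c_def)
    qed
    also have "\<dots> = ennreal (stein_norm bs) * (\<Prod>j\<in>big_blocks bs. stein_mix (block bs j) 0 \<theta>)"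
      by (simp add: prod.distrib stein_norm_def prod_ennreal)
    finally show "ennreal (stein_prior bs \<theta>)
     = ennreal (stein_norm bs) * (\<Prod>j\<in>big_blocks bs. stein_mix (block bs j) 0 \<theta>)" .
  qed
qed

lemma measurable_stein_prior [measurable]: "stein_prior bs \<in> borel_measurable (Rd d)"
  unfolding stein_prior_def by measurable

text \<open>The mixing variances become one variable per big block and are integrated last. Given
  them the coordinates are independent, and each integrates to a convolution of two Gaussians, or to
  1 outside the big blocks.\<close>

lemma stein_marginal:
  assumes d: "d = sum_list bs" and s: "0 < s"
  shows "(\<integral>\<^sup>+ \<theta>. ennreal (stein_prior bs \<theta> * (\<Prod>i<d. vnd s (z i - \<theta> i))) \<partial>Rd d)
     = ennreal (stein_norm bs) * (\<Prod>j\<in>big_blocks bs. stein_mix (block bs j) s z)"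
proof -
  let ?S = "big_blocks bs"
  let ?PS = "PiM ?S (\<lambda>_. lborel :: real measure)"
  have [measurable]: "(\<lambda>x. x i) \<in> borel_measurable ?PS" for i by (rule measurable_PiM_lborel_component)
  interpret R: sigma_finite_measure "Rd d" unfolding Rd_def by (rule sigma_finite_PiM_lborel) simp
  interpret PS: sigma_finite_measure ?PS by (rule sigma_finite_PiM_lborel) simp
  interpret RP: pair_sigma_finite "Rd d" ?PS ..
  define F where "F \<theta> \<tau> = (\<Prod>j\<in>?S. ennreal (\<Prod>i\<in>block bs j. vnd (\<tau> j) (\<theta> i)) * indicator {0<..} (\<tau> j))" for \<theta> \<tau> :: rseq
  define L where "L \<theta> = (\<Prod>i<d. ennreal (vnd s (z i - \<theta> i)))" for \<theta> :: rseq
  have [measurable]: "L \<in> borel_measurable (Rd d)" unfolding L_def by measurable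
  have m1: "(\<lambda>\<theta>. \<theta> i) \<in> borel_measurable (Rd d)" for i by measurable
  have F2: "(\<lambda>w. F (fst w) (snd w)) \<in> borel_measurable (Rd d \<Otimes>\<^sub>M ?PS)"
  proof -
    have [measurable]: "(\<lambda>w. fst w i) \<in> borel_measurable (Rd d \<Otimes>\<^sub>M ?PS)"
      "(\<lambda>w. snd w i) \<in> borel_measurable (Rd d \<Otimes>\<^sub>M ?PS)" for i
      by (rule measurable_compose[OF measurable_fst m1]
          measurable_compose[OF measurable_snd measurable_PiM_lborel_component])+
    show ?thesis unfolding F_def by measurable
  qed
  have Fm: "(\<lambda>\<tau>. F \<theta> \<tau>) \<in> borel_measurable ?PS" for \<theta> unfolding F_def by measurable
  have mix: "(\<Prod>j\<in>?S. stein_mix (block bs j) 0 \<theta>) = (\<integral>\<^sup>+ \<tau>. F \<theta> \<tau> \<partial>?PS)" for \<theta>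
    unfolding F_def stein_mix_def add_0_right
    by (rule nn_integral_PiM_lborel_prod[symmetric]) (auto, measurable)
  have inner: "(\<integral>\<^sup>+ \<theta>. F \<theta> \<tau> * L \<theta> \<partial>Rd d)
     = (\<Prod>j\<in>?S. ennreal (\<Prod>i\<in>block bs j. vnd (\<tau> j + s) (z i)) * indicator {0<..} (\<tau> j))" for \<tau>
  proof (cases "\<forall>j\<in>?S. 0 < \<tau> j")
    case False
    then obtain j where j: "j \<in> ?S" "\<not> 0 < \<tau> j" by auto
    then have "F \<theta> \<tau> = 0" for \<theta> unfolding F_def
      by (intro prod_zero finite_big_blocks bexI[OF _ j(1)]) (use j in auto)
    moreover have "(\<Prod>j\<in>?S. ennreal (\<Prod>i\<in>block bs j. vnd (\<tau> j + s) (z i)) * indicator {0<..} (\<tau> j)) = 0"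
      by (intro prod_zero finite_big_blocks bexI[OF _ j(1)]) (use j in auto)
    ultimately show ?thesis by simp
  next
    case True
    \<comment> \<open>By disjointness at most one block contains \<open>i\<close>, so at most one
      factor differs from 1; as a product over \<open>j\<close> it can be regrouped by
      coordinates.\<close>
    define f where "f i t = (\<Prod>j\<in>?S. if i \<in> block bs j then ennreal (vnd (\<tau> j) t) else 1) * ennreal (vnd s (z i - t))" for i t
    have fm: "f i \<in> borel_measurable borel" for i unfolding f_def[abs_def] by measurable
    have regroup: "(\<Prod>j\<in>?S. ennreal (\<Prod>i\<in>block bs j. g j i))
        = (\<Prod>i<d. \<Prod>j\<in>?S. if i \<in> block bs j then ennreal (g j i) else 1)"
      if g: "\<And>j i. j \<in> ?S \<Longrightarrow> 0 \<le> g j i" for g :: "nat \<Rightarrow> nat \<Rightarrow> real"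
    proof -
      have "(\<Prod>j\<in>?S. ennreal (\<Prod>i\<in>block bs j. g j i)) = (\<Prod>j\<in>?S. \<Prod>i<d. if i \<in> block bs j then ennreal (g j i) else 1)"
      proof (intro prod.cong refl)
        fix j assume j: "j \<in> ?S"
        have "(\<Prod>i<d. if i \<in> block bs j then ennreal (g j i) else 1) = (\<Prod>i\<in>{..<d} \<inter> block bs j. ennreal (g j i))"
          by (rule prod.inter_restrict[symmetric]) simp
        also have "{..<d} \<inter> block bs j = block bs j" using block_subset[of bs j] by (auto simp: d)
        finally show "ennreal (\<Prod>i\<in>block bs j. g j i) = (\<Prod>i<d. if i \<in> block bs j then ennreal (g j i) else 1)"
          using g[OF j] by (simp add: prod_ennreal)
      qed
      also have "\<dots> = (\<Prod>i<d. \<Prod>j\<in>?S. if i \<in> block bs j then ennreal (g j i) else 1)" by (rule prod.swap)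
      finally show ?thesis .
    qed
    have "F \<theta> \<tau> * L \<theta> = (\<Prod>i<d. f i (\<theta> i))" for \<theta>
    proof -
      have "F \<theta> \<tau> = (\<Prod>j\<in>?S. ennreal (\<Prod>i\<in>block bs j. vnd (\<tau> j) (\<theta> i)))"
        unfolding F_def using True by (intro prod.cong) auto
      also have "\<dots> = (\<Prod>i<d. \<Prod>j\<in>?S. if i \<in> block bs j then ennreal (vnd (\<tau> j) (\<theta> i)) else 1)"
        using True by (intro regroup) (auto intro: less_imp_le vnd_pos)
      finally show ?thesis unfolding L_def f_def by (simp add: prod.distrib)
    qed
    then have "(\<integral>\<^sup>+ \<theta>. F \<theta> \<tau> * L \<theta> \<partial>Rd d) = (\<Prod>i<d. \<integral>\<^sup>+ t. f i t \<partial>lborel)"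
      unfolding Rd_def by (simp add: nn_integral_PiM_lborel_prod fm)
    also have "\<dots> = (\<Prod>i<d. \<Prod>j\<in>?S. if i \<in> block bs j then ennreal (vnd (\<tau> j + s) (z i)) else 1)"
    proof (intro prod.cong refl)
      fix i
      show "(\<integral>\<^sup>+ t. f i t \<partial>lborel) = (\<Prod>j\<in>?S. if i \<in> block bs j then ennreal (vnd (\<tau> j + s) (z i)) else 1)"
      proof (cases "\<exists>j\<in>?S. i \<in> block bs j")
        case False
        then have "f i t = ennreal (vnd s (z i - t))" for t
          unfolding f_def by (subst prod.neutral) auto
        moreover have "(\<Prod>j\<in>?S. if i \<in> block bs j then ennreal (vnd (\<tau> j + s) (z i)) else 1) = 1"
          using False by (intro prod.neutral) auto
        ultimately show ?thesis using s by (simp add: nn_integral_vnd)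
      next
        case ex: True
        then obtain k where k: "k \<in> ?S" "i \<in> block bs k" by blast
        have iff: "i \<in> block bs j \<longleftrightarrow> j = k" for j using block_disjoint[of j k bs] k by auto
        have "f i t = ennreal (vnd s (z i - t)) * ennreal (vnd (\<tau> k) t)" for t
          unfolding f_def iff using k by (simp add: prod.delta mult.commute)
        then show ?thesis
          unfolding iff using k s True by (simp add: prod.delta nn_integral_vnd_conv add.commute)
      qed
    qed
    also have "\<dots> = (\<Prod>j\<in>?S. ennreal (\<Prod>i\<in>block bs j. vnd (\<tau> j + s) (z i)))"
      using True s by (intro regroup[symmetric]) (auto intro!: less_imp_le vnd_pos add_pos_pos)
    also have "\<dots> = (\<Prod>j\<in>?S. ennreal (\<Prod>i\<in>block bs j. vnd (\<tau> j + s) (z i)) * indicator {0<..} (\<tau> j))"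
      using True by (intro prod.cong) auto
    finally show ?thesis .
  qed
  have "(\<integral>\<^sup>+ \<theta>. ennreal (stein_prior bs \<theta> * (\<Prod>i<d. vnd s (z i - \<theta> i))) \<partial>Rd d)
    = (\<integral>\<^sup>+ \<theta>. ennreal (stein_norm bs) * (\<integral>\<^sup>+ \<tau>. F \<theta> \<tau> * L \<theta> \<partial>?PS) \<partial>Rd d)"
    using AE_stein_prior[OF d]
  proof (intro nn_integral_cong_AE, eventually_elim)
    fix \<theta> assume "ennreal (stein_prior bs \<theta>)
      = ennreal (stein_norm bs) * (\<Prod>j\<in>big_blocks bs. stein_mix (block bs j) 0 \<theta>)"
    moreover have "ennreal (stein_prior bs \<theta> * (\<Prod>i<d. vnd s (z i - \<theta> i))) = ennreal (stein_prior bs \<theta>) * L \<theta>"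
      unfolding L_def using s by (subst prod_ennreal) (auto simp: ennreal_mult' stein_prior_nonneg intro: less_imp_le vnd_pos)
    moreover have "(\<integral>\<^sup>+ \<tau>. F \<theta> \<tau> * L \<theta> \<partial>?PS) = (\<integral>\<^sup>+ \<tau>. F \<theta> \<tau> \<partial>?PS) * L \<theta>"
      by (rule nn_integral_multc[OF Fm])
    ultimately show "ennreal (stein_prior bs \<theta> * (\<Prod>i<d. vnd s (z i - \<theta> i)))
      = ennreal (stein_norm bs) * (\<integral>\<^sup>+ \<tau>. F \<theta> \<tau> * L \<theta> \<partial>?PS)" by (simp add: mix mult.assoc)
  qed
  also have "\<dots> = ennreal (stein_norm bs) * (\<integral>\<^sup>+ \<theta>. \<integral>\<^sup>+ \<tau>. F \<theta> \<tau> * L \<theta> \<partial>?PS \<partial>Rd d)"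
  proof (rule nn_integral_cmult)
    have "(\<lambda>\<theta>. \<integral>\<^sup>+ \<tau>. F \<theta> \<tau> * L \<theta> \<partial>?PS) = (\<lambda>\<theta>. (\<Prod>j\<in>?S. stein_mix (block bs j) 0 \<theta>) * L \<theta>)"
      by (intro ext) (simp add: nn_integral_multc[OF Fm] mix)
    then show "(\<lambda>\<theta>. \<integral>\<^sup>+ \<tau>. F \<theta> \<tau> * L \<theta> \<partial>?PS) \<in> borel_measurable (Rd d)" by simp
  qed
  also have "(\<integral>\<^sup>+ \<theta>. \<integral>\<^sup>+ \<tau>. F \<theta> \<tau> * L \<theta> \<partial>?PS \<partial>Rd d) = (\<integral>\<^sup>+ \<tau>. \<integral>\<^sup>+ \<theta>. F \<theta> \<tau> * L \<theta> \<partial>Rd d \<partial>?PS)"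
    by (rule RP.Fubini'[symmetric]) (use F2 in \<open>auto simp: split_beta'\<close>)
  also have "\<dots> = (\<Prod>j\<in>?S. stein_mix (block bs j) s z)"
    unfolding inner stein_mix_def by (rule nn_integral_PiM_lborel_prod) (auto, measurable)
  finally show ?thesis .
qed

section \<open>The risk of the blockwise Stein predictive distribution\<close>

text \<open>A cylinder set splits into a rectangle with one side over \<open>I\<close> and the other
  over its complement.\<close>

lemma merge_gauss_prod:
  fixes e2 :: real
  assumes e2: "0 < e2"
  shows "distr (PiM I (\<lambda>i. gauss (\<theta> i) e2) \<Otimes>\<^sub>M PiM (- I) (\<lambda>_. gauss 0 e2)) Rinf (merge I (- I))
    = gauss_prod (\<lambda>i. if i \<in> I then \<theta> i else 0) (\<lambda>_. e2)"
proof -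
  let ?M = "\<lambda>i. gauss (if i \<in> I then \<theta> i else 0) e2"
  have pr: "prob_space (?M i)" for i by (rule prob_space_gauss[OF e2])
  interpret product_prob_space ?M UNIV
    unfolding product_prob_space_def product_prob_space_axioms_def product_sigma_finite_def
    using pr by (auto simp: prob_space_imp_sigma_finite)
  have e1: "PiM I (\<lambda>i. gauss (\<theta> i) e2) = PiM I ?M" by (intro PiM_cong) auto
  have e2': "PiM (- I) (\<lambda>_. gauss 0 e2) = PiM (- I) ?M" by (intro PiM_cong) auto
  interpret A: prob_space "PiM I ?M" by (intro prob_space_PiM pr)
  interpret B: prob_space "PiM (- I) ?M" by (intro prob_space_PiM pr)
  have Rinf: "sets Rinf = sets (PiM UNIV ?M)"
    unfolding Rinf_def by (intro sets_PiM_cong) auto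
  have mm: "merge I (- I) \<in> PiM I ?M \<Otimes>\<^sub>M PiM (- I) ?M \<rightarrow>\<^sub>M PiM UNIV ?M"
    using measurable_merge[of I "- I" ?M] by simp
  have mm': "merge I (- I) \<in> PiM I ?M \<Otimes>\<^sub>M PiM (- I) ?M \<rightarrow>\<^sub>M Rinf"
    using mm by (simp add: Rinf cong: measurable_cong_sets)
  show ?thesis
    unfolding gauss_prod_def e1 e2'
  proof (rule PiM_eq)
    fix J F assume J: "finite J" and F: "\<And>j. j \<in> J \<Longrightarrow> F j \<in> sets (?M j)"
    let ?E = "prod_emb UNIV ?M J (\<Pi>\<^sub>E j\<in>J. F j)"
    let ?E1 = "prod_emb I ?M (J \<inter> I) (\<Pi>\<^sub>E j\<in>J \<inter> I. F j)"
    let ?E2 = "prod_emb (- I) ?M (J \<inter> - I) (\<Pi>\<^sub>E j\<in>J \<inter> - I. F j)"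
    have E: "?E \<in> sets Rinf" unfolding Rinf using J F by (intro sets_PiM_I) auto
    have s1: "?E1 \<in> sets (PiM I ?M)" using J F by (intro sets_PiM_I) auto
    have s2: "?E2 \<in> sets (PiM (- I) ?M)" using J F by (intro sets_PiM_I) auto
    have pre: "merge I (- I) -` ?E \<inter> space (PiM I ?M \<Otimes>\<^sub>M PiM (- I) ?M) = ?E1 \<times> ?E2"
      by (auto simp: prod_emb_def space_pair_measure space_PiM PiE_iff merge_def split: if_splits)
    have "emeasure (distr (PiM I ?M \<Otimes>\<^sub>M PiM (- I) ?M) Rinf (merge I (- I))) ?E
      = emeasure (PiM I ?M \<Otimes>\<^sub>M PiM (- I) ?M) (?E1 \<times> ?E2)"
      unfolding pre[symmetric] by (rule emeasure_distr[OF mm' E])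
    also have "\<dots> = emeasure (PiM I ?M) ?E1 * emeasure (PiM (- I) ?M) ?E2"
      by (rule B.emeasure_pair_measure_Times[OF s1 s2])
    also have "emeasure (PiM I ?M) ?E1 = (\<Prod>j\<in>J \<inter> I. emeasure (?M j) (F j))"
      using J F by (intro Infinite_Product_Measure.emeasure_PiM_emb pr) auto
    also have "emeasure (PiM (- I) ?M) ?E2 = (\<Prod>j\<in>J \<inter> - I. emeasure (?M j) (F j))"
      using J F by (intro Infinite_Product_Measure.emeasure_PiM_emb pr) auto
    also have "(\<Prod>j\<in>J \<inter> I. emeasure (?M j) (F j)) * (\<Prod>j\<in>J \<inter> - I. emeasure (?M j) (F j))
      = (\<Prod>j\<in>(J \<inter> I) \<union> (J \<inter> - I). emeasure (?M j) (F j))"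
      using J by (intro prod.union_disjoint[symmetric]) auto
    also have "(J \<inter> I) \<union> (J \<inter> - I) = J" by auto
    finally show "emeasure (distr (PiM I ?M \<Otimes>\<^sub>M PiM (- I) ?M) Rinf (merge I (- I))) ?E
      = (\<Prod>j\<in>J. emeasure (?M j) (F j))" .
  qed (simp add: Rinf)
qed

text \<open>Cylinder sets form a generator closed under intersection, and the mass of a cylinder is
  a finite product of parametrised integrals.\<close>

lemma measurable_gauss_kernel:
  fixes e2 :: real
  assumes e2: "0 < e2"
  shows "(\<lambda>\<theta>. PiM {..<d} (\<lambda>i. gauss (\<theta> i) e2)) \<in> Rd d \<rightarrow>\<^sub>M prob_algebra (PiM {..<d} (\<lambda>_. borel))"
proof (rule measurable_prob_algebra_generated)
  show "sets (PiM {..<d} (\<lambda>_. borel :: real measure)) = sigma_sets (\<Pi>\<^sub>E i\<in>{..<d}. space borel) (prod_algebra {..<d} (\<lambda>_. borel))"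
    by (rule sets_PiM)
  show "Int_stable (prod_algebra {..<d} (\<lambda>_. borel :: real measure))" by (rule Int_stable_prod_algebra)
  show "prod_algebra {..<d} (\<lambda>_. borel :: real measure) \<subseteq> Pow (\<Pi>\<^sub>E i\<in>{..<d}. space borel)"
    by (rule prod_algebra_sets_into_space)
  show "prob_space (PiM {..<d} (\<lambda>i. gauss (\<theta> i) e2))" for \<theta>
    by (intro prob_space_PiM prob_space_gauss e2)
  show "sets (PiM {..<d} (\<lambda>i. gauss (\<theta> i) e2)) = sets (PiM {..<d} (\<lambda>_. borel))" for \<theta>
    by (intro sets_PiM_cong) auto
  fix A assume "A \<in> prod_algebra {..<d} (\<lambda>_. borel :: real measure)"
  then obtain J E where A: "A = prod_emb {..<d} (\<lambda>_. borel) J (Pi\<^sub>E J E)" and J: "finite J" "J \<subseteq> {..<d}"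
    and E: "\<And>i. i \<in> J \<Longrightarrow> E i \<in> sets borel"
    by (elim prod_algebraE) auto
  have "emeasure (PiM {..<d} (\<lambda>i. gauss (\<theta> i) e2)) A
    = (\<Prod>i\<in>J. \<integral>\<^sup>+ y. ennreal (vnd (e2\<^sup>2) (y - \<theta> i)) * indicator (E i) y \<partial>lborel)" for \<theta>
  proof -
    have "A = prod_emb {..<d} (\<lambda>i. gauss (\<theta> i) e2) J (Pi\<^sub>E J E)" by (simp add: A prod_emb_def)
    then have "emeasure (PiM {..<d} (\<lambda>i. gauss (\<theta> i) e2)) A = (\<Prod>i\<in>J. emeasure (gauss (\<theta> i) e2) (E i))"
      using J E by (simp add: Infinite_Product_Measure.emeasure_PiM_emb prob_space_gauss e2)
    also have "\<dots> = (\<Prod>i\<in>J. \<integral>\<^sup>+ y. ennreal (vnd (e2\<^sup>2) (y - \<theta> i)) * indicator (E i) y \<partial>lborel)"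
      using E by (intro prod.cong) (auto simp: gauss_def emeasure_density normal_density_eq_vnd)
    finally show ?thesis .
  qed
  moreover have "(\<lambda>\<theta>. \<integral>\<^sup>+ y. ennreal (vnd (e2\<^sup>2) (y - \<theta> i)) * indicator (E i) y \<partial>lborel) \<in> borel_measurable (Rd d)"
    if "i \<in> J" for i
  proof -
    have [measurable]: "E i \<in> sets borel" by (rule E[OF that])
    have [measurable]: "(\<lambda>w. fst w i) \<in> borel_measurable (Rd d \<Otimes>\<^sub>M lborel)"
      by (rule measurable_compose[OF measurable_fst measurable_Rd_component])
    have "(\<lambda>(\<theta>, y). ennreal (vnd (e2\<^sup>2) (y - \<theta> i)) * indicator (E i) y) \<in> borel_measurable (Rd d \<Otimes>\<^sub>M lborel)"
      unfolding split_beta' by measurable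
    from lborel.borel_measurable_nn_integral[OF this] show ?thesis .
  qed
  ultimately show "(\<lambda>\<theta>. emeasure (PiM {..<d} (\<lambda>i. gauss (\<theta> i) e2)) A) \<in> borel_measurable (Rd d)"
    by (simp add: borel_measurable_prod_ennreal)
qed

definition stein_mix_real :: "nat set \<Rightarrow> real \<Rightarrow> rseq \<Rightarrow> real" where
  "stein_mix_real B s z = enn2real (stein_mix B s z)"

text \<open>A density with respect to \<open>N(0, e2\<^sup>2)\<close>-noise, not to Lebesgue measure.\<close>

definition stein_density :: "nat list \<Rightarrow> real \<Rightarrow> real \<Rightarrow> rseq \<Rightarrow> rseq \<Rightarrow> real" where
  "stein_density bs v u x y =
     (\<Prod>i<sum_list bs. vnd (v + u) (x i - y i) / vnd u (y i)) *
     (\<Prod>j\<in>big_blocks bs. stein_mix_real (block bs j) (pooled v u) (\<lambda>i. pool v u (x i) (y i))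
        / stein_mix_real (block bs j) v x)"

context
  fixes e e2 v u :: real and bs :: "nat list" and d :: nat
  assumes e: "0 < e" and e2: "0 < e2" and v_def: "v = e\<^sup>2" and u_def: "u = e2\<^sup>2" and d: "d = sum_list bs"
begin

lemma vu_pos: "0 < v" "0 < u" "0 < pooled v u" "0 < v + u"
  using e e2 pooled_pos[of v u] by (auto simp: v_def u_def add_pos_pos)

lemma stein_mix_real:
  assumes "j \<in> big_blocks bs" "0 < s"
  shows "stein_mix (block bs j) s z = ennreal (stein_mix_real (block bs j) s z)" "0 < stein_mix_real (block bs j) s z"
  using stein_mix_pos_finite[OF finite_block card_big_block_ge[OF assms(1)] assms(2), of z]
  by (auto simp: stein_mix_real_def enn2real_positive_iff)

lemma stein_density_pos: "0 < stein_density bs v u x y"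
  unfolding stein_density_def using vu_pos
  by (auto intro!: mult_pos_pos prod_pos divide_pos_pos vnd_pos stein_mix_real(2))

lemma measurable_stein_density:
  "(\<lambda>(x, y). stein_density bs v u x y) \<in> borel_measurable (Rinf \<Otimes>\<^sub>M Rinf)"
  unfolding stein_density_def stein_mix_real_def split_beta' by measurable

text \<open>Tonelli moves the posterior integral inside. Then \<open>vnd_pair\<close> merges the
  likelihoods of \<open>x\<close> and \<open>y\<close> into that of the pooled observation, and
  \<open>stein_marginal\<close> evaluates both this integral and the posterior normaliser.\<close>

lemma emeasure_stein_pred:
  assumes A: "A \<in> sets Rinf"
  shows "emeasure (stein_pred d bs e e2 x) A
    = (\<integral>\<^sup>+ y. ennreal (stein_density bs v u x y) * indicator A y \<partial>gauss_prod (\<lambda>_. 0) (\<lambda>_. e2))"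
    and prob_space_stein_pred: "prob_space (stein_pred d bs e e2 x)"
proof -
  let ?G = "gauss_prod (\<lambda>_. 0) (\<lambda>_. e2)"
  let ?S = "big_blocks bs"
  define w where "w \<theta> = ennreal (stein_prior bs \<theta> * (\<Prod>i<d. vnd v (x i - \<theta> i)))" for \<theta>
  \<comment> \<open>The normaliser is positive and finite, so the posterior is a probability measure
    although the prior is improper.\<close>
  define Z where "Z = stein_norm bs * (\<Prod>j\<in>?S. stein_mix_real (block bs j) v x)"
  have Z0: "0 < Z" unfolding Z_def using vu_pos
    by (intro mult_pos_pos stein_norm_pos prod_pos stein_mix_real(2)) auto
  have mixes: "ennreal (stein_norm bs) * (\<Prod>j\<in>?S. stein_mix (block bs j) s z)
     = ennreal (stein_norm bs * (\<Prod>j\<in>?S. stein_mix_real (block bs j) s z))" if "0 < s" for s z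
    using stein_mix_real[OF _ that, of _ z] stein_norm_pos[of bs]
    by (simp add: ennreal_mult' prod_ennreal less_imp_le)
  have Z: "(\<integral>\<^sup>+ \<theta>. w \<theta> \<partial>Rd d) = ennreal Z"
    unfolding w_def Z_def stein_marginal[OF d vu_pos(1)] by (rule mixes[OF vu_pos(1)])
  have w_m[measurable]: "w \<in> borel_measurable (Rd d)" unfolding w_def by measurable
  let ?K = "\<lambda>\<theta>. PiM {..<d} (\<lambda>i. gauss (\<theta> i) e2)"
  let ?T = "PiM {d..} (\<lambda>_. gauss 0 e2)"
  let ?B = "PiM {..<d} (\<lambda>_. borel :: real measure)"
  let ?post = "density (Rd d) (\<lambda>\<theta>. w \<theta> / ennreal Z)"
  have post: "stein_posterior d bs e x = ?post"
    using Z unfolding stein_posterior_def Let_def w_def normal_density_eq_vnd v_def by simp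
  have Km: "?K \<in> ?post \<rightarrow>\<^sub>M subprob_algebra ?B"
    using measurable_prob_algebraD[OF measurable_gauss_kernel[OF e2, of d]] by (simp cong: measurable_cong_sets)
  have ne: "space ?post \<noteq> {}" by (auto simp: Rd_def space_PiM PiE_eq_empty_iff)
  have sets_bind: "sets (bind ?post ?K) = sets ?B" by (rule sets_bind_measurable[OF Km ne])
  interpret T: prob_space ?T by (intro prob_space_PiM prob_space_gauss e2)
  have dc: "{d..} = - {..<d}" by auto
  have sT: "sets ?T = sets (PiM {d..} (\<lambda>_. borel))" by (intro sets_PiM_cong) auto
  have mm: "merge {..<d} {d..} \<in> ?B \<Otimes>\<^sub>M ?T \<rightarrow>\<^sub>M Rinf"
  proof -
    have un: "{..<d} \<union> {d..} = UNIV" by auto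
    have "merge {..<d} {d..} \<in> ?B \<Otimes>\<^sub>M PiM {d..} (\<lambda>_. borel :: real measure) \<rightarrow>\<^sub>M Rinf"
      unfolding Rinf_def un[symmetric] by (rule measurable_merge)
    moreover have "sets (?B \<Otimes>\<^sub>M ?T) = sets (?B \<Otimes>\<^sub>M PiM {d..} (\<lambda>_. borel :: real measure))"
      by (rule sets_pair_measure_cong[OF refl sT])
    ultimately show ?thesis using measurable_cong_sets[OF _ refl] by blast
  qed
  define X where "X = merge {..<d} {d..} -` A \<inter> space (?B \<Otimes>\<^sub>M ?T)"
  have X: "X \<in> sets (?B \<Otimes>\<^sub>M ?T)" unfolding X_def by (rule measurable_sets[OF mm A])
  have sets_pair: "sets (N \<Otimes>\<^sub>M ?T) = sets (?B \<Otimes>\<^sub>M ?T)" "space (N \<Otimes>\<^sub>M ?T) = space (?B \<Otimes>\<^sub>M ?T)"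
    if "sets N = sets ?B" for N
    using that by (auto intro!: sets_pair_measure_cong sets_eq_imp_space_eq)
  have d_distr: "emeasure (distr (N \<Otimes>\<^sub>M ?T) Rinf (merge {..<d} {d..})) A = (\<integral>\<^sup>+ y. emeasure ?T (Pair y -` X) \<partial>N)"
    if N: "sets N = sets ?B" for N
  proof -
    have "merge {..<d} {d..} \<in> N \<Otimes>\<^sub>M ?T \<rightarrow>\<^sub>M Rinf"
      using mm sets_pair(1)[OF N] by (simp cong: measurable_cong_sets)
    then have "emeasure (distr (N \<Otimes>\<^sub>M ?T) Rinf (merge {..<d} {d..})) A = emeasure (N \<Otimes>\<^sub>M ?T) X"
      using A sets_pair(2)[OF N] by (simp add: emeasure_distr X_def)
    also have "\<dots> = (\<integral>\<^sup>+ y. emeasure ?T (Pair y -` X) \<partial>N)"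
      using X sets_pair(1)[OF N] by (intro T.emeasure_pair_measure_alt) auto
    finally show ?thesis .
  qed
  have slice_m: "(\<lambda>y. emeasure ?T (Pair y -` X)) \<in> borel_measurable ?B"
    by (rule T.measurable_emeasure_Pair[OF X])
  have sK: "sets (?K \<theta>) = sets ?B" for \<theta> by (intro sets_PiM_cong) auto
  have "(\<integral>\<^sup>+ \<theta>. w \<theta> / ennreal Z \<partial>Rd d) = 1"
    using Z0 by (subst nn_integral_divide) (auto simp: Z divide_ennreal)
  then have "prob_space ?post"
    by (intro prob_spaceI) (simp add: emeasure_density cong: nn_integral_cong)
  then have "prob_space (bind ?post ?K)"
    by (intro prob_space.prob_space_bind[OF _ _ Km] AE_I2 prob_space_PiM prob_space_gauss e2)
  then have "prob_space (bind ?post ?K \<Otimes>\<^sub>M ?T)"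
    by (intro prob_space_pair T.prob_space_axioms)
  moreover have "merge {..<d} {d..} \<in> bind ?post ?K \<Otimes>\<^sub>M ?T \<rightarrow>\<^sub>M Rinf"
    using mm sets_pair(1)[OF sets_bind] by (simp cong: measurable_cong_sets)
  ultimately show "prob_space (stein_pred d bs e e2 x)"
    unfolding stein_pred_def post by (rule prob_space.prob_space_distr)
  have "emeasure (stein_pred d bs e e2 x) A = (\<integral>\<^sup>+ y. emeasure ?T (Pair y -` X) \<partial>bind ?post ?K)"
    unfolding stein_pred_def post by (rule d_distr[OF sets_bind])
  also have "\<dots> = (\<integral>\<^sup>+ \<theta>. \<integral>\<^sup>+ y. emeasure ?T (Pair y -` X) \<partial>?K \<theta> \<partial>?post)"
    by (rule nn_integral_bind[OF slice_m Km])
  also have "\<dots> = (\<integral>\<^sup>+ \<theta>. emeasure (gauss_prod (\<lambda>i. if i \<in> {..<d} then \<theta> i else 0) (\<lambda>_. e2)) A \<partial>?post)"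
  proof (intro nn_integral_cong)
    fix \<theta>
    show "(\<integral>\<^sup>+ y. emeasure ?T (Pair y -` X) \<partial>?K \<theta>) = emeasure (gauss_prod (\<lambda>i. if i \<in> {..<d} then \<theta> i else 0) (\<lambda>_. e2)) A"
      using d_distr[OF sK, of \<theta>] merge_gauss_prod[OF e2, of "{..<d}" \<theta>] unfolding dc[symmetric] by simp
  qed
  also have "\<dots> = (\<integral>\<^sup>+ \<theta>. \<integral>\<^sup>+ y. ennreal (\<Prod>i<d. shift_ratio e2 (\<theta> i) (y i)) * indicator A y \<partial>?G \<partial>?post)"
  proof (intro nn_integral_cong)
    fix \<theta>
    show "emeasure (gauss_prod (\<lambda>i. if i \<in> {..<d} then \<theta> i else 0) (\<lambda>_. e2)) A
      = (\<integral>\<^sup>+ y. ennreal (\<Prod>i<d. shift_ratio e2 (\<theta> i) (y i)) * indicator A y \<partial>?G)"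
      unfolding gauss_prod_shift_finite_set[OF e2 finite_lessThan] using A by (subst emeasure_density) auto
  qed
  also have "\<dots> = (\<integral>\<^sup>+ \<theta>. \<integral>\<^sup>+ y. (w \<theta> / ennreal Z) * (ennreal (\<Prod>i<d. shift_ratio e2 (\<theta> i) (y i)) * indicator A y) \<partial>?G \<partial>Rd d)"
  proof -
    interpret G: prob_space ?G by (intro prob_space_gauss_prod e2)
    note [measurable] = A
    have [measurable]: "(\<lambda>w. fst w i) \<in> borel_measurable (Rd d \<Otimes>\<^sub>M ?G)" for i
      by (rule measurable_compose[OF measurable_fst measurable_Rd_component])
    have "(\<lambda>(\<theta>, y). ennreal (\<Prod>i<d. shift_ratio e2 (\<theta> i) (y i)) * indicator A y) \<in> borel_measurable (Rd d \<Otimes>\<^sub>M ?G)"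
      unfolding split_beta' shift_ratio_def by measurable
    from G.borel_measurable_nn_integral[OF this]
    have "(\<lambda>\<theta>. \<integral>\<^sup>+ y. ennreal (\<Prod>i<d. shift_ratio e2 (\<theta> i) (y i)) * indicator A y \<partial>?G) \<in> borel_measurable (Rd d)" .
    moreover have "(\<lambda>y. ennreal (\<Prod>i<d. shift_ratio e2 (\<theta> i) (y i)) * indicator A y) \<in> borel_measurable ?G" for \<theta>
      unfolding shift_ratio_def by measurable
    ultimately show ?thesis by (simp add: nn_integral_density nn_integral_cmult)
  qed
  also have "\<dots> = (\<integral>\<^sup>+ y. \<integral>\<^sup>+ \<theta>. (w \<theta> / ennreal Z) * (ennreal (\<Prod>i<d. shift_ratio e2 (\<theta> i) (y i)) * indicator A y) \<partial>Rd d \<partial>?G)"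
  proof -
    interpret G: prob_space ?G by (intro prob_space_gauss_prod e2)
    interpret R: sigma_finite_measure "Rd d" unfolding Rd_def by (rule sigma_finite_PiM_lborel) simp
    interpret RG: pair_sigma_finite "Rd d" ?G ..
    note [measurable] = A
    have [measurable]: "(\<lambda>w. fst w i) \<in> borel_measurable (Rd d \<Otimes>\<^sub>M ?G)" for i
      by (rule measurable_compose[OF measurable_fst measurable_Rd_component])
    have "(\<lambda>(\<theta>, y). (w \<theta> / ennreal Z) * (ennreal (\<Prod>i<d. shift_ratio e2 (\<theta> i) (y i)) * indicator A y)) \<in> borel_measurable (Rd d \<Otimes>\<^sub>M ?G)"
      unfolding split_beta' shift_ratio_def by measurable
    from RG.Fubini'[OF this] show ?thesis by simp
  qed
  also have "\<dots> = (\<integral>\<^sup>+ y. ennreal (stein_density bs v u x y) * indicator A y \<partial>?G)"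
  proof (intro nn_integral_cong)
    fix y
    let ?p = "\<lambda>i. pool v u (x i) (y i)"
    define C where "C = (\<Prod>i<d. vnd (v + u) (x i - y i) / vnd u (y i))"
    have C0: "0 < C" unfolding C_def using vu_pos by (auto intro!: prod_pos divide_pos_pos vnd_pos)
    have sr: "shift_ratio e2 t y = vnd u (y - t) / vnd u y" for t y
      using normal_density_shift[OF e2, of y t] vnd_pos[OF vu_pos(2), of y]
      by (simp add: normal_density_eq_vnd u_def field_simps)
    have eq: "w \<theta> * ennreal (\<Prod>i<d. shift_ratio e2 (\<theta> i) (y i))
      = ennreal C * ennreal (stein_prior bs \<theta> * (\<Prod>i<d. vnd (pooled v u) (?p i - \<theta> i)))" for \<theta>
    proof -
      have "(\<Prod>i<d. vnd v (x i - \<theta> i)) * (\<Prod>i<d. shift_ratio e2 (\<theta> i) (y i))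
        = C * (\<Prod>i<d. vnd (pooled v u) (?p i - \<theta> i))"
        unfolding C_def prod.distrib[symmetric]
      proof (intro prod.cong refl)
        fix i
        show "vnd v (x i - \<theta> i) * shift_ratio e2 (\<theta> i) (y i)
          = vnd (v + u) (x i - y i) / vnd u (y i) * vnd (pooled v u) (?p i - \<theta> i)"
          unfolding sr using vnd_pair[OF vu_pos(1,2), of "x i" "\<theta> i" "y i"] by simp
      qed
      then have "stein_prior bs \<theta> * (\<Prod>i<d. vnd v (x i - \<theta> i)) * (\<Prod>i<d. shift_ratio e2 (\<theta> i) (y i))
        = C * (stein_prior bs \<theta> * (\<Prod>i<d. vnd (pooled v u) (?p i - \<theta> i)))"
        by (simp add: mult.assoc mult.left_commute)
      then have "ennreal (stein_prior bs \<theta> * (\<Prod>i<d. vnd v (x i - \<theta> i)) * (\<Prod>i<d. shift_ratio e2 (\<theta> i) (y i)))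
        = ennreal (C * (stein_prior bs \<theta> * (\<Prod>i<d. vnd (pooled v u) (?p i - \<theta> i))))" by (rule arg_cong)
      moreover have "0 \<le> (\<Prod>i<d. shift_ratio e2 (\<theta> i) (y i))"
        by (intro prod_nonneg) (auto simp: less_imp_le[OF shift_ratio_pos])
      ultimately show ?thesis unfolding w_def
        using ennreal_mult'' ennreal_mult' less_imp_le[OF C0] by metis
    qed
    have "(\<integral>\<^sup>+ \<theta>. (w \<theta> / ennreal Z) * (ennreal (\<Prod>i<d. shift_ratio e2 (\<theta> i) (y i)) * indicator A y) \<partial>Rd d)
      = (\<integral>\<^sup>+ \<theta>. (ennreal C / ennreal Z * indicator A y) *
          ennreal (stein_prior bs \<theta> * (\<Prod>i<d. vnd (pooled v u) (?p i - \<theta> i))) \<partial>Rd d)"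
    proof (intro nn_integral_cong)
      fix \<theta>
      have "(w \<theta> / ennreal Z) * (ennreal (\<Prod>i<d. shift_ratio e2 (\<theta> i) (y i)) * indicator A y)
        = (w \<theta> * ennreal (\<Prod>i<d. shift_ratio e2 (\<theta> i) (y i))) / ennreal Z * indicator A y"
        by (simp add: divide_ennreal_def mult_ac)
      then show "(w \<theta> / ennreal Z) * (ennreal (\<Prod>i<d. shift_ratio e2 (\<theta> i) (y i)) * indicator A y)
        = (ennreal C / ennreal Z * indicator A y) *
          ennreal (stein_prior bs \<theta> * (\<Prod>i<d. vnd (pooled v u) (?p i - \<theta> i)))"
        unfolding eq by (simp add: divide_ennreal_def mult_ac)
    qed
    also have "\<dots> = (ennreal C / ennreal Z * indicator A y) *
        (\<integral>\<^sup>+ \<theta>. ennreal (stein_prior bs \<theta> * (\<Prod>i<d. vnd (pooled v u) (?p i - \<theta> i))) \<partial>Rd d)"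
      by (rule nn_integral_cmult) measurable
    also have "(\<integral>\<^sup>+ \<theta>. ennreal (stein_prior bs \<theta> * (\<Prod>i<d. vnd (pooled v u) (?p i - \<theta> i))) \<partial>Rd d)
      = ennreal (stein_norm bs * (\<Prod>j\<in>?S. stein_mix_real (block bs j) (pooled v u) ?p))"
      unfolding stein_marginal[OF d vu_pos(3)] by (rule mixes[OF vu_pos(3)])
    also have "(ennreal C / ennreal Z * indicator A y) * \<dots>
      = ennreal (C / Z * (stein_norm bs * (\<Prod>j\<in>?S. stein_mix_real (block bs j) (pooled v u) ?p))) * indicator A y"
      using C0 Z0 by (simp add: divide_ennreal ennreal_mult'[symmetric] mult_ac split: split_indicator)
    also have "C / Z * (stein_norm bs * (\<Prod>j\<in>?S. stein_mix_real (block bs j) (pooled v u) ?p)) = stein_density bs v u x y"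
      using stein_norm_pos[of bs] by (simp add: stein_density_def C_def Z_def d prod_dividef)
    finally show "(\<integral>\<^sup>+ \<theta>. (w \<theta> / ennreal Z) * (ennreal (\<Prod>i<d. shift_ratio e2 (\<theta> i) (y i)) * indicator A y) \<partial>Rd d)
      = ennreal (stein_density bs v u x y) * indicator A y" .
  qed
  finally show "emeasure (stein_pred d bs e e2 x) A
    = (\<integral>\<^sup>+ y. ennreal (stein_density bs v u x y) * indicator A y \<partial>gauss_prod (\<lambda>_. 0) (\<lambda>_. e2))" .
qed

lemma stein_pred_density:
  "stein_pred d bs e e2 x = density (gauss_prod (\<lambda>_. 0) (\<lambda>_. e2)) (\<lambda>y. ennreal (stein_density bs v u x y))"
proof (rule measure_eqI)
  have [measurable]: "stein_density bs v u x \<in> borel_measurable Rinf"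
    using measurable_compose_Pair1[OF _ measurable_stein_density, of x] by simp
  show "sets (stein_pred d bs e e2 x) = sets (density (gauss_prod (\<lambda>_. 0) (\<lambda>_. e2)) (\<lambda>y. ennreal (stein_density bs v u x y)))"
    by (simp add: stein_pred_def)
  fix A assume "A \<in> sets (stein_pred d bs e e2 x)"
  then have A: "A \<in> sets Rinf" by (simp add: stein_pred_def)
  then show "emeasure (stein_pred d bs e e2 x) A
    = emeasure (density (gauss_prod (\<lambda>_. 0) (\<lambda>_. e2)) (\<lambda>y. ennreal (stein_density bs v u x y))) A"
    by (simp add: emeasure_stein_pred emeasure_density cong: measurable_cong_sets)
qed

text \<open>This makes the Stein rule one of the competitors in the infimum, so that the ratio of
  risks is at least 1.\<close>

lemma stein_pred_in_pred_rules: "stein_pred d bs e e2 \<in> pred_rules"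
  unfolding pred_rules_def
proof (rule measurable_prob_algebraI)
  show "prob_space (stein_pred d bs e e2 x)" for x by (rule prob_space_stein_pred[OF sets.empty_sets])
  show "stein_pred d bs e e2 \<in> Rinf \<rightarrow>\<^sub>M subprob_algebra Rinf"
  proof (rule measurable_subprob_algebra)
    show "subprob_space (stein_pred d bs e e2 x)" for x
      by (intro prob_space_imp_subprob_space prob_space_stein_pred[OF sets.empty_sets])
    show "sets (stein_pred d bs e e2 x) = sets Rinf" for x by (simp add: stein_pred_def)
    fix A assume A[measurable]: "A \<in> sets Rinf"
    interpret G: prob_space "gauss_prod (\<lambda>_. 0) (\<lambda>_. e2)" by (intro prob_space_gauss_prod e2)
    have m: "(\<lambda>z. stein_density bs v u (fst z) (snd z)) \<in> borel_measurable (Rinf \<Otimes>\<^sub>M gauss_prod (\<lambda>_. 0) (\<lambda>_. e2))"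
      using measurable_stein_density by (simp add: split_beta' cong: measurable_cong_sets sets_pair_measure_cong)
    have "(\<lambda>(x, y). ennreal (stein_density bs v u x y) * indicator A y) \<in> borel_measurable (Rinf \<Otimes>\<^sub>M gauss_prod (\<lambda>_. 0) (\<lambda>_. e2))"
      unfolding split_beta' using m by measurable
    from G.borel_measurable_nn_integral[OF this]
    show "(\<lambda>x. emeasure (stein_pred d bs e e2 x) A) \<in> borel_measurable Rinf"
      by (simp add: emeasure_stein_pred[OF A])
  qed
qed

end

section \<open>The loss dominated by Gaussian polynomials, and its mean\<close>

definition loss_mean :: "real \<Rightarrow> real \<Rightarrow> real \<Rightarrow> real \<Rightarrow> real" where
  "loss_mean v u t x = (ln (2 * pi * (v + u)) - ln (2 * pi * u)) / 2 - (t\<^sup>2 + u) / (2 * u)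
     + ((x - t)\<^sup>2 + u) / (2 * (v + u))"

text \<open>The mean of the squared \<open>pool\<close> over \<open>y\<close>, just as
  \<open>loss_mean\<close> is the mean over \<open>y\<close> of minus the log density, relative to
  centred noise, of the flat-prior prediction.\<close>

definition pool_mean :: "real \<Rightarrow> real \<Rightarrow> real \<Rightarrow> real \<Rightarrow> real" where
  "pool_mean v u t x = (v / (v + u))\<^sup>2 * ((t + u * x / v)\<^sup>2 + u)"

context
  fixes e e2 v u t :: real
  assumes e: "0 < e" and e2: "0 < e2" and v_def: "v = e\<^sup>2" and u_def: "u = e2\<^sup>2"
begin

lemma v0: "0 < v" and u0: "0 < u" and vu0: "0 < v + u"
  using e e2 by (auto simp: v_def u_def add_pos_pos)

lemma loss_mean_y:
  "has_bochner_integral (gauss t e2) (\<lambda>y. ln (vnd u y) - ln (vnd (v + u) (x - y))) (loss_mean v u t x)"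
proof -
  let ?a = "- 1 / (2 * u)" and ?b = "1 / (2 * (v + u))" and ?c = "(ln (2 * pi * (v + u)) - ln (2 * pi * u)) / 2"
  have "has_bochner_integral (gauss t e2)
     (\<lambda>y. ?a * (y - 0)\<^sup>2 + (?b * (y - x)\<^sup>2 + ?c))
     (?a * ((t - 0)\<^sup>2 + e2\<^sup>2) + (?b * ((t - x)\<^sup>2 + e2\<^sup>2) + ?c))"
    by (intro has_bochner_integral_add gauss_centered_square gauss_moments(5) e2)
  also have "(\<lambda>y. ?a * (y - 0)\<^sup>2 + (?b * (y - x)\<^sup>2 + ?c)) = (\<lambda>y. ln (vnd u y) - ln (vnd (v + u) (x - y)))"
    using u0 vu0 by (auto simp: ln_vnd power2_commute[of x] diff_divide_distrib)
  also have "?a * ((t - 0)\<^sup>2 + e2\<^sup>2) + (?b * ((t - x)\<^sup>2 + e2\<^sup>2) + ?c) = loss_mean v u t x"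
    unfolding loss_mean_def u_def[symmetric] by (simp add: power2_commute[of x])
  finally show ?thesis .
qed

text \<open>The first term is the constant risk of the flat prior. The second arises because
  densities are relative to centred noise, and cancels the Cameron--Martin entropy of this
  coordinate.\<close>

lemma loss_mean_x: "has_bochner_integral (gauss t e) (loss_mean v u t) (ln ((v + u) / u) / 2 - t\<^sup>2 / (2 * u))"
proof -
  let ?b = "1 / (2 * (v + u))" and ?c = "(ln (2 * pi * (v + u)) - ln (2 * pi * u)) / 2 - (t\<^sup>2 + u) / (2 * u) + u / (2 * (v + u))"
  have "has_bochner_integral (gauss t e) (\<lambda>x. ?b * (x - t)\<^sup>2 + ?c) (?b * ((t - t)\<^sup>2 + e\<^sup>2) + ?c)"
    by (intro has_bochner_integral_add gauss_centered_square gauss_moments(5) e)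
  also have "(\<lambda>x. ?b * (x - t)\<^sup>2 + ?c) = loss_mean v u t"
    by (auto simp: loss_mean_def add_divide_distrib)
  also have "?b * ((t - t)\<^sup>2 + e\<^sup>2) + ?c = ln ((v + u) / u) / 2 - t\<^sup>2 / (2 * u)"
  proof -
    have "?b * ((t - t)\<^sup>2 + e\<^sup>2) + u / (2 * (v + u)) = 1 / 2"
      using vu0 by (simp add: v_def[symmetric] add_divide_distrib[symmetric])
    moreover have "(t\<^sup>2 + u) / (2 * u) = t\<^sup>2 / (2 * u) + 1 / 2" using u0 by (simp add: add_divide_distrib)
    moreover have "ln ((v + u) / u) = ln (2 * pi * (v + u)) - ln (2 * pi * u)"
      using u0 vu0 by (simp add: ln_two_pi_mult ln_div)
    moreover have "X + Z = 1 / 2 \<Longrightarrow> T = w + 1 / 2 \<Longrightarrow> l = a - b \<Longrightarrow> X + ((a - b) / 2 - T + Z) = l / 2 - w"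
      for X Z T w l a b :: real by simp
    ultimately show ?thesis by blast
  qed
  finally show ?thesis .
qed

lemma pool_mean_y: "has_bochner_integral (gauss t e2) (\<lambda>y. (pool v u x y)\<^sup>2) (pool_mean v u t x)"
  using gauss_centered_square[OF e2, of t "(v / (v + u))\<^sup>2" "- (u * x / v)"]
  unfolding pool_sq[OF v0 u0] pool_mean_def u_def[symmetric] by simp

lemma pool_mean_x: "has_bochner_integral (gauss t e) (pool_mean v u t) (t\<^sup>2 + pooled v u)"
proof -
  let ?r = "(v / (v + u))\<^sup>2"
  have "has_bochner_integral (gauss t e) (\<lambda>x. ?r * (u / v)\<^sup>2 * (x - (- (v * t / u)))\<^sup>2 + ?r * u)
    (?r * (u / v)\<^sup>2 * ((t - (- (v * t / u)))\<^sup>2 + e\<^sup>2) + ?r * u)"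
    by (intro has_bochner_integral_add gauss_centered_square gauss_moments(5) e)
  also have "(\<lambda>x. ?r * (u / v)\<^sup>2 * (x - (- (v * t / u)))\<^sup>2 + ?r * u) = pool_mean v u t"
  proof
    fix x
    have "t + u * x / v = u / v * (x - (- (v * t / u)))" using v0 u0 by (simp add: field_simps)
    then have "(t + u * x / v)\<^sup>2 = (u / v)\<^sup>2 * (x - (- (v * t / u)))\<^sup>2" by (simp add: power_mult_distrib power_divide)
    then show "?r * (u / v)\<^sup>2 * (x - (- (v * t / u)))\<^sup>2 + ?r * u = pool_mean v u t x"
      by (simp only: pool_mean_def) (simp add: algebra_simps)
  qed
  also have "?r * (u / v)\<^sup>2 * ((t - (- (v * t / u)))\<^sup>2 + e\<^sup>2) + ?r * u = t\<^sup>2 + pooled v u"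
    using pooled_variance[OF v0 u0, of t] by (simp only: v_def[symmetric] mult.assoc distrib_left)
  finally show ?thesis .
qed

lemma square_minus_mean:
  "has_bochner_integral (gauss t e) (\<lambda>x. x\<^sup>2 - (t\<^sup>2 + v)) 0"
  "has_bochner_integral (gauss t e) (\<lambda>x. (x\<^sup>2 - (t\<^sup>2 + v))\<^sup>2) (2 * v\<^sup>2 + 4 * t\<^sup>2 * v)"
proof -
  show "has_bochner_integral (gauss t e) (\<lambda>x. x\<^sup>2 - (t\<^sup>2 + v)) 0"
    using gauss_quadratic[OF e, of t 1 0 "- (t\<^sup>2 + v)"] by (simp add: v_def algebra_simps)
  have "e ^ 4 = v\<^sup>2" by (simp add: v_def)
  then show "has_bochner_integral (gauss t e) (\<lambda>x. (x\<^sup>2 - (t\<^sup>2 + v))\<^sup>2) (2 * v\<^sup>2 + 4 * t\<^sup>2 * v)"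
    using gauss_square_variance[OF e, of t] by (simp add: v_def)
qed

end

text \<open>A block of size \<open>b\<close> and energy \<open>R\<close> costs the oracle risk \<open>b * phi v u (R / b)\<close> plus this error.\<close>

definition block_error :: "real \<Rightarrow> real \<Rightarrow> real \<Rightarrow> real \<Rightarrow> real" where
  "block_error v u b R = ln ((v + u) / u) + ln (1 + R / b / v) / 4 + 6 + ln b"

text \<open>Collects the exponents of \<open>stein_mix_upper\<close> and
  \<open>stein_mix_lower\<close> with their quadratic terms at the mean. The additive constant is
  \<open>3 + 5/4 + 1 + 1/2\<close>, from \<open>ln 4\<close>, \<open>b / 2 - c\<close>, the variance
  term and the window, rounded up to 6. The two logarithms split
  \<open>5 / 4 * ln (\<tau> + v) - ln v / 4 - ln t1\<close>.\<close>

lemma block_constants_le: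
  fixes v u b R :: real
  assumes v: "0 < v" and u: "0 < u" and b: "3 \<le> b" and R: "0 \<le> R"
  defines "c \<equiv> b / 2 - 5 / 4" and "m \<equiv> R + b * v" and "t1 \<equiv> R / b + pooled v u"
  shows "(- (b / 2) * ln (2 * pi) - ln v / 4 + ln 4 - c * ln (m / (2 * c)) - m / (2 * (m / (2 * c))) + 1)
     - (- (b / 2) * ln (2 * pi) - (b / 2) * ln (t1 * (1 + 1 / b)) + ln (t1 / b))
     + (R + b * pooled v u) / (2 * t1) + b / 2 * ln ((v + u) / u)
    \<le> b * phi v u (R / b) + block_error v u b R"
proof -
  define \<tau> where "\<tau> = R / b"
  have p: "0 < pooled v u" "pooled v u < v" using pooled_pos[OF v u] pooled_less[OF v u] .
  have \<tau>: "0 \<le> \<tau>" using R b by (simp add: \<tau>_def)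
  have c: "0 < c" "2 * c \<le> b" using b by (auto simp: c_def)
  have m: "m = b * (\<tau> + v)" using b by (simp add: m_def \<tau>_def distrib_left)
  have m0: "0 < m" using m \<tau> v b by simp
  have t1: "t1 = \<tau> + pooled v u" "0 < t1" using \<tau> p by (auto simp: t1_def \<tau>_def)
  have "m / (2 * (m / (2 * c))) = c" using m0 c by simp
  moreover have "(R + b * pooled v u) / (2 * t1) = b / 2"
  proof -
    have "R + b * pooled v u = b * t1" using b by (simp add: t1_def distrib_left)
    then show ?thesis using t1(2) by simp
  qed
  moreover have "ln (\<tau> + v) \<le> ln (m / (2 * c))"
  proof -
    have "(\<tau> + v) * 1 \<le> (\<tau> + v) * (b / (2 * c))" using c \<tau> v by (intro mult_left_mono) auto
    then show ?thesis using \<tau> v by (simp add: m mult.commute)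
  qed
  then have "c * ln (\<tau> + v) \<le> c * ln (m / (2 * c))" using c by (intro mult_left_mono) auto
  moreover have "b / 2 * ln (t1 * (1 + 1 / b)) \<le> b / 2 * ln t1 + 1 / 2"
  proof -
    have "ln (1 + 1 / b) \<le> 1 / b" using b by (intro ln_add_one_self_le_self) auto
    then have "b / 2 * ln (1 + 1 / b) \<le> b / 2 * (1 / b)" using b by (intro mult_left_mono) auto
    moreover have "0 < 1 + 1 / b" using b by (simp add: add_pos_pos)
    then have "ln (t1 * (1 + 1 / b)) = ln t1 + ln (1 + 1 / b)" using t1 by (simp add: ln_mult)
    ultimately show ?thesis using b by (simp add: distrib_left)
  qed
  moreover have "ln (t1 / b) = ln t1 - ln b" using t1 b by (simp add: ln_div)
  moreover have "ln 4 \<le> (3 :: real)" using ln_le_minus_one[of "4 :: real"] by simp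
  moreover have "ln (\<tau> + v) - ln t1 \<le> ln ((v + u) / u)"
  proof -
    have "(\<tau> + v) / t1 \<le> (v + u) / u"
    proof -
      have pu: "pooled v u * (v + u) = v * u" using v u by (simp add: pooled_def)
      have "(\<tau> + v) * u \<le> (v + u) * t1"
        using pu \<tau> v unfolding t1(1) by (simp add: algebra_simps)
      then show ?thesis using t1 u by (simp add: field_simps)
    qed
    then have "ln ((\<tau> + v) / t1) \<le> ln ((v + u) / u)" using \<tau> v t1 u
      by (subst ln_le_cancel_iff) (auto intro!: divide_pos_pos add_nonneg_pos)
    then show ?thesis using \<tau> v t1 by (simp add: ln_div)
  qed
  moreover have "ln (1 + R / b / v) = ln (\<tau> + v) - ln v"
  proof -
    have "1 + R / b / v = (\<tau> + v) / v" using v by (simp add: \<tau>_def add_divide_distrib)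
    then show ?thesis using \<tau> v by (simp add: ln_div)
  qed
  moreover have "b * phi v u (R / b) = b / 2 * ln ((v + u) / u) + b / 2 * (ln t1 - ln (\<tau> + v))"
  proof -
    have "ln ((\<tau> + pooled v u) / (\<tau> + v)) = ln t1 - ln (\<tau> + v)"
      unfolding t1(1)[symmetric] by (rule ln_divide_pos) (use t1 \<tau> v in auto)
    moreover have "b * ((L + X) / 2) = b / 2 * L + b / 2 * X" for L X :: real by (simp add: algebra_simps add_divide_distrib)
    ultimately show ?thesis unfolding phi_def \<tau>_def[symmetric] by presburger
  qed
  moreover have "b / 2 * (ln t1 - ln (\<tau> + v)) = b / 2 * ln t1 - b / 2 * ln (\<tau> + v)"
    by (simp add: right_diff_distrib)
  moreover have "c * ln (\<tau> + v) = b / 2 * ln (\<tau> + v) - 5 / 4 * ln (\<tau> + v)" by (simp add: c_def left_diff_distrib)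
  ultimately show ?thesis unfolding block_error_def c_def by linarith
qed

text \<open>The numerator is the variance of the energy of \<open>x\<close> in a block: replacing
  that energy by its mean costs at most the 1 provided for in
  \<open>block_constants_le\<close>.\<close>

lemma block_variance_le:
  fixes v m R :: real
  assumes v: "0 < v" and R: "0 \<le> R" and b: "0 < b"
  defines "m \<equiv> R + b * v"
  shows "(2 * (b * v\<^sup>2) + 4 * R * v) / (4 * v * m) \<le> 1"
proof -
  have "0 < m" using assms by (simp add: add_nonneg_pos)
  moreover have "2 * (b * v\<^sup>2) + 4 * R * v \<le> 4 * v * m"
    using v b by (simp add: m_def power2_eq_square algebra_simps)
  ultimately show ?thesis using v by simp
qed

text \<open>The log density of the true law relative to the Stein rule is \<open>ln D\<close>, with
  \<open>D\<close> from \<open>cameron_martin\<close>, minus \<open>ln\<close> of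
  \<open>stein_density\<close>. The former contributes the whole energy of \<theta>, of which
  \<open>loss_mean\<close> cancels the first \<open>d\<close> coordinates; the remainder is the tail
  term.\<close>

lemma risk_stein_le:
  fixes e e2 v u :: real and bs :: "nat list"
  assumes e: "0 < e" and e2: "0 < e2" and v_def: "v = e\<^sup>2" and u_def: "u = e2\<^sup>2" and d: "d = sum_list bs"
    and \<theta>: "summable (\<lambda>i. (\<theta> i)\<^sup>2)"
  defines "R \<equiv> \<lambda>j. \<Sum>i\<in>block bs j. (\<theta> i)\<^sup>2"
  shows "risk e e2 \<theta> (stein_pred d bs e e2)
    \<le> ennreal (((\<Sum>i. (\<theta> i)\<^sup>2) - (\<Sum>i<d. (\<theta> i)\<^sup>2)) / (2 * u)
       + (\<Sum>j<length bs. real (bs ! j) * phi v u (R j / real (bs ! j)) + block_error v u (real (bs ! j)) (R j)))"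
proof -
  let ?S = "big_blocks bs"
  let ?P = "gauss_prod \<theta> (\<lambda>_. e)" and ?Q = "gauss_prod \<theta> (\<lambda>_. e2)" and ?G = "gauss_prod (\<lambda>_. 0) (\<lambda>_. e2)"
  have v: "0 < v" and u: "0 < u" using e e2 by (auto simp: v_def u_def)
  have vu: "0 < v + u" and p: "0 < pooled v u" using v u pooled_pos[OF v u] by auto
  interpret P: prob_space ?P by (intro prob_space_gauss_prod e)
  interpret Q: prob_space ?Q by (intro prob_space_gauss_prod e2)
  define b where "b j = real (bs ! j)" for j
  define c where "c j = b j / 2 - 5 / 4" for j
  \<comment> \<open>\<open>m j\<close> is the mean energy of \<open>x\<close> in the block, and
    \<open>t1 j\<close> the mean square of \<open>pool\<close> per coordinate: the points at which
    the mixture bounds are centred. Their dependence on \<theta> is legitimate because they enter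
    the estimate only, not the rule.\<close>
  define m where "m j = R j + b j * v" for j
  define t1 where "t1 j = R j / b j + pooled v u" for j
  define CU where "CU j = - (b j / 2) * ln (2 * pi) - ln v / 4 + ln 4 - c j * ln (m j / (2 * c j))" for j
  define CL where "CL j = - (b j / 2) * ln (2 * pi) - (b j / 2) * ln (t1 j * (1 + 1 / b j)) + ln (t1 j / b j)" for j
  define n where "n j z = (\<Sum>i\<in>block bs j. (z i)\<^sup>2)" for j and z :: rseq
  define Up where "Up j x = CU j - n j x / (2 * (m j / (2 * c j))) + (n j x - m j)\<^sup>2 / (4 * v * m j)" for j x
  define U where "U x y = (\<Sum>i<d. ln (vnd u (y i)) - ln (vnd (v + u) (x i - y i)))
     + (\<Sum>j\<in>?S. Up j x - CL j + (\<Sum>i\<in>block bs j. (pool v u (x i) (y i))\<^sup>2) / (2 * t1 j))" for x y :: rseq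
  define aU where "aU x = (\<Sum>i<d. loss_mean v u (\<theta> i) (x i))
     + (\<Sum>j\<in>?S. Up j x - CL j + (\<Sum>i\<in>block bs j. pool_mean v u (\<theta> i) (x i)) / (2 * t1 j))" for x :: rseq
  define VN where "VN j = (\<Sum>i\<in>block bs j. 2 * v\<^sup>2 + 4 * (\<theta> i)\<^sup>2 * v)" for j
  define tot where "tot = (\<Sum>i<d. ln ((v + u) / u) / 2 - (\<theta> i)\<^sup>2 / (2 * u))
     + (\<Sum>j\<in>?S. (CU j - m j / (2 * (m j / (2 * c j))) + VN j / (4 * v * m j)) - CL j
         + (\<Sum>i\<in>block bs j. (\<theta> i)\<^sup>2 + pooled v u) / (2 * t1 j))"
  let ?K = "(\<Sum>i. (\<theta> i)\<^sup>2) / (2 * u)"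
  have R0: "0 \<le> R j" for j by (simp add: R_def sum_nonneg)
  have b3: "3 \<le> b j" if "j \<in> ?S" for j using that by (auto simp: b_def big_blocks_def)
  have bcard: "real (card (block bs j)) = b j" if "j \<in> ?S" for j using that by (simp add: b_def card_big_block)
  have n_eq: "n j x = (\<Sum>i\<in>block bs j. (x i)\<^sup>2 - ((\<theta> i)\<^sup>2 + v)) + m j" if "j \<in> ?S" for j x
    using bcard[OF that] by (simp add: n_def m_def R_def sum_subtractf sum.distrib)
  have hy: "has_bochner_integral ?Q (U x) (aU x)" for x
    unfolding U_def aU_def
    by (intro has_bochner_integral_add gauss_prod_sum has_bochner_integral_sum has_bochner_integral_divide_zero
          loss_mean_y[OF e e2 v_def u_def] pool_mean_y[OF e e2 v_def u_def] e2)
      (use Q.prob_space in \<open>simp add: has_bochner_integral_iff\<close>)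
  have hn: "has_bochner_integral ?P (n j) (m j)" if j: "j \<in> ?S" for j
  proof -
    have "has_bochner_integral ?P (\<lambda>x. (\<Sum>i\<in>block bs j. (x i)\<^sup>2 - ((\<theta> i)\<^sup>2 + v)) + m j) ((\<Sum>i\<in>block bs j. 0) + m j)"
      by (intro has_bochner_integral_add gauss_prod_sum square_minus_mean[OF e e2 v_def u_def] e)
         (use P.prob_space in \<open>simp add: has_bochner_integral_iff\<close>)
    moreover have "n j = (\<lambda>x. (\<Sum>i\<in>block bs j. (x i)\<^sup>2 - ((\<theta> i)\<^sup>2 + v)) + m j)"
      using n_eq[OF j] by auto
    ultimately show ?thesis by simp
  qed
  have hn2: "has_bochner_integral ?P (\<lambda>x. (n j x - m j)\<^sup>2) (VN j)" if j: "j \<in> ?S" for j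
    unfolding n_eq[OF j] VN_def add_diff_cancel_right'
    by (intro gauss_prod_sum_variance square_minus_mean[OF e e2 v_def u_def] e finite_block)
  have hx: "has_bochner_integral ?P aU tot"
    unfolding aU_def tot_def Up_def
    by (intro has_bochner_integral_add has_bochner_integral_diff gauss_prod_sum has_bochner_integral_sum has_bochner_integral_divide_zero
          loss_mean_x[OF e e2 v_def u_def] pool_mean_x[OF e e2 v_def u_def] hn hn2 e) (use P.prob_space in \<open>simp_all add: has_bochner_integral_iff\<close>)
  have neg_ln: "- ln (stein_density bs v u x y) \<le> U x y" for x y
  proof -
    let ?p = "\<lambda>i. pool v u (x i) (y i)"
    have pos1: "0 < vnd (v + u) (x i - y i) / vnd u (y i)" for i using vu u by (simp add: vnd_pos)
    have pos2: "0 < stein_mix_real (block bs j) (pooled v u) ?p" "0 < stein_mix_real (block bs j) v x" if "j \<in> ?S" for j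
      using that p v by (auto intro: stein_mix_real(2)[OF e e2 v_def u_def d])
    have "ln (stein_density bs v u x y) = (\<Sum>i<d. ln (vnd (v + u) (x i - y i)) - ln (vnd u (y i)))
       + (\<Sum>j\<in>?S. ln (stein_mix_real (block bs j) (pooled v u) ?p) - ln (stein_mix_real (block bs j) v x))"
    proof -
      have "ln (stein_density bs v u x y) = ln (\<Prod>i<d. vnd (v + u) (x i - y i) / vnd u (y i))
        + ln (\<Prod>j\<in>?S. stein_mix_real (block bs j) (pooled v u) ?p / stein_mix_real (block bs j) v x)"
        unfolding stein_density_def d[symmetric]
        by (rule ln_mult_pos) (auto intro!: prod_pos pos1 divide_pos_pos pos2)
      also have "ln (\<Prod>i<d. vnd (v + u) (x i - y i) / vnd u (y i)) = (\<Sum>i<d. ln (vnd (v + u) (x i - y i) / vnd u (y i)))"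
        by (rule ln_prod[OF finite_lessThan less_imp_neq[OF pos1, symmetric]])
      also have "(\<Sum>i<d. ln (vnd (v + u) (x i - y i) / vnd u (y i))) = (\<Sum>i<d. ln (vnd (v + u) (x i - y i)) - ln (vnd u (y i)))"
        using vnd_pos[OF vu] vnd_pos[OF u] by (intro sum.cong refl ln_divide_pos) auto
      also have "ln (\<Prod>j\<in>?S. stein_mix_real (block bs j) (pooled v u) ?p / stein_mix_real (block bs j) v x)
        = (\<Sum>j\<in>?S. ln (stein_mix_real (block bs j) (pooled v u) ?p / stein_mix_real (block bs j) v x))"
        by (rule ln_prod[OF finite_big_blocks less_imp_neq[OF divide_pos_pos[OF pos2], symmetric]])
      also have "\<dots> = (\<Sum>j\<in>?S. ln (stein_mix_real (block bs j) (pooled v u) ?p) - ln (stein_mix_real (block bs j) v x))"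
        by (intro sum.cong refl ln_divide_pos pos2)
      finally show ?thesis .
    qed
    moreover have "ln (stein_mix_real (block bs j) v x) \<le> Up j x" if j: "j \<in> ?S" for j
    proof -
      have "2 * (real (card (block bs j)) / 2 - 5 / 4) * v \<le> m j"
        using R0[of j] v bcard[OF j] by (simp add: m_def algebra_simps)
      from stein_mix_upper[OF finite_block card_big_block_ge[OF j] v this, of x]
      have "stein_mix (block bs j) v x \<le> ennreal (exp (Up j x))"
        unfolding bcard[OF j] Up_def CU_def n_def[symmetric] c_def[symmetric] by (simp add: algebra_simps)
      then have "stein_mix_real (block bs j) v x \<le> exp (Up j x)"
        unfolding stein_mix_real(1)[OF e e2 v_def u_def d j v] by simp
      then show ?thesis using pos2(2)[OF j] by (metis ln_exp ln_le_cancel_iff exp_gt_zero)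
    qed
    moreover have "CL j - (\<Sum>i\<in>block bs j. (?p i)\<^sup>2) / (2 * t1 j) \<le> ln (stein_mix_real (block bs j) (pooled v u) ?p)" if j: "j \<in> ?S" for j
    proof -
      have t1: "pooled v u \<le> t1 j" "0 < t1 j"
        using R0[of j] p b3[OF j] by (auto simp: t1_def add_nonneg_pos)
      from stein_mix_lower[OF finite_block card_big_block_ge[OF j] less_imp_le[OF p] t1, of ?p]
      have "ennreal (exp (CL j - (\<Sum>i\<in>block bs j. (?p i)\<^sup>2) / (2 * t1 j))) \<le> stein_mix (block bs j) (pooled v u) ?p"
        unfolding bcard[OF j] CL_def by (simp add: algebra_simps)
      then have "exp (CL j - (\<Sum>i\<in>block bs j. (?p i)\<^sup>2) / (2 * t1 j)) \<le> stein_mix_real (block bs j) (pooled v u) ?p"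
        unfolding stein_mix_real(1)[OF e e2 v_def u_def d j p] using pos2(1)[OF j] by simp
      then show ?thesis using pos2(1)[OF j] by (metis ln_exp ln_le_cancel_iff exp_gt_zero)
    qed
    ultimately have "(\<Sum>j\<in>?S. ln (stein_mix_real (block bs j) v x) - ln (stein_mix_real (block bs j) (pooled v u) ?p))
      \<le> (\<Sum>j\<in>?S. Up j x - CL j + (\<Sum>i\<in>block bs j. (?p i)\<^sup>2) / (2 * t1 j))"
      by (intro sum_mono) (smt (verit))
    then show ?thesis
      using \<open>ln (stein_density bs v u x y) = _\<close> unfolding U_def by (simp add: sum_subtractf)
  qed
  obtain D where D[measurable]: "D \<in> borel_measurable Rinf" and D0: "\<And>y. 0 \<le> D y"
    and DQ: "?Q = density ?G (\<lambda>y. ennreal (D y))"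
    and ID: "integrable ?Q (\<lambda>y. ln (D y))" and ED: "(\<integral> y. ln (D y) \<partial>?Q) \<le> ?K"
    using cameron_martin[OF e2 \<theta>] unfolding gauss_seq_eq u_def by metis
  have KL: "0 \<le> ?K + aU x \<and> KL_loss ?Q (stein_pred d bs e e2 x) \<le> ennreal (?K + aU x)" for x
  proof -
    let ?h = "stein_density bs v u x"
    have h0: "0 < ?h y" for y by (rule stein_density_pos[OF e e2 v_def u_def d])
    have [measurable]: "?h \<in> borel_measurable Rinf"
      using measurable_compose_Pair1[OF _ measurable_stein_density[OF e e2 v_def u_def d], of x] by simp
    have dens: "stein_pred d bs e e2 x = density ?G (\<lambda>y. ennreal (?h y))"
      by (rule stein_pred_density[OF e e2 v_def u_def d])
    have pr: "prob_space (stein_pred d bs e e2 x)"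
      by (rule prob_space_stein_pred[OF e e2 v_def u_def d sets.empty_sets])
    have Qd: "?Q = density (stein_pred d bs e e2 x) (\<lambda>y. ennreal (D y / ?h y))"
      unfolding dens DQ
      by (subst density_density_eq) (auto intro!: density_cong AE_I2 simp: ennreal_mult'[symmetric] less_imp_le[OF h0] less_imp_neq[OF h0, symmetric])
    have meas: "(\<lambda>y. D y / ?h y) \<in> borel_measurable (stein_pred d bs e e2 x)" unfolding dens by measurable
    have "AE y in ?Q. 0 < D y" unfolding DQ by (rule AE_density_pos) (auto simp: D0)
    then have ae: "AE y in ?Q. ln (D y / ?h y) \<le> ln (D y) + U x y"
      by eventually_elim (use neg_ln[of x] h0 in \<open>auto simp: ln_div less_imp_neq[OF h0, symmetric]\<close>)
    have IU: "integrable ?Q (\<lambda>y. ln (D y) + U x y)" "(\<integral> y. ln (D y) + U x y \<partial>?Q) \<le> ?K + aU x"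
      using ID ED hy[of x] by (auto simp: has_bochner_integral_iff)
    have nn: "0 \<le> D y / ?h y" for y by (intro divide_nonneg_nonneg D0 less_imp_le[OF h0])
    have "0 \<le> (\<integral> y. ln (D y) + U x y \<partial>?Q)"
      "KL_loss ?Q (stein_pred d bs e e2 x) \<le> ennreal (\<integral> y. ln (D y) + U x y \<partial>?Q)"
      by (rule KL_loss_le[OF pr meas nn Qd Q.prob_space_axioms IU(1) ae])+
    with IU(2) show ?thesis by (auto intro: order.trans ennreal_leI)
  qed
  have Ix: "integrable ?P (\<lambda>x. ?K + aU x)" "(\<integral>x. ?K + aU x \<partial>?P) = ?K + tot"
    using hx P.prob_space by (auto simp: has_bochner_integral_iff)
  have "risk e e2 \<theta> (stein_pred d bs e e2) \<le> (\<integral>\<^sup>+ x. ennreal (?K + aU x) \<partial>?P)"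
    unfolding risk_def gauss_seq_eq using KL by (intro nn_integral_mono) auto
  also have "\<dots> = ennreal (?K + tot)"
    using KL Ix by (subst nn_integral_eq_integral) auto
  also have "\<dots> \<le> ennreal (((\<Sum>i. (\<theta> i)\<^sup>2) - (\<Sum>i<d. (\<theta> i)\<^sup>2)) / (2 * u)
       + (\<Sum>j<length bs. b j * phi v u (R j / b j) + block_error v u (b j) (R j)))"
  proof (rule ennreal_leI)
    let ?L = "ln ((v + u) / u)"
    let ?f = "\<lambda>j. (CU j - m j / (2 * (m j / (2 * c j))) + VN j / (4 * v * m j)) - CL j
         + (\<Sum>i\<in>block bs j. (\<theta> i)\<^sup>2 + pooled v u) / (2 * t1 j)"
    have L0: "0 \<le> ?L" using v u by simp
    have f: "b j / 2 * ?L + ?f j \<le> b j * phi v u (R j / b j) + block_error v u (b j) (R j)" if j: "j \<in> ?S" for j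
    proof -
      have "VN j = 2 * (b j * v\<^sup>2) + 4 * R j * v"
        using bcard[OF j] by (simp add: VN_def R_def sum.distrib sum_distrib_left sum_distrib_right)
      then have 1: "VN j / (4 * v * m j) \<le> 1"
        using block_variance_le[OF v R0, of "b j" j] b3[OF j] by (simp add: m_def)
      have 2: "(\<Sum>i\<in>block bs j. (\<theta> i)\<^sup>2 + pooled v u) = R j + b j * pooled v u"
        using bcard[OF j] by (simp add: R_def sum.distrib)
      show ?thesis
        using block_constants_le[OF v u b3[OF j] R0[of j]] 1
        unfolding 2 CU_def CL_def c_def m_def t1_def by linarith
    qed
    \<comment> \<open>Blocks of size at most 2 have the flat prior; their risk is at most
      \<open>ln ((v + u) / u)\<close>, a summand of \<open>block_error\<close>.\<close>
    have g: "b j / 2 * ?L \<le> b j * phi v u (R j / b j) + block_error v u (b j) (R j)" if "j < length bs" "j \<notin> ?S" for j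
    proof -
      have b2: "0 \<le> b j" "b j \<le> 2" using that by (auto simp: big_blocks_def b_def)
      have Rb: "0 \<le> R j / b j" using R0 b2 by simp
      have "b j / 2 * ?L \<le> 1 * ?L" using b2 L0 by (intro mult_right_mono) auto
      moreover have "0 \<le> b j * phi v u (R j / b j)" using b2 Rb by (intro mult_nonneg_nonneg phi_nonneg v u)
      moreover have "0 \<le> ln (1 + R j / b j / v)" using divide_nonneg_nonneg[OF Rb less_imp_le[OF v]] by (intro ln_ge_zero) simp
      \<comment> \<open>For an empty block this is \<open>ln 0 = 0\<close>.\<close>
      moreover have "0 \<le> ln (b j)" by (cases "bs ! j") (auto simp: b_def)
      ultimately show ?thesis by (simp add: block_error_def)
    qed
    have "tot = (\<Sum>i<d. ?L / 2) - (\<Sum>i<d. (\<theta> i)\<^sup>2) / (2 * u) + (\<Sum>j\<in>?S. ?f j)"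
      unfolding tot_def by (simp add: sum_subtractf sum_divide_distrib)
    also have "(\<Sum>i<d. ?L / 2) = (\<Sum>j<length bs. b j / 2 * ?L)"
      unfolding d using sum_blocks[of "\<lambda>_. ?L / 2" bs] by (simp add: card_block b_def)
    also have "(\<Sum>j\<in>?S. ?f j) = (\<Sum>j<length bs. if j \<in> ?S then ?f j else 0)"
      by (subst sum.inter_restrict[symmetric]) (auto simp: big_blocks_def intro!: sum.cong)
    finally have "tot = (\<Sum>j<length bs. b j / 2 * ?L + (if j \<in> ?S then ?f j else 0)) - (\<Sum>i<d. (\<theta> i)\<^sup>2) / (2 * u)"
      by (simp add: sum.distrib)
    moreover have "(\<Sum>j<length bs. b j / 2 * ?L + (if j \<in> ?S then ?f j else 0))
      \<le> (\<Sum>j<length bs. b j * phi v u (R j / b j) + block_error v u (b j) (R j))"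
      using f g by (intro sum_mono) auto
    moreover have "((\<Sum>i. (\<theta> i)\<^sup>2) - (\<Sum>i<d. (\<theta> i)\<^sup>2)) / (2 * u) = ?K - (\<Sum>i<d. (\<theta> i)\<^sup>2) / (2 * u)"
      by (rule diff_divide_distrib)
    ultimately show "?K + tot \<le> ((\<Sum>i. (\<theta> i)\<^sup>2) - (\<Sum>i<d. (\<theta> i)\<^sup>2)) / (2 * u)
       + (\<Sum>j<length bs. b j * phi v u (R j / b j) + block_error v u (b j) (R j))"
      by linarith
  qed
  finally show ?thesis unfolding b_def .
qed

section \<open>Weakly geometric blocks\<close>

lemma wgb_raw_bounds:
  assumes j: "1 \<le> j" and \<rho>: "0 \<le> wgb_rho \<epsilon>"
  shows "real (wgb_raw \<epsilon> j) \<le> real (wgb_b1 \<epsilon>) * (1 + wgb_rho \<epsilon>) ^ (j - 1)"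
    and "real (wgb_b1 \<epsilon>) * (1 + wgb_rho \<epsilon>) ^ (j - 1) - 1 \<le> real (wgb_raw \<epsilon> j)"
    and "wgb_b1 \<epsilon> \<le> wgb_raw \<epsilon> j"
proof -
  let ?x = "real (wgb_b1 \<epsilon>) * (1 + wgb_rho \<epsilon>) ^ (j - 1)"
  have x0: "0 \<le> ?x" using \<rho> by simp
  \<comment> \<open>For \<open>j = 1\<close> the power is 1 and the floor of a natural number is
    that number, so both branches of \<open>wgb_raw\<close> have this form.\<close>
  have raw: "wgb_raw \<epsilon> j = nat \<lfloor>?x\<rfloor>" by (simp add: wgb_raw_def)
  show "real (wgb_raw \<epsilon> j) \<le> ?x" unfolding raw using x0 by simp
  show "?x - 1 \<le> real (wgb_raw \<epsilon> j)" unfolding raw by linarith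
  have "real (wgb_b1 \<epsilon>) * 1 \<le> ?x" using \<rho> by (intro mult_left_mono one_le_power) auto
  then show "wgb_b1 \<epsilon> \<le> wgb_raw \<epsilon> j" unfolding raw by (simp add: le_nat_floor)
qed

definition wgb_sum :: "real \<Rightarrow> nat \<Rightarrow> nat" where
  "wgb_sum \<epsilon> n = (\<Sum>j=1..n. wgb_raw \<epsilon> j)"

lemma wgb_sum_Suc: "wgb_sum \<epsilon> (Suc n) = wgb_sum \<epsilon> n + wgb_raw \<epsilon> (Suc n)"
  by (simp add: wgb_sum_def)

lemma wgb_sum_mono: "m \<le> n \<Longrightarrow> wgb_sum \<epsilon> m \<le> wgb_sum \<epsilon> n"
  unfolding wgb_sum_def by (intro sum_mono2) auto

context
  fixes \<epsilon> L :: real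
  assumes \<epsilon>: "0 < \<epsilon>" "\<epsilon> < 1" and L_def: "L = ln (1 / \<epsilon>)" and L4: "4 \<le> L"
begin

lemma wgb_rho_eq: "wgb_rho \<epsilon> = 1 / L"
  by (simp add: wgb_rho_def L_def)

lemma wgb_rho_bounds: "0 < wgb_rho \<epsilon>" "wgb_rho \<epsilon> \<le> 1"
  using L4 by (auto simp: wgb_rho_eq)

lemma wgb_b1_bounds: "L \<le> real (wgb_b1 \<epsilon>)" "real (wgb_b1 \<epsilon>) \<le> L + 1"
proof -
  have "wgb_b1 \<epsilon> = nat \<lceil>L\<rceil>" by (simp add: wgb_b1_def wgb_rho_eq)
  then show "L \<le> real (wgb_b1 \<epsilon>)" "real (wgb_b1 \<epsilon>) \<le> L + 1" using L4 by linarith+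
qed

lemma wgb_J: "1 \<le> wgb_J \<epsilon>" "wgb_d \<epsilon> \<le> wgb_sum \<epsilon> (wgb_J \<epsilon>)"
  "\<And>m. 1 \<le> m \<Longrightarrow> m < wgb_J \<epsilon> \<Longrightarrow> wgb_sum \<epsilon> m < wgb_d \<epsilon>"
proof -
  let ?P = "\<lambda>m. m \<ge> 1 \<and> wgb_d \<epsilon> \<le> wgb_sum \<epsilon> m"
  have J: "wgb_J \<epsilon> = (LEAST m. ?P m)" by (simp add: wgb_J_def wgb_sum_def)
  \<comment> \<open>Every block has at least one element, so \<open>wgb_d \<epsilon>\<close> blocks
    certainly suffice; the maximum covers the value 0.\<close>
  have "?P (max 1 (wgb_d \<epsilon>))"
  proof -
    have "1 \<le> wgb_raw \<epsilon> j" if "1 \<le> j" for j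
      using wgb_raw_bounds(3)[OF that, of \<epsilon>] wgb_rho_bounds wgb_b1_bounds(1) L4 by linarith
    then have "(\<Sum>j=1..max 1 (wgb_d \<epsilon>). 1) \<le> wgb_sum \<epsilon> (max 1 (wgb_d \<epsilon>))"
      unfolding wgb_sum_def by (intro sum_mono) auto
    then show ?thesis by simp
  qed
  then have "?P (wgb_J \<epsilon>)" unfolding J by (rule LeastI)
  then show "1 \<le> wgb_J \<epsilon>" "wgb_d \<epsilon> \<le> wgb_sum \<epsilon> (wgb_J \<epsilon>)" by auto
  show "wgb_sum \<epsilon> m < wgb_d \<epsilon>" if "1 \<le> m" "m < wgb_J \<epsilon>" for m
    using not_less_Least[of m ?P] that unfolding J by auto
qed

lemma wgb_sum_pred_le: "wgb_sum \<epsilon> (wgb_J \<epsilon> - 1) \<le> wgb_d \<epsilon>"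
proof (cases "wgb_J \<epsilon> = 1")
  case True
  then show ?thesis by (simp add: wgb_sum_def)
next
  case False
  then have "1 \<le> wgb_J \<epsilon> - 1" "wgb_J \<epsilon> - 1 < wgb_J \<epsilon>" using wgb_J(1) by auto
  from wgb_J(3)[OF this] show ?thesis by simp
qed

lemma wgb_blocks_eq:
  "wgb_blocks \<epsilon> = map (wgb_raw \<epsilon>) [1..<wgb_J \<epsilon>] @ [wgb_d \<epsilon> - wgb_sum \<epsilon> (wgb_J \<epsilon> - 1)]"
  by (simp add: wgb_blocks_def wgb_sum_def)

lemma length_wgb_blocks: "length (wgb_blocks \<epsilon>) = wgb_J \<epsilon>"
  using wgb_J(1) by (simp add: wgb_blocks_eq)

lemma sum_take_wgb_blocks:
  assumes "j < wgb_J \<epsilon>" shows "sum_list (take j (wgb_blocks \<epsilon>)) = wgb_sum \<epsilon> j"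
proof -
  have "take j (wgb_blocks \<epsilon>) = map (wgb_raw \<epsilon>) [1..<Suc j]"
    using assms by (simp add: wgb_blocks_eq take_map)
  then show ?thesis
    by (simp add: wgb_sum_def sum_list_distinct_conv_sum_set atLeastLessThanSuc_atLeastAtMost del: upt_Suc)
qed

lemma sum_wgb_blocks: "sum_list (wgb_blocks \<epsilon>) = wgb_d \<epsilon>"
proof -
  have "sum_list (map (wgb_raw \<epsilon>) [1..<wgb_J \<epsilon>]) = wgb_sum \<epsilon> (wgb_J \<epsilon> - 1)"
    using wgb_J(1) by (simp add: wgb_sum_def sum_list_distinct_conv_sum_set atLeastLessThanSuc_atLeastAtMost[symmetric])
  then show ?thesis using wgb_sum_pred_le by (simp add: wgb_blocks_eq)
qed

lemma nth_wgb_blocks: "j < wgb_J \<epsilon> - 1 \<Longrightarrow> wgb_blocks \<epsilon> ! j = wgb_raw \<epsilon> (Suc j)"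
  by (simp add: wgb_blocks_eq nth_append)

lemma nth_wgb_blocks_ge: "j < wgb_J \<epsilon> - 1 \<Longrightarrow> L \<le> real (wgb_blocks \<epsilon> ! j)"
  using wgb_raw_bounds(3)[of "Suc j" \<epsilon>] wgb_rho_bounds wgb_b1_bounds(1) by (simp add: nth_wgb_blocks)

lemma wgb_blocks_le_d: "j < wgb_J \<epsilon> \<Longrightarrow> wgb_blocks \<epsilon> ! j \<le> wgb_d \<epsilon>"
  using member_le_sum_list[of "wgb_blocks \<epsilon> ! j" "wgb_blocks \<epsilon>"] nth_mem[of j "wgb_blocks \<epsilon>"]
  by (simp add: sum_wgb_blocks length_wgb_blocks)

lemma wgb_d_bounds: "1 / \<epsilon>\<^sup>2 - 1 < real (wgb_d \<epsilon>)" "real (wgb_d \<epsilon>) \<le> 1 / \<epsilon>\<^sup>2"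
proof -
  have "0 \<le> 1 / \<epsilon>\<^sup>2" by simp
  then show "1 / \<epsilon>\<^sup>2 - 1 < real (wgb_d \<epsilon>)" "real (wgb_d \<epsilon>) \<le> 1 / \<epsilon>\<^sup>2"
    unfolding wgb_d_def by linarith+
qed

text \<open>The last block but one is still smaller than \<open>1 / \<epsilon>^2\<close>, while the
  sizes grow geometrically with ratio \<open>1 + 1 / L\<close> up to rounding. Logarithms give
  \<open>k / (2 * L) \<le> 1 + 2 * L\<close>.\<close>

lemma wgb_J_le: "real (wgb_J \<epsilon>) \<le> 2 + 2 * L + 4 * L\<^sup>2"
proof (cases "wgb_J \<epsilon> \<le> 2")
  case True
  then have "real (wgb_J \<epsilon>) \<le> 2" by simp
  then show ?thesis using L4 zero_le_power2[of L] by linarith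
next
  case False
  define k where "k = wgb_J \<epsilon> - 2"
  have J: "wgb_J \<epsilon> = Suc (Suc k)" using False by (simp add: k_def)
  have "wgb_raw \<epsilon> (Suc k) \<le> wgb_sum \<epsilon> (Suc k)" by (simp add: wgb_sum_Suc)
  also have "\<dots> < wgb_d \<epsilon>" using J by (intro wgb_J(3)) auto
  finally have "real (wgb_raw \<epsilon> (Suc k)) \<le> 1 / \<epsilon>\<^sup>2" using wgb_d_bounds(2) by linarith
  then have 1: "real (wgb_b1 \<epsilon>) * (1 + wgb_rho \<epsilon>) ^ k \<le> 1 / \<epsilon>\<^sup>2 + 1"
    using wgb_raw_bounds(2)[of "Suc k" \<epsilon>] wgb_rho_bounds by simp
  have b1: "1 \<le> real (wgb_b1 \<epsilon>)" using wgb_b1_bounds(1) L4 by simp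
  have "(1 + wgb_rho \<epsilon>) ^ k \<le> real (wgb_b1 \<epsilon>) * (1 + wgb_rho \<epsilon>) ^ k"
    using b1 wgb_rho_bounds by simp
  also note 1
  also have "1 / \<epsilon>\<^sup>2 + 1 \<le> exp 1 * (1 / \<epsilon>\<^sup>2)"
  proof -
    have "1 \<le> 1 / \<epsilon>\<^sup>2" using \<epsilon> by (simp add: power_le_one)
    moreover have "2 * (1 / \<epsilon>\<^sup>2) \<le> exp 1 * (1 / \<epsilon>\<^sup>2)"
      using exp_ge_add_one_self[of 1] by (intro mult_right_mono) auto
    ultimately show ?thesis by linarith
  qed
  finally have "ln ((1 + wgb_rho \<epsilon>) ^ k) \<le> ln (exp 1 * (1 / \<epsilon>\<^sup>2))"
    using wgb_rho_bounds \<epsilon> by (subst ln_le_cancel_iff) auto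
  also have "\<dots> = 1 + 2 * L"
    using \<epsilon> by (simp add: L_def ln_mult ln_div ln_realpow)
  finally have 2: "real k * ln (1 + wgb_rho \<epsilon>) \<le> 1 + 2 * L"
    using wgb_rho_bounds by (simp add: ln_realpow)
  have "1 / (2 * L) \<le> ln (1 + wgb_rho \<epsilon>)"
  proof -
    have "wgb_rho \<epsilon> - (wgb_rho \<epsilon>)\<^sup>2 \<le> ln (1 + wgb_rho \<epsilon>)"
      using wgb_rho_bounds by (intro ln_one_plus_pos_lower_bound) auto
    moreover have "(wgb_rho \<epsilon>)\<^sup>2 \<le> wgb_rho \<epsilon> / 2"
      using L4 by (simp add: wgb_rho_eq power2_eq_square field_simps)
    ultimately show ?thesis by (simp add: wgb_rho_eq)
  qed
  then have "real k * (1 / (2 * L)) \<le> real k * ln (1 + wgb_rho \<epsilon>)" by (intro mult_left_mono) auto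
  with 2 have "real k * (1 / (2 * L)) \<le> 1 + 2 * L" by simp
  then have "real k \<le> (1 + 2 * L) * (2 * L)" using L4 by (simp add: field_simps)
  then show ?thesis using J by (simp add: power2_eq_square algebra_simps)
qed

context
  fixes K :: nat
  assumes K: "1 \<le> K" and K_small: "(1 + 1 / L) ^ K \<le> 3 / 2" and K_L: "3 * real K * L \<le> 1 / \<epsilon>\<^sup>2 - 1"
begin

lemma wgb_sum_initial: "real (wgb_sum \<epsilon> K) \<le> 3 * real K * L"
proof -
  have "real (wgb_sum \<epsilon> K) = (\<Sum>j=1..K. real (wgb_raw \<epsilon> j))" by (simp add: wgb_sum_def)
  also have "\<dots> \<le> (\<Sum>j=1..K. 3 * L)"
  proof (intro sum_mono)
    fix j assume j: "j \<in> {1..K}"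
    have "real (wgb_raw \<epsilon> j) \<le> real (wgb_b1 \<epsilon>) * (1 + wgb_rho \<epsilon>) ^ (j - 1)"
      using j wgb_rho_bounds by (intro wgb_raw_bounds) auto
    also have "\<dots> \<le> (L + 1) * (1 + wgb_rho \<epsilon>) ^ K"
      using wgb_b1_bounds wgb_rho_bounds j L4 by (intro mult_mono power_increasing) auto
    also have "\<dots> \<le> (L + 1) * (3 / 2)"
      using K_small L4 by (intro mult_left_mono) (auto simp: wgb_rho_eq)
    also have "\<dots> \<le> 3 * L" using L4 by simp
    finally show "real (wgb_raw \<epsilon> j) \<le> 3 * L" .
  qed
  also have "\<dots> = 3 * real K * L" by simp
  finally show ?thesis .
qed

lemma wgb_K_less_J: "K < wgb_J \<epsilon>"
proof (rule ccontr)
  assume "\<not> K < wgb_J \<epsilon>"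
  then have "wgb_d \<epsilon> \<le> wgb_sum \<epsilon> K" using wgb_J(2) wgb_sum_mono[of "wgb_J \<epsilon>" K \<epsilon>] by simp
  then have "real (wgb_d \<epsilon>) \<le> real (wgb_sum \<epsilon> K)" by simp
  then show False using wgb_sum_initial wgb_d_bounds(1) K_L by linarith
qed

text \<open>Over \<open>K\<close> steps the sizes grow by at most 3/2 before rounding, so each of
  the \<open>K\<close> preceding blocks is at least half as large. This is thinness: a block adds at
  most the fraction \<open>2 / K\<close> to all that precedes it.\<close>

lemma wgb_raw_le_sum:
  assumes j: "K < j" shows "real K / 2 * real (wgb_raw \<epsilon> j) \<le> real (wgb_sum \<epsilon> (j - 1))"
proof -
  let ?q = "1 + wgb_rho \<epsilon>" and ?b = "real (wgb_b1 \<epsilon>)"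
  have q: "1 \<le> ?q" using wgb_rho_bounds by simp
  have half: "real (wgb_raw \<epsilon> j) / 2 \<le> real (wgb_raw \<epsilon> k)" if k: "k \<in> {j - K..j - 1}" for k
  proof -
    have k1: "1 \<le> k" "k - 1 \<le> j - 1" "j - 1 \<le> (k - 1) + K" using k j by auto
    have "real (wgb_raw \<epsilon> j) \<le> ?b * ?q ^ (j - 1)"
      using j wgb_rho_bounds by (intro wgb_raw_bounds) auto
    also have "\<dots> \<le> ?b * (?q ^ (k - 1) * (3 / 2))"
    proof (intro mult_left_mono)
      have "?q ^ (j - 1) \<le> ?q ^ ((k - 1) + K)" using q k1 by (intro power_increasing) auto
      also have "\<dots> = ?q ^ (k - 1) * ?q ^ K" by (rule power_add)
      also have "\<dots> \<le> ?q ^ (k - 1) * (3 / 2)"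
        using K_small q by (intro mult_left_mono) (auto simp: wgb_rho_eq)
      finally show "?q ^ (j - 1) \<le> ?q ^ (k - 1) * (3 / 2)" .
    qed simp
    finally have 1: "real (wgb_raw \<epsilon> j) \<le> 3 / 2 * (?b * ?q ^ (k - 1))" by simp
    \<comment> \<open>Rounding down costs at most 1, which is covered because
      \<open>3 / 4 * x \<le> x - 1\<close> for \<open>x \<ge> 4\<close>.\<close>
    have "4 * 1 \<le> ?b * ?q ^ (k - 1)"
      using wgb_b1_bounds(1) L4 q by (intro mult_mono one_le_power) auto
    moreover have "?b * ?q ^ (k - 1) - 1 \<le> real (wgb_raw \<epsilon> k)"
      using k1 wgb_rho_bounds by (intro wgb_raw_bounds) auto
    ultimately show ?thesis using 1 by linarith
  qed
  have "real K / 2 * real (wgb_raw \<epsilon> j) = (\<Sum>k\<in>{j - K..j - 1}. real (wgb_raw \<epsilon> j) / 2)"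
    using j K by simp
  also have "\<dots> \<le> (\<Sum>k\<in>{j - K..j - 1}. real (wgb_raw \<epsilon> k))" by (intro sum_mono half)
  also have "\<dots> \<le> (\<Sum>k\<in>{1..j - 1}. real (wgb_raw \<epsilon> k))"
    using j by (intro sum_mono2) auto
  also have "\<dots> = real (wgb_sum \<epsilon> (j - 1))" by (simp add: wgb_sum_def)
  finally show ?thesis .
qed

lemma sum_take_wgb_growth:
  assumes j: "K \<le> j" "j < wgb_J \<epsilon>"
  shows "real (sum_list (take (Suc j) (wgb_blocks \<epsilon>))) \<le> (1 + 2 / real K) * real (sum_list (take j (wgb_blocks \<epsilon>)))"
proof -
  have le: "sum_list (take (Suc j) (wgb_blocks \<epsilon>)) \<le> wgb_sum \<epsilon> (Suc j)"
  proof (cases "Suc j < wgb_J \<epsilon>")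
    case True
    then show ?thesis by (simp add: sum_take_wgb_blocks)
  next
    case False
    then have "Suc j = wgb_J \<epsilon>" using j by simp
    then show ?thesis using wgb_J(2) sum_wgb_blocks by (simp add: length_wgb_blocks)
  qed
  have "real (wgb_sum \<epsilon> (Suc j)) = real (wgb_sum \<epsilon> j) + real (wgb_raw \<epsilon> (Suc j))"
    by (simp add: wgb_sum_Suc)
  moreover have "real (wgb_raw \<epsilon> (Suc j)) \<le> 2 / real K * real (wgb_sum \<epsilon> j)"
    using wgb_raw_le_sum[of "Suc j"] j K by (simp add: field_simps)
  ultimately have "real (wgb_sum \<epsilon> (Suc j)) \<le> (1 + 2 / real K) * real (wgb_sum \<epsilon> j)"
    by (simp add: distrib_right)
  moreover have "real (sum_list (take (Suc j) (wgb_blocks \<epsilon>))) \<le> real (wgb_sum \<epsilon> (Suc j))"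
    using le by simp
  ultimately show ?thesis unfolding sum_take_wgb_blocks[OF j(2)] by linarith
qed

end

end

section \<open>Asymptotics over the Sobolev ellipsoid\<close>

lemma sobolev_weight_le:
  assumes "\<theta> \<in> sobolev \<alpha> B" "finite I"
  shows "(\<Sum>i\<in>I. real (Suc i) powr (2 * \<alpha>) * (\<theta> i)\<^sup>2) \<le> B"
proof -
  have "(\<Sum>i\<in>I. real (Suc i) powr (2 * \<alpha>) * (\<theta> i)\<^sup>2) \<le> (\<Sum>i. real (Suc i) powr (2 * \<alpha>) * (\<theta> i)\<^sup>2)"
    using assms by (intro sum_le_suminf) (auto simp: sobolev_def)
  then show ?thesis using assms by (simp add: sobolev_def)
qed

lemma sobolev_energy_le:
  assumes \<theta>: "\<theta> \<in> sobolev \<alpha> B" and \<alpha>: "0 < \<alpha>" and I: "finite I" and s: "\<And>i. i \<in> I \<Longrightarrow> s \<le> real (Suc i)" "0 < s"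
  shows "(\<Sum>i\<in>I. (\<theta> i)\<^sup>2) \<le> B * s powr (- 2 * \<alpha>)"
proof -
  have "s powr (2 * \<alpha>) * (\<Sum>i\<in>I. (\<theta> i)\<^sup>2) \<le> (\<Sum>i\<in>I. real (Suc i) powr (2 * \<alpha>) * (\<theta> i)\<^sup>2)"
    unfolding sum_distrib_left using s \<alpha> by (intro sum_mono mult_right_mono powr_mono2) auto
  also have "\<dots> \<le> B" by (rule sobolev_weight_le[OF \<theta> I])
  finally have "s powr (- 2 * \<alpha>) * (s powr (2 * \<alpha>) * (\<Sum>i\<in>I. (\<theta> i)\<^sup>2)) \<le> s powr (- 2 * \<alpha>) * B"
    by (rule mult_left_mono) simp
  moreover have "s powr (- 2 * \<alpha>) * s powr (2 * \<alpha>) = 1" using s by (simp add: powr_add[symmetric])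
  ultimately show ?thesis by (simp only: mult.assoc[symmetric] mult_1) (simp only: mult.commute)
qed

lemma sobolev_tail_le:
  assumes \<theta>: "\<theta> \<in> sobolev \<alpha> B" and \<alpha>: "0 < \<alpha>" and s: "s \<le> real (Suc d)" "0 < s"
  shows "(\<Sum>i. (\<theta> i)\<^sup>2) - (\<Sum>i<d. (\<theta> i)\<^sup>2) \<le> B * s powr (- 2 * \<alpha>)"
proof -
  have sm: "summable (\<lambda>i. (\<theta> i)\<^sup>2)" using \<theta> by (simp add: sobolev_def)
  have "(\<Sum>i. (\<theta> i)\<^sup>2) - (\<Sum>i<d. (\<theta> i)\<^sup>2) = (\<Sum>i. (\<theta> (i + d))\<^sup>2)"
    using suminf_split_initial_segment[OF sm, of d] by simp
  also have "\<dots> \<le> B * s powr (- 2 * \<alpha>)"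
  proof (rule suminf_le_const)
    show "summable (\<lambda>i. (\<theta> (i + d))\<^sup>2)" using sm by (rule summable_ignore_initial_segment)
    fix n
    have "(\<Sum>i<n. (\<theta> (i + d))\<^sup>2) = (\<Sum>i\<in>(\<lambda>i. i + d) ` {..<n}. (\<theta> i)\<^sup>2)"
      by (subst sum.reindex) auto
    also have "\<dots> \<le> B * s powr (- 2 * \<alpha>)"
      using s by (intro sobolev_energy_le[OF \<theta> \<alpha>]) auto
    finally show "(\<Sum>i<n. (\<theta> (i + d))\<^sup>2) \<le> B * s powr (- 2 * \<alpha>)" .
  qed
  finally show ?thesis .
qed

text \<open>Signal and both noise variances scale together, so with all of order
  \<open>\<epsilon>^2\<close> the Bayes risk per coordinate does not depend on \<epsilon>.\<close>

lemma phi_scale_invariant: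
  assumes "0 < s" "0 < v" "0 < u" "0 \<le> \<tau>"
  shows "phi (s * v) (s * u) (s * \<tau>) = phi v u \<tau>"
proof -
  have e: "s * v + s * u = s * (v + u)" by (simp add: distrib_left)
  have p: "pooled (s * v) (s * u) = s * pooled v u"
    unfolding pooled_def e using assms by simp
  have "s * \<tau> + s * pooled v u = s * (\<tau> + pooled v u)" "s * \<tau> + s * v = s * (\<tau> + v)"
    by (simp_all add: distrib_left)
  then show ?thesis unfolding phi_def p e using assms by simp
qed

lemma phi_pos:
  assumes "0 < v" "0 < u" "0 < t" shows "0 < phi v u t"
proof -
  have "0 < t * dphi v u t"
    using assms pooled_pos[of v u] pooled_less[of v u]
    by (auto simp: dphi_eq intro!: mult_pos_pos divide_pos_pos add_pos_pos)
  also have "\<dots> \<le> phi v u t" using assms by (intro dphi_mult_le) auto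
  finally show ?thesis .
qed

text \<open>The prior has variance \<open>B / 2 * \<epsilon>^2\<close> on the first \<open>N\<close>
  coordinates, each of which contributes a constant by scale invariance. The ellipsoid admits this,
  with slack 1/2, as long as \<open>N powr (2 * \<alpha> + 1)\<close> is at most
  \<open>1 / \<epsilon>^2\<close>.\<close>

lemma minimax_growth:
  fixes \<gamma> \<alpha> B \<epsilon> :: real and N :: nat
  assumes \<gamma>: "0 < \<gamma>" and \<alpha>: "0 < \<alpha>" and B: "0 < B" and \<epsilon>: "0 < \<epsilon>"
    and N: "16 \<le> N" "real N powr (2 * \<alpha> + 1) * \<epsilon>\<^sup>2 \<le> 1" and Qh: "Qh \<in> pred_rules"
  shows "ennreal (real N * phi 1 (\<gamma>\<^sup>2) (B / 2) / 4 - 1) \<le> (SUP \<theta>\<in>sobolev \<alpha> B. risk \<epsilon> (\<gamma> * \<epsilon>) \<theta> Qh)"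
proof -
  define c where "c = B / 2"
  define A where "A = (\<Sum>i\<in>{..<N}. phi (\<epsilon>\<^sup>2) ((\<gamma> * \<epsilon>)\<^sup>2) (c * \<epsilon>\<^sup>2))"
  have c: "0 < c" using B by (simp add: c_def)
  have N0: "0 < real N" using N by simp
  have a: "real (Suc i) powr (2 * \<alpha>) * (c * \<epsilon>\<^sup>2) \<le> c / real N" if "i \<in> {..<N}" for i
  proof -
    have "real (Suc i) powr (2 * \<alpha>) * (c * \<epsilon>\<^sup>2) \<le> real N powr (2 * \<alpha>) * (c * \<epsilon>\<^sup>2)"
      using that \<alpha> c by (intro mult_right_mono powr_mono2) auto
    also have "\<dots> = c * (real N powr (2 * \<alpha> + 1) * \<epsilon>\<^sup>2) / real N"
      using N0 by (simp add: powr_add)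
    also have "\<dots> \<le> c * 1 / real N" using N c by (intro divide_right_mono mult_left_mono) auto
    finally show ?thesis by simp
  qed
  have "(\<Sum>i\<in>{..<N}. real (Suc i) powr (2 * \<alpha>) * (c * \<epsilon>\<^sup>2)) \<le> (\<Sum>i\<in>{..<N}. c / real N)"
    by (intro sum_mono a)
  also have "\<dots> = (1 - 1 / 2) * B" using N0 by (simp add: c_def)
  finally have s: "(\<Sum>i\<in>{..<N}. real (Suc i) powr (2 * \<alpha>) * (c * \<epsilon>\<^sup>2)) \<le> (1 - 1 / 2) * B" .
  have ge: "0 < \<gamma> * \<epsilon>" "0 < c * \<epsilon>\<^sup>2" using \<gamma> \<epsilon> c by auto
  have "ennreal (A - (A + 1) * (2 * (c / real N) / ((1 / 2)\<^sup>2 * B)) - 1 / 2 * A - 1 / (4 * (1 / 2)))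
    \<le> (SUP \<theta>\<in>sobolev \<alpha> B. risk \<epsilon> (\<gamma> * \<epsilon>) \<theta> Qh)"
    unfolding A_def
    by (rule minimax_lower_bound[where \<tau> = "\<lambda>_. c * \<epsilon>\<^sup>2"]) (use \<epsilon> ge B s a Qh c in auto)
  moreover have "real N * phi 1 (\<gamma>\<^sup>2) (B / 2) / 4 - 1
    \<le> A - (A + 1) * (2 * (c / real N) / ((1 / 2)\<^sup>2 * B)) - 1 / 2 * A - 1 / (4 * (1 / 2))"
  proof -
    have "phi (\<epsilon>\<^sup>2) ((\<gamma> * \<epsilon>)\<^sup>2) (c * \<epsilon>\<^sup>2) = phi 1 (\<gamma>\<^sup>2) c"
      using phi_scale_invariant[of "\<epsilon>\<^sup>2" 1 "\<gamma>\<^sup>2" c] \<epsilon> \<gamma> c by (simp add: power_mult_distrib mult.commute)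
    then have A: "A = real N * phi 1 (\<gamma>\<^sup>2) (B / 2)" by (simp add: A_def c_def)
    have A0: "0 \<le> A" unfolding A using \<gamma> B by (intro mult_nonneg_nonneg phi_nonneg) auto
    have "2 * (c / real N) / ((1 / 2)\<^sup>2 * B) = 4 / real N" using B by (simp add: c_def power2_eq_square)
    \<comment> \<open>With at least 16 coordinates the ellipsoid penalty takes a quarter of
      \<open>A\<close> and the slack a half, which leaves \<open>A / 4\<close>.\<close>
    also have "\<dots> \<le> 1 / 4" using N by (simp add: field_simps)
    finally have "(A + 1) * (2 * (c / real N) / ((1 / 2)\<^sup>2 * B)) \<le> (A + 1) * (1 / 4)"
      using A0 by (intro mult_left_mono) auto
    then show ?thesis unfolding A[symmetric] by simp
  qed
  ultimately show ?thesis by (meson ennreal_leI order.trans)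
qed

abbreviation (input) wgb_start :: "real \<Rightarrow> nat \<Rightarrow> nat" where
  "wgb_start \<epsilon> j \<equiv> sum_list (take j (wgb_blocks \<epsilon>))"

definition block_energy :: "real \<Rightarrow> rseq \<Rightarrow> nat \<Rightarrow> real" where
  "block_energy \<epsilon> \<theta> j = (\<Sum>i\<in>block (wgb_blocks \<epsilon>) j. (\<theta> i)\<^sup>2)"

text \<open>The first \<open>K\<close> blocks are not thin and the last one may be short; all the others carry the risk.\<close>

definition main_risk :: "real \<Rightarrow> real \<Rightarrow> nat \<Rightarrow> rseq \<Rightarrow> real" where
  "main_risk \<gamma> \<epsilon> K \<theta> = (\<Sum>j\<in>{K..<wgb_J \<epsilon> - 1}. real (wgb_blocks \<epsilon> ! j) *
     phi (\<epsilon>\<^sup>2) ((\<gamma> * \<epsilon>)\<^sup>2) (block_energy \<epsilon> \<theta> j / real (wgb_blocks \<epsilon> ! j)))"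

text \<open>In order: the first \<open>K\<close> blocks at the maximal risk per coordinate; the
  energy bound beyond index \<open>1 / (3 * \<epsilon>^2)\<close>, once for the tail and once for
  the last block; the number of blocks times a uniform bound on \<open>block_error\<close>.\<close>

definition rest_risk :: "real \<Rightarrow> real \<Rightarrow> real \<Rightarrow> real \<Rightarrow> real \<Rightarrow> nat \<Rightarrow> real" where
  "rest_risk \<gamma> \<alpha> B \<epsilon> L K = 3 * real K * L * ln ((1 + \<gamma>\<^sup>2) / \<gamma>\<^sup>2) / 2
   + B * (1 / (3 * \<epsilon>\<^sup>2)) powr (- 2 * \<alpha>) / (\<gamma>\<^sup>2 * \<epsilon>\<^sup>2)
   + (2 + 2 * L + 4 * L\<^sup>2) * (ln ((1 + \<gamma>\<^sup>2) / \<gamma>\<^sup>2) + (ln (1 + B) + 2 * L) / 4 + 6 + 2 * L)"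

text \<open>Shrinking the block averages of \<open>\<theta>\<^sup>2\<close> by this factor brings them back into the ellipsoid.\<close>

definition shrinkage :: "real \<Rightarrow> real \<Rightarrow> nat \<Rightarrow> real" where
  "shrinkage \<alpha> \<eta> K = (1 - \<eta>) / (1 + 2 / real K) powr (2 * \<alpha>)"

context
  fixes \<gamma> \<alpha> B \<epsilon> L \<eta> :: real and K :: nat
  assumes \<gamma>: "0 < \<gamma>" and \<alpha>: "0 < \<alpha>" and B: "0 < B"
    and \<epsilon>: "0 < \<epsilon>" "\<epsilon> < 1" and L_def: "L = ln (1 / \<epsilon>)" and L4: "4 \<le> L"
    and K: "1 \<le> K" and K_small: "(1 + 1 / L) ^ K \<le> 3 / 2" and K_L: "3 * real K * L \<le> 1 / \<epsilon>\<^sup>2 - 1"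
    and \<eta>: "0 < \<eta>" "\<eta> \<le> 1 / 2" and \<eta>L: "2 / (\<eta>\<^sup>2 * L) \<le> \<eta>"
begin


lemmas wgb_facts = \<epsilon> L_def L4
lemmas wgb_K_facts = \<epsilon> L_def L4 K K_small K_L

lemma vu: "0 < \<epsilon>\<^sup>2" "0 < (\<gamma> * \<epsilon>)\<^sup>2" using \<epsilon> \<gamma> by auto

lemma block_energy_nonneg: "0 \<le> block_energy \<epsilon> \<theta> j"
  by (simp add: block_energy_def sum_nonneg)

lemma wgb_block_pos: "j < wgb_J \<epsilon> - 1 \<Longrightarrow> L \<le> real (wgb_blocks \<epsilon> ! j) \<and> 0 < real (wgb_blocks \<epsilon> ! j)"
  using nth_wgb_blocks_ge[OF wgb_facts] L4 by fastforce

lemma shrinkage_bounds: "0 < shrinkage \<alpha> \<eta> K" "shrinkage \<alpha> \<eta> K \<le> 1"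
proof -
  have "1 \<le> (1 + 2 / real K) powr (2 * \<alpha>)" using \<alpha> by (intro ge_one_powr_ge_zero) auto
  then have "0 < (1 + 2 / real K) powr (2 * \<alpha>)" "1 - \<eta> \<le> (1 + 2 / real K) powr (2 * \<alpha>)"
    using \<eta> by linarith+
  then show "0 < shrinkage \<alpha> \<eta> K" "shrinkage \<alpha> \<eta> K \<le> 1"
    using \<eta> unfolding shrinkage_def by (simp_all only: divide_le_eq_1_pos zero_less_divide_iff) auto
qed

text \<open>The right end of a thin block exceeds its left end by at most the factor
  \<open>1 + 2 / K\<close>, which the denominator of \<open>shrinkage\<close> undoes; the numerator
  leaves the slack \<eta>.\<close>

lemma shrunk_weight_le:
  assumes j: "K \<le> j" "j < wgb_J \<epsilon> - 1" and i: "i \<in> block (wgb_blocks \<epsilon>) j"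
  shows "real (Suc i) powr (2 * \<alpha>) * shrinkage \<alpha> \<eta> K \<le> (1 - \<eta>) * real (wgb_start \<epsilon> j) powr (2 * \<alpha>)"
proof -
  have "real (Suc i) \<le> real (wgb_start \<epsilon> (Suc j))" using i by (simp add: block_def)
  also have "\<dots> \<le> (1 + 2 / real K) * real (wgb_start \<epsilon> j)"
    using j by (intro sum_take_wgb_growth[OF wgb_K_facts]) auto
  finally have "real (Suc i) powr (2 * \<alpha>) \<le> ((1 + 2 / real K) * real (wgb_start \<epsilon> j)) powr (2 * \<alpha>)"
    using \<alpha> by (intro powr_mono2) auto
  also have "\<dots> = (1 + 2 / real K) powr (2 * \<alpha>) * real (wgb_start \<epsilon> j) powr (2 * \<alpha>)"
    by (simp only: powr_mult)
  finally have "real (Suc i) powr (2 * \<alpha>) * shrinkage \<alpha> \<eta> K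
    \<le> (1 + 2 / real K) powr (2 * \<alpha>) * real (wgb_start \<epsilon> j) powr (2 * \<alpha>) * shrinkage \<alpha> \<eta> K"
    using shrinkage_bounds by (intro mult_right_mono) auto
  also have "\<dots> = (1 - \<eta>) * real (wgb_start \<epsilon> j) powr (2 * \<alpha>)"
  proof -
    have "0 \<le> 2 / real K" by simp
    then have "1 + 2 / real K \<noteq> 0" by linarith
    then show ?thesis by (simp add: shrinkage_def)
  qed
  finally show ?thesis .
qed

lemma block_weight_energy_le:
  "real (wgb_start \<epsilon> j) powr (2 * \<alpha>) * block_energy \<epsilon> \<theta> j \<le> (\<Sum>i\<in>block (wgb_blocks \<epsilon>) j. real (Suc i) powr (2 * \<alpha>) * (\<theta> i)\<^sup>2)"
  unfolding block_energy_def sum_distrib_left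
  using \<alpha> by (intro sum_mono mult_right_mono powr_mono2) (auto simp: block_def)

text \<open>The prior variances are the shrunk block averages of the squared coordinates. Blocks
  have at least \<open>L\<close> elements, so no weighted variance exceeds \<open>B / L\<close> and
  leaving the ellipsoid costs little; by \<open>phi_scale\<close> the shrinking costs no more than
  its factor.\<close>

lemma wgb_minimax_lower:
  assumes \<theta>: "\<theta> \<in> sobolev \<alpha> B" and Qh: "Qh \<in> pred_rules"
  shows "ennreal (shrinkage \<alpha> \<eta> K * (1 - 2 * \<eta>) * main_risk \<gamma> \<epsilon> K \<theta> - 1 - 1 / (4 * \<eta>))
    \<le> (SUP \<theta>\<in>sobolev \<alpha> B. risk \<epsilon> (\<gamma> * \<epsilon>) \<theta> Qh)"
proof -
  let ?mid = "{K..<wgb_J \<epsilon> - 1}"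
  let ?a = "\<lambda>i. real (Suc i) powr (2 * \<alpha>)"
  define T where "T j = block_energy \<epsilon> \<theta> j / real (wgb_blocks \<epsilon> ! j)" for j
  define \<tau> where "\<tau> i = shrinkage \<alpha> \<eta> K * (\<Sum>j\<in>?mid. if i \<in> block (wgb_blocks \<epsilon>) j then T j else 0)" for i
  define I where "I = (\<Union>j\<in>?mid. block (wgb_blocks \<epsilon>) j)"
  define F where "F = {i \<in> I. 0 < \<tau> i}"
  have T0: "0 \<le> T j" for j by (simp add: T_def block_energy_nonneg)
  have I: "finite I" by (simp add: I_def)
  have FI: "F \<subseteq> I" "finite F" using I by (auto simp: F_def)
  have \<tau>_eq: "\<tau> i = shrinkage \<alpha> \<eta> K * T j" if "j \<in> ?mid" "i \<in> block (wgb_blocks \<epsilon>) j" for i j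
  proof -
    have "i \<in> block (wgb_blocks \<epsilon>) k \<longleftrightarrow> k = j" for k using block_disjoint[of k j "wgb_blocks \<epsilon>"] that by auto
    then show ?thesis using that by (simp add: \<tau>_def sum.delta)
  qed
  have \<tau>0: "0 \<le> \<tau> i" for i
    unfolding \<tau>_def using shrinkage_bounds T0 by (intro mult_nonneg_nonneg sum_nonneg) auto
  have regroup: "(\<Sum>i\<in>I. g i) = (\<Sum>j\<in>?mid. \<Sum>i\<in>block (wgb_blocks \<epsilon>) j. g i)" for g :: "nat \<Rightarrow> real"
    unfolding I_def using block_disjoint by (intro sum.UNION_disjoint) auto
  have to_I: "(\<Sum>i\<in>F. g i) = (\<Sum>i\<in>I. g i)" if "\<And>i. i \<in> I \<Longrightarrow> \<tau> i = 0 \<Longrightarrow> g i = 0" for g :: "nat \<Rightarrow> real"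
    using that \<tau>0 I FI by (intro sum.mono_neutral_left) (auto simp: F_def not_less antisym)
  have bpos: "0 < real (wgb_blocks \<epsilon> ! j)" "L \<le> real (wgb_blocks \<epsilon> ! j)" if "j \<in> ?mid" for j
    using wgb_block_pos[of j] that by auto
  have bcard: "real (card (block (wgb_blocks \<epsilon>) j)) = real (wgb_blocks \<epsilon> ! j)" if "j \<in> ?mid" for j
    using that by (subst card_block) (auto simp: length_wgb_blocks[OF wgb_facts])
  have w: "?a i * \<tau> i \<le> (1 - \<eta>) * (real (wgb_start \<epsilon> j) powr (2 * \<alpha>) * T j)" if "j \<in> ?mid" "i \<in> block (wgb_blocks \<epsilon>) j" for i j
  proof -
    have "?a i * \<tau> i = ?a i * shrinkage \<alpha> \<eta> K * T j" using \<tau>_eq[OF that] by simp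
    also have "\<dots> \<le> (1 - \<eta>) * real (wgb_start \<epsilon> j) powr (2 * \<alpha>) * T j"
      using that T0 by (intro mult_right_mono shrunk_weight_le) auto
    finally show ?thesis by simp
  qed
  have energy: "(\<Sum>j\<in>?mid. real (wgb_start \<epsilon> j) powr (2 * \<alpha>) * block_energy \<epsilon> \<theta> j) \<le> B"
  proof -
    have "(\<Sum>j\<in>?mid. real (wgb_start \<epsilon> j) powr (2 * \<alpha>) * block_energy \<epsilon> \<theta> j) \<le> (\<Sum>i\<in>I. ?a i * (\<theta> i)\<^sup>2)"
      unfolding regroup by (intro sum_mono block_weight_energy_le)
    also have "\<dots> \<le> B" by (rule sobolev_weight_le[OF \<theta> I])
    finally show ?thesis .
  qed
  have sum: "(\<Sum>i\<in>F. ?a i * \<tau> i) \<le> (1 - \<eta>) * B"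
  proof -
    have "(\<Sum>i\<in>F. ?a i * \<tau> i) = (\<Sum>j\<in>?mid. \<Sum>i\<in>block (wgb_blocks \<epsilon>) j. ?a i * \<tau> i)"
      unfolding regroup[symmetric] by (intro to_I) auto
    also have "\<dots> \<le> (\<Sum>j\<in>?mid. \<Sum>i\<in>block (wgb_blocks \<epsilon>) j. (1 - \<eta>) * (real (wgb_start \<epsilon> j) powr (2 * \<alpha>) * T j))"
      by (intro sum_mono w)
    also have "\<dots> = (\<Sum>j\<in>?mid. (1 - \<eta>) * (real (wgb_start \<epsilon> j) powr (2 * \<alpha>) * block_energy \<epsilon> \<theta> j))"
      using bpos(1) by (intro sum.cong) (auto simp: T_def bcard)
    also have "\<dots> = (1 - \<eta>) * (\<Sum>j\<in>?mid. real (wgb_start \<epsilon> j) powr (2 * \<alpha>) * block_energy \<epsilon> \<theta> j)"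
      by (simp add: sum_distrib_left)
    also have "\<dots> \<le> (1 - \<eta>) * B" using energy \<eta> by (intro mult_left_mono) auto
    finally show ?thesis .
  qed
  have \<mu>: "?a i * \<tau> i \<le> B / L" if "i \<in> F" for i
  proof -
    have "i \<in> I" using that FI by blast
    then obtain j where j: "j \<in> ?mid" "i \<in> block (wgb_blocks \<epsilon>) j" unfolding I_def by blast
    have "?a i * \<tau> i \<le> (1 - \<eta>) * (real (wgb_start \<epsilon> j) powr (2 * \<alpha>) * T j)" by (rule w[OF j])
    also have "\<dots> \<le> 1 * (real (wgb_start \<epsilon> j) powr (2 * \<alpha>) * T j)"
      using \<eta> T0 by (intro mult_right_mono mult_nonneg_nonneg) auto
    also have "1 * (real (wgb_start \<epsilon> j) powr (2 * \<alpha>) * T j) = (real (wgb_start \<epsilon> j) powr (2 * \<alpha>) * block_energy \<epsilon> \<theta> j) / real (wgb_blocks \<epsilon> ! j)"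
      by (simp add: T_def)
    also have "\<dots> \<le> B / L"
    proof (rule frac_le)
      have "real (wgb_start \<epsilon> j) powr (2 * \<alpha>) * block_energy \<epsilon> \<theta> j \<le> (\<Sum>i\<in>block (wgb_blocks \<epsilon>) j. ?a i * (\<theta> i)\<^sup>2)"
        by (rule block_weight_energy_le)
      also have "\<dots> \<le> B" by (rule sobolev_weight_le[OF \<theta> finite_block])
      finally show "real (wgb_start \<epsilon> j) powr (2 * \<alpha>) * block_energy \<epsilon> \<theta> j \<le> B" .
    qed (use B L4 bpos[OF j(1)] in auto)
    finally show ?thesis .
  qed
  define A where "A = (\<Sum>i\<in>F. phi (\<epsilon>\<^sup>2) ((\<gamma> * \<epsilon>)\<^sup>2) (\<tau> i))"
  have A: "shrinkage \<alpha> \<eta> K * main_risk \<gamma> \<epsilon> K \<theta> \<le> A"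
  proof -
    have "A = (\<Sum>j\<in>?mid. \<Sum>i\<in>block (wgb_blocks \<epsilon>) j. phi (\<epsilon>\<^sup>2) ((\<gamma> * \<epsilon>)\<^sup>2) (\<tau> i))"
      unfolding A_def regroup[symmetric] by (intro to_I) (simp add: phi_0[OF vu])
    also have "\<dots> = (\<Sum>j\<in>?mid. real (wgb_blocks \<epsilon> ! j) * phi (\<epsilon>\<^sup>2) ((\<gamma> * \<epsilon>)\<^sup>2) (shrinkage \<alpha> \<eta> K * T j))"
      using \<tau>_eq by (intro sum.cong) (auto simp: bcard)
    also have "\<dots> \<ge> (\<Sum>j\<in>?mid. real (wgb_blocks \<epsilon> ! j) * (shrinkage \<alpha> \<eta> K * phi (\<epsilon>\<^sup>2) ((\<gamma> * \<epsilon>)\<^sup>2) (T j)))"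
      using T0 shrinkage_bounds by (intro sum_mono mult_left_mono phi_scale vu) auto
    finally show ?thesis by (simp add: main_risk_def T_def sum_distrib_left mult.left_commute)
  qed
  have A0: "0 \<le> A" unfolding A_def using \<tau>0 by (intro sum_nonneg phi_nonneg vu)
  have "ennreal (A - (A + 1) * (2 * (B / L) / (\<eta>\<^sup>2 * B)) - \<eta> * A - 1 / (4 * \<eta>))
    \<le> (SUP \<theta>\<in>sobolev \<alpha> B. risk \<epsilon> (\<gamma> * \<epsilon>) \<theta> Qh)"
    unfolding A_def
    by (rule minimax_lower_bound[OF _ _ B \<eta>(1) FI(2) _ sum \<mu> _ Qh])
       (use \<epsilon> \<gamma> B L4 in \<open>auto simp: F_def\<close>)
  moreover have "shrinkage \<alpha> \<eta> K * (1 - 2 * \<eta>) * main_risk \<gamma> \<epsilon> K \<theta> - 1 - 1 / (4 * \<eta>)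
    \<le> A - (A + 1) * (2 * (B / L) / (\<eta>\<^sup>2 * B)) - \<eta> * A - 1 / (4 * \<eta>)"
  proof -
    have "2 * (B / L) / (\<eta>\<^sup>2 * B) \<le> \<eta>" using \<eta>L B by (simp add: mult.commute)
    then have "(A + 1) * (2 * (B / L) / (\<eta>\<^sup>2 * B)) \<le> (A + 1) * \<eta>" using A0 by (intro mult_left_mono) auto
    moreover have "(1 - 2 * \<eta>) * (shrinkage \<alpha> \<eta> K * main_risk \<gamma> \<epsilon> K \<theta>) \<le> (1 - 2 * \<eta>) * A"
      using A \<eta> by (intro mult_left_mono) auto
    ultimately show ?thesis using \<eta> by (simp add: algebra_simps)
  qed
  ultimately show ?thesis by (meson ennreal_leI order.trans)
qed

text \<open>The initial blocks are few and have bounded risk per coordinate; the last block lies so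
  far out that the linear bound on \<open>phi\<close> suffices. The middle blocks keep their oracle
  risk, the expression that also occurs in \<open>wgb_minimax_lower\<close>.\<close>

lemma wgb_risk_upper:
  assumes \<theta>: "\<theta> \<in> sobolev \<alpha> B"
  shows "risk \<epsilon> (\<gamma> * \<epsilon>) \<theta> (stein_pred (wgb_d \<epsilon>) (wgb_blocks \<epsilon>) \<epsilon> (\<gamma> * \<epsilon>)) \<le> ennreal (main_risk \<gamma> \<epsilon> K \<theta> + rest_risk \<gamma> \<alpha> B \<epsilon> L K)"
proof -
  let ?J = "wgb_J \<epsilon>"
  let ?\<Lambda> = "ln ((1 + \<gamma>\<^sup>2) / \<gamma>\<^sup>2)"
  define f where "f j = real (wgb_blocks \<epsilon> ! j) * phi (\<epsilon>\<^sup>2) ((\<gamma> * \<epsilon>)\<^sup>2) (block_energy \<epsilon> \<theta> j / real (wgb_blocks \<epsilon> ! j))" for j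
  define g where "g j = block_error (\<epsilon>\<^sup>2) ((\<gamma> * \<epsilon>)\<^sup>2) (real (wgb_blocks \<epsilon> ! j)) (block_energy \<epsilon> \<theta> j)" for j
  have \<Lambda>: "ln ((\<epsilon>\<^sup>2 + (\<gamma> * \<epsilon>)\<^sup>2) / (\<gamma> * \<epsilon>)\<^sup>2) = ?\<Lambda>"
  proof -
    have "(\<epsilon>\<^sup>2 + (\<gamma> * \<epsilon>)\<^sup>2) / (\<gamma> * \<epsilon>)\<^sup>2 = (1 + \<gamma>\<^sup>2) / \<gamma>\<^sup>2" using \<epsilon> \<gamma> by (simp add: power_mult_distrib field_simps)
    then show ?thesis by simp
  qed
  have \<Lambda>0: "0 \<le> ?\<Lambda>" using \<gamma> by simp
  have KJ: "K < ?J" by (rule wgb_K_less_J[OF wgb_K_facts])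
  have len: "length (wgb_blocks \<epsilon>) = ?J" by (rule length_wgb_blocks[OF wgb_facts])
  have dsum: "wgb_d \<epsilon> = sum_list (wgb_blocks \<epsilon>)" by (rule sum_wgb_blocks[OF wgb_facts, symmetric])
  have T0: "0 \<le> block_energy \<epsilon> \<theta> j / real (wgb_blocks \<epsilon> ! j)" for j by (simp add: block_energy_nonneg)
  have eB: "block_energy \<epsilon> \<theta> j \<le> B" for j
    using sobolev_energy_le[OF \<theta> \<alpha> finite_block, of "wgb_blocks \<epsilon>" j 1] by (simp add: block_energy_def)
  \<comment> \<open>As \<open>wgb_d \<epsilon> + 1\<close> exceeds \<open>1 / \<epsilon>^2\<close>
    and the last block starts no earlier than a third of the way, every coordinate in or beyond it
    has 1-based index at least \<open>?s\<close>.\<close>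
  let ?s = "1 / (3 * \<epsilon>\<^sup>2)"
  let ?t = "B * ?s powr (- 2 * \<alpha>) / (2 * (\<gamma> * \<epsilon>)\<^sup>2)"
  have d3: "3 * ?s \<le> real (Suc (wgb_d \<epsilon>))"
    using wgb_d_bounds(1)[OF wgb_facts] \<epsilon> by simp
  have "0 \<le> ?s" by simp
  then have "?s \<le> real (Suc (wgb_d \<epsilon>))" using d3 by linarith
  then have tail: "((\<Sum>i. (\<theta> i)\<^sup>2) - (\<Sum>i<wgb_d \<epsilon>. (\<theta> i)\<^sup>2)) / (2 * (\<gamma> * \<epsilon>)\<^sup>2) \<le> ?t"
    using \<epsilon> vu by (intro divide_right_mono sobolev_tail_le[OF \<theta> \<alpha>]) auto
  have last: "f (?J - 1) \<le> ?t"
  proof -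
    have "real (wgb_start \<epsilon> (Suc (?J - 1))) \<le> (1 + 2 / real K) * real (wgb_start \<epsilon> (?J - 1))"
      using KJ by (intro sum_take_wgb_growth[OF wgb_K_facts]) auto
    also have "\<dots> \<le> 3 * real (wgb_start \<epsilon> (?J - 1))" using K by (intro mult_right_mono) (auto simp: field_simps)
    finally have "real (wgb_d \<epsilon>) \<le> 3 * real (wgb_start \<epsilon> (?J - 1))" using KJ len dsum by simp
    then have s: "?s \<le> real (Suc i)" if "i \<in> block (wgb_blocks \<epsilon>) (?J - 1)" for i
      using d3 that by (simp add: block_def)
    have "f (?J - 1) \<le> real (wgb_blocks \<epsilon> ! (?J - 1)) * (block_energy \<epsilon> \<theta> (?J - 1) / real (wgb_blocks \<epsilon> ! (?J - 1)) / (2 * (\<gamma> * \<epsilon>)\<^sup>2))"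
      unfolding f_def by (intro mult_left_mono phi_le_linear vu T0) auto
    also have "\<dots> \<le> block_energy \<epsilon> \<theta> (?J - 1) / (2 * (\<gamma> * \<epsilon>)\<^sup>2)"
      using block_energy_nonneg[of \<theta> "?J - 1"] vu by (cases "wgb_blocks \<epsilon> ! (?J - 1) = 0") auto
    also have "\<dots> \<le> ?t"
      unfolding block_energy_def using s \<epsilon> vu
      by (intro divide_right_mono sobolev_energy_le[OF \<theta> \<alpha>]) auto
    finally show ?thesis .
  qed
  have initial: "(\<Sum>j<K. f j) \<le> 3 * real K * L * ?\<Lambda> / 2"
  proof -
    have "(\<Sum>j<K. f j) \<le> (\<Sum>j<K. real (wgb_blocks \<epsilon> ! j) * (?\<Lambda> / 2))"
      unfolding f_def using phi_le_const[OF vu T0] unfolding \<Lambda> by (intro sum_mono mult_left_mono) auto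
    also have "\<dots> = real (\<Sum>j<K. wgb_blocks \<epsilon> ! j) * (?\<Lambda> / 2)" by (simp add: sum_distrib_right sum_divide_distrib)
    also have "(\<Sum>j<K. wgb_blocks \<epsilon> ! j) = wgb_start \<epsilon> K"
      using KJ unfolding len[symmetric] by (simp only: sum_list_sum_nth length_take atLeast0LessThan) simp
    also have "real (wgb_start \<epsilon> K) * (?\<Lambda> / 2) \<le> 3 * real K * L * (?\<Lambda> / 2)"
      unfolding sum_take_wgb_blocks[OF wgb_facts KJ]
      using \<Lambda>0 by (intro mult_right_mono wgb_sum_initial[OF wgb_K_facts]) auto
    finally show ?thesis by simp
  qed
  have g: "g j \<le> ?\<Lambda> + (ln (1 + B) + 2 * L) / 4 + 6 + 2 * L" if j: "j < ?J" for j
  proof -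
    have l2: "ln (1 / \<epsilon>\<^sup>2) = 2 * L" using \<epsilon> by (simp add: L_def ln_div ln_realpow)
    have "ln (real (wgb_blocks \<epsilon> ! j)) \<le> 2 * L"
    proof (cases "wgb_blocks \<epsilon> ! j = 0")
      case False
      have "real (wgb_blocks \<epsilon> ! j) \<le> real (wgb_d \<epsilon>)" using wgb_blocks_le_d[OF wgb_facts j] by simp
      then have "real (wgb_blocks \<epsilon> ! j) \<le> 1 / \<epsilon>\<^sup>2" "0 < real (wgb_blocks \<epsilon> ! j)" "0 < 1 / \<epsilon>\<^sup>2"
        using wgb_d_bounds(2)[OF wgb_facts] False \<epsilon> by auto
      then have "ln (real (wgb_blocks \<epsilon> ! j)) \<le> ln (1 / \<epsilon>\<^sup>2)" by simp
      then show ?thesis using l2 by simp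
    qed (use L4 in simp)
    moreover have "ln (1 + block_energy \<epsilon> \<theta> j / real (wgb_blocks \<epsilon> ! j) / \<epsilon>\<^sup>2) \<le> ln (1 + B) + 2 * L"
    proof -
      have "block_energy \<epsilon> \<theta> j / real (wgb_blocks \<epsilon> ! j) \<le> B"
      proof (cases "wgb_blocks \<epsilon> ! j = 0")
        case False
        then have "block_energy \<epsilon> \<theta> j / real (wgb_blocks \<epsilon> ! j) \<le> block_energy \<epsilon> \<theta> j / 1"
          using block_energy_nonneg by (intro divide_left_mono) auto
        then show ?thesis using eB[of j] by simp
      qed (use B in simp)
      then have "block_energy \<epsilon> \<theta> j / real (wgb_blocks \<epsilon> ! j) / \<epsilon>\<^sup>2 \<le> B / \<epsilon>\<^sup>2" using vu by (intro divide_right_mono) auto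
      moreover have "1 \<le> 1 / \<epsilon>\<^sup>2" using \<epsilon> by (simp add: power_le_one)
      moreover have "0 \<le> block_energy \<epsilon> \<theta> j / real (wgb_blocks \<epsilon> ! j) / \<epsilon>\<^sup>2" by (intro divide_nonneg_nonneg[OF T0] less_imp_le vu)
      moreover have "(1 + B) * (1 / \<epsilon>\<^sup>2) = 1 / \<epsilon>\<^sup>2 + B / \<epsilon>\<^sup>2" by (simp add: add_divide_distrib)
      ultimately have "1 + block_energy \<epsilon> \<theta> j / real (wgb_blocks \<epsilon> ! j) / \<epsilon>\<^sup>2 \<le> (1 + B) * (1 / \<epsilon>\<^sup>2)"
        "0 < 1 + block_energy \<epsilon> \<theta> j / real (wgb_blocks \<epsilon> ! j) / \<epsilon>\<^sup>2" by linarith+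
      then have "ln (1 + block_energy \<epsilon> \<theta> j / real (wgb_blocks \<epsilon> ! j) / \<epsilon>\<^sup>2) \<le> ln ((1 + B) * (1 / \<epsilon>\<^sup>2))"
        by (subst ln_le_cancel_iff) linarith+
      also have "\<dots> = ln (1 + B) + 2 * L" unfolding l2[symmetric] using B \<epsilon> by (intro ln_mult_pos) auto
      finally show ?thesis .
    qed
    ultimately show ?thesis unfolding g_def block_error_def \<Lambda>
      by (intro add_mono divide_right_mono order.refl) simp_all
  qed
  have "risk \<epsilon> (\<gamma> * \<epsilon>) \<theta> (stein_pred (wgb_d \<epsilon>) (wgb_blocks \<epsilon>) \<epsilon> (\<gamma> * \<epsilon>))
    \<le> ennreal (((\<Sum>i. (\<theta> i)\<^sup>2) - (\<Sum>i<wgb_d \<epsilon>. (\<theta> i)\<^sup>2)) / (2 * (\<gamma> * \<epsilon>)\<^sup>2) + (\<Sum>j<?J. f j + g j))"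
    unfolding f_def g_def block_energy_def len[symmetric]
    by (rule risk_stein_le[OF _ _ refl refl dsum]) (use \<epsilon> \<gamma> \<theta> in \<open>simp_all add: sobolev_def\<close>)
  also have "\<dots> \<le> ennreal (main_risk \<gamma> \<epsilon> K \<theta> + rest_risk \<gamma> \<alpha> B \<epsilon> L K)"
  proof (rule ennreal_leI)
    have "(\<Sum>j<?J. f j) = (\<Sum>j<K. f j) + main_risk \<gamma> \<epsilon> K \<theta> + f (?J - 1)"
    proof -
      have "{..<?J} = insert (?J - 1) ({..<K} \<union> {K..<?J - 1})" using KJ by auto
      then have "(\<Sum>j<?J. f j) = (\<Sum>j\<in>insert (?J - 1) ({..<K} \<union> {K..<?J - 1}). f j)" by (rule arg_cong)
      also have "\<dots> = f (?J - 1) + (\<Sum>j\<in>{..<K} \<union> {K..<?J - 1}. f j)"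
        by (rule sum.insert) (use KJ in auto)
      also have "(\<Sum>j\<in>{..<K} \<union> {K..<?J - 1}. f j) = (\<Sum>j<K. f j) + (\<Sum>j\<in>{K..<?J - 1}. f j)"
        by (rule sum.union_disjoint) auto
      finally show ?thesis unfolding main_risk_def f_def by linarith
    qed
    moreover have "(\<Sum>j<?J. g j) \<le> (2 + 2 * L + 4 * L\<^sup>2) * (?\<Lambda> + (ln (1 + B) + 2 * L) / 4 + 6 + 2 * L)"
    proof -
      have "(\<Sum>j<?J. g j) \<le> (\<Sum>j<?J. ?\<Lambda> + (ln (1 + B) + 2 * L) / 4 + 6 + 2 * L)" using g by (intro sum_mono) auto
      also have "\<dots> = real ?J * (?\<Lambda> + (ln (1 + B) + 2 * L) / 4 + 6 + 2 * L)" by simp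
      also have "\<dots> \<le> (2 + 2 * L + 4 * L\<^sup>2) * (?\<Lambda> + (ln (1 + B) + 2 * L) / 4 + 6 + 2 * L)"
        using wgb_J_le[OF wgb_facts] \<Lambda>0 L4 B by (intro mult_right_mono add_nonneg_nonneg divide_nonneg_nonneg) auto
      finally show ?thesis .
    qed
    moreover have "B * ?s powr (- 2 * \<alpha>) / (\<gamma>\<^sup>2 * \<epsilon>\<^sup>2) = ?t + ?t"
      by (simp add: power_mult_distrib)
    ultimately show "((\<Sum>i. (\<theta> i)\<^sup>2) - (\<Sum>i<wgb_d \<epsilon>. (\<theta> i)\<^sup>2)) / (2 * (\<gamma> * \<epsilon>)\<^sup>2) + (\<Sum>j<?J. f j + g j) \<le> main_risk \<gamma> \<epsilon> K \<theta> + rest_risk \<gamma> \<alpha> B \<epsilon> L K"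
      using tail last initial unfolding rest_risk_def sum.distrib by linarith
  qed
  finally show ?thesis .
qed

end

lemma rest_risk_nonneg:
  assumes "0 < \<gamma>" "0 < B" "0 < L" shows "0 \<le> rest_risk \<gamma> \<alpha> B \<epsilon> L K"
  unfolding rest_risk_def using assms
  by (intro add_nonneg_nonneg mult_nonneg_nonneg divide_nonneg_nonneg) auto

text \<open>For every \<theta> the minimax risk \<open>r\<close> is at least
  \<open>k * main_risk - C\<close>, while the Stein risk is at most
  \<open>main_risk + rest_risk\<close>. Eliminating \<open>main_risk\<close> bounds the Stein risk
  by \<open>r / k\<close> plus errors, and \<open>m \<le> r\<close> makes these errors
  relative.\<close>

lemma ratio_bounds:
  fixes \<gamma> \<alpha> B \<epsilon> L \<eta> m :: real and K :: nat
  assumes \<gamma>: "0 < \<gamma>" and \<alpha>: "0 < \<alpha>" and B: "0 < B"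
    and \<epsilon>: "0 < \<epsilon>" "\<epsilon> < 1" and L_def: "L = ln (1 / \<epsilon>)" and L4: "4 \<le> L"
    and K: "1 \<le> K" and K_small: "(1 + 1 / L) ^ K \<le> 3 / 2" and K_L: "3 * real K * L \<le> 1 / \<epsilon>\<^sup>2 - 1"
    and \<eta>: "0 < \<eta>" "\<eta> < 1 / 2" and \<eta>L: "2 / (\<eta>\<^sup>2 * L) \<le> \<eta>"
    and m: "0 < m" "\<And>Qh. Qh \<in> pred_rules \<Longrightarrow> ennreal m \<le> (SUP \<theta>\<in>sobolev \<alpha> B. risk \<epsilon> (\<gamma> * \<epsilon>) \<theta> Qh)"
  defines "k \<equiv> shrinkage \<alpha> \<eta> K * (1 - 2 * \<eta>)"
  defines "ratio \<equiv> (SUP \<theta>\<in>sobolev \<alpha> B. risk \<epsilon> (\<gamma> * \<epsilon>) \<theta> (stein_pred (wgb_d \<epsilon>) (wgb_blocks \<epsilon>) \<epsilon> (\<gamma> * \<epsilon>)))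
           / (INF Qh\<in>pred_rules. SUP \<theta>\<in>sobolev \<alpha> B. risk \<epsilon> (\<gamma> * \<epsilon>) \<theta> Qh)"
  shows "1 \<le> ratio" and "ratio \<le> ennreal (1 / k + ((1 + 1 / (4 * \<eta>)) / k + rest_risk \<gamma> \<alpha> B \<epsilon> L K) / m)"
proof -
  let ?main = "main_risk \<gamma> \<epsilon> K"
  let ?rest = "rest_risk \<gamma> \<alpha> B \<epsilon> L K"
  let ?C = "1 + 1 / (4 * \<eta>)"
  let ?st = "stein_pred (wgb_d \<epsilon>) (wgb_blocks \<epsilon>) \<epsilon> (\<gamma> * \<epsilon>)"
  define X where "X = (SUP \<theta>\<in>sobolev \<alpha> B. risk \<epsilon> (\<gamma> * \<epsilon>) \<theta> ?st)"
  define M where "M = (INF Qh\<in>pred_rules. SUP \<theta>\<in>sobolev \<alpha> B. risk \<epsilon> (\<gamma> * \<epsilon>) \<theta> Qh)"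
  have ratio: "ratio = X / M" by (simp add: ratio_def X_def M_def)
  have \<eta>': "\<eta> \<le> 1 / 2" using \<eta> by simp
  note facts = \<gamma> \<alpha> B \<epsilon> L_def L4 K K_small K_L \<eta>(1) \<eta>' \<eta>L
  have upper: "risk \<epsilon> (\<gamma> * \<epsilon>) \<theta> ?st \<le> ennreal (?main \<theta> + ?rest)" if "\<theta> \<in> sobolev \<alpha> B" for \<theta>
    by (rule wgb_risk_upper[OF facts that])
  have lower: "ennreal (k * ?main \<theta> - ?C) \<le> M" if "\<theta> \<in> sobolev \<alpha> B" for \<theta>
    unfolding M_def
  proof (rule INF_greatest)
    fix Qh assume "Qh \<in> pred_rules"
    from wgb_minimax_lower[OF facts that this]
    show "ennreal (k * ?main \<theta> - ?C) \<le> (SUP \<theta>\<in>sobolev \<alpha> B. risk \<epsilon> (\<gamma> * \<epsilon>) \<theta> Qh)"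
      unfolding k_def by (simp add: diff_diff_eq)
  qed
  have k: "0 < k" using shrinkage_bounds(1)[OF facts] \<eta> by (simp add: k_def)
  have rest0: "0 \<le> ?rest" using \<gamma> B L4 by (intro rest_risk_nonneg) auto
  have stein: "?st \<in> pred_rules"
    by (rule stein_pred_in_pred_rules[OF \<epsilon>(1) _ refl refl sum_wgb_blocks[OF \<epsilon> L_def L4, symmetric]])
       (use \<gamma> \<epsilon> in auto)
  have MX: "M \<le> X" unfolding M_def X_def by (rule INF_lower[OF stein])
  \<comment> \<open>Finiteness excludes a quotient of infinities; the bound on \<open>phi\<close> by
    a constant gives a crude estimate uniform in \<theta>.\<close>
  have fin: "M < \<top>"
  proof -
    let ?c = "\<Sum>j\<in>{K..<wgb_J \<epsilon> - 1}. real (wgb_blocks \<epsilon> ! j) * (ln ((\<epsilon>\<^sup>2 + (\<gamma> * \<epsilon>)\<^sup>2) / (\<gamma> * \<epsilon>)\<^sup>2) / 2)"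
    have "?main \<theta> \<le> ?c" for \<theta>
      unfolding main_risk_def using \<epsilon> \<gamma> block_energy_nonneg[OF facts]
      by (intro sum_mono mult_left_mono phi_le_const divide_nonneg_nonneg) auto
    then have "X \<le> ennreal (?c + ?rest)"
      unfolding X_def by (intro SUP_least order.trans[OF upper] ennreal_leI add_right_mono)
    with MX show ?thesis using ennreal_less_top by (meson le_less_trans)
  qed
  then obtain r where r: "M = ennreal r" "0 \<le> r" by (cases M) auto
  have "ennreal m \<le> M" unfolding M_def using m(2) by (rule INF_greatest)
  then have mr: "m \<le> r" unfolding r(1) using r(2) by simp
  have r0: "0 < r" using mr m by simp
  show "1 \<le> ratio"
  proof -
    have "1 = M / M" unfolding r(1) using r0 by (simp add: divide_ennreal)
    also have "\<dots> \<le> X / M" by (rule divide_right_mono_ennreal[OF MX])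
    finally show ?thesis by (simp add: ratio)
  qed
  have main: "?main \<theta> \<le> (r + ?C) / k" if "\<theta> \<in> sobolev \<alpha> B" for \<theta>
  proof -
    have "k * ?main \<theta> - ?C \<le> r" using lower[OF that] r(2) unfolding r(1) by simp
    then show ?thesis using k by (simp add: field_simps)
  qed
  have XM: "X \<le> ennreal ((r + ?C) / k + ?rest)"
    unfolding X_def by (intro SUP_least order.trans[OF upper] ennreal_leI add_right_mono main)
  have C0: "0 \<le> ?C" using \<eta> by simp
  have "ratio \<le> ennreal ((r + ?C) / k + ?rest) / M"
    unfolding ratio by (rule divide_right_mono_ennreal[OF XM])
  also have "\<dots> = ennreal (((r + ?C) / k + ?rest) / r)"
  proof -
    have "0 \<le> r + ?C" using r0 C0 by linarith
    then have "0 \<le> (r + ?C) / k + ?rest"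
      by (rule add_nonneg_nonneg[OF divide_nonneg_nonneg[OF _ less_imp_le[OF k]] rest0])
    then show ?thesis unfolding r(1) using r0 by (rule divide_ennreal)
  qed
  also have "((r + ?C) / k + ?rest) / r = 1 / k + (?C / k + ?rest) / r"
    using r0 by (simp add: add_divide_distrib)
  also have "ennreal \<dots> \<le> ennreal (1 / k + (?C / k + ?rest) / m)"
  proof -
    have "0 \<le> ?C / k + ?rest" by (intro add_nonneg_nonneg[OF divide_nonneg_nonneg[OF C0 less_imp_le[OF k]] rest0])
    then show ?thesis using mr m(1) r0 by (intro ennreal_leI add_left_mono divide_left_mono mult_pos_pos)
  qed
  finally show "ratio \<le> ennreal (1 / k + (?C / k + ?rest) / m)" .
qed

text \<open>After multiplying through by \<open>\<epsilon> powr p\<close>, the numerator consists of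
  powers of logarithms times \<open>\<epsilon> powr p\<close> and a tail of order
  \<open>\<epsilon> powr q\<close>. The identity
  \<open>q * (2 * \<alpha> + 1) = 8 * \<alpha>^2\<close> shows \<open>q > 0\<close>: truncation near
  \<open>1 / \<epsilon>^2\<close> is far enough for every positive \<alpha>.\<close>

lemma rest_risk_negligible:
  fixes \<gamma> \<alpha> B c \<phi> :: real and K :: nat
  assumes \<gamma>: "0 < \<gamma>" and \<alpha>: "0 < \<alpha>" and \<phi>: "0 < \<phi>"
  defines "p \<equiv> 2 / (2 * \<alpha> + 1)"
  shows "((\<lambda>\<epsilon>. (c + rest_risk \<gamma> \<alpha> B \<epsilon> (ln (1 / \<epsilon>)) K) / ((\<epsilon> powr (- p) - 1) * \<phi> - 1)) \<longlongrightarrow> 0) (at_right 0)"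
proof -
  have p: "0 < p" using \<alpha> by (simp add: p_def)
  define q where "q = 4 * \<alpha> - 2 + p"
  have q: "0 < q"
  proof -
    have "p * (2 * \<alpha> + 1) = 2" using \<alpha> by (simp add: p_def field_simps)
    then have "q * (2 * \<alpha> + 1) = 8 * \<alpha>\<^sup>2"
      by (simp add: q_def power2_eq_square algebra_simps)
    moreover have "0 < 8 * \<alpha>\<^sup>2" using \<alpha> by simp
    ultimately show ?thesis using \<alpha> by (metis add_pos_pos mult_pos_pos zero_less_mult_pos2 zero_less_numeral zero_less_one)
  qed
  define a where "a = 3 * real K * ln ((1 + \<gamma>\<^sup>2) / \<gamma>\<^sup>2) / 2"
  define b where "b = ln ((1 + \<gamma>\<^sup>2) / \<gamma>\<^sup>2) + ln (1 + B) / 4 + 6"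
  have 1: "((\<lambda>\<epsilon>. (c + a * ln (1 / \<epsilon>) + (2 + 2 * ln (1 / \<epsilon>) + 4 * (ln (1 / \<epsilon>))\<^sup>2) * (b + 5 / 2 * ln (1 / \<epsilon>))) * \<epsilon> powr p)
    \<longlongrightarrow> 0) (at_right 0)"
    using p by real_asymp
  have 2: "((\<lambda>\<epsilon>. B * 3 powr (2 * \<alpha>) / \<gamma>\<^sup>2 * \<epsilon> powr q) \<longlongrightarrow> 0) (at_right 0)"
    using q by real_asymp
  have 3: "((\<lambda>\<epsilon>. \<phi> - \<epsilon> powr p * \<phi> - \<epsilon> powr p) \<longlongrightarrow> \<phi>) (at_right 0)"
    using p by real_asymp
  have "((\<lambda>\<epsilon>. ((c + a * ln (1 / \<epsilon>) + (2 + 2 * ln (1 / \<epsilon>) + 4 * (ln (1 / \<epsilon>))\<^sup>2) * (b + 5 / 2 * ln (1 / \<epsilon>))) * \<epsilon> powr p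
     + B * 3 powr (2 * \<alpha>) / \<gamma>\<^sup>2 * \<epsilon> powr q) / (\<phi> - \<epsilon> powr p * \<phi> - \<epsilon> powr p)) \<longlongrightarrow> (0 + 0) / \<phi>) (at_right 0)"
    using \<phi> by (intro tendsto_divide tendsto_add 1 2 3) auto
  then have lim: "((\<lambda>\<epsilon>. ((c + a * ln (1 / \<epsilon>) + (2 + 2 * ln (1 / \<epsilon>) + 4 * (ln (1 / \<epsilon>))\<^sup>2) * (b + 5 / 2 * ln (1 / \<epsilon>))) * \<epsilon> powr p
     + B * 3 powr (2 * \<alpha>) / \<gamma>\<^sup>2 * \<epsilon> powr q) / (\<phi> - \<epsilon> powr p * \<phi> - \<epsilon> powr p)) \<longlongrightarrow> 0) (at_right 0)" by simp
  have eq: "((c + a * ln (1 / \<epsilon>) + (2 + 2 * ln (1 / \<epsilon>) + 4 * (ln (1 / \<epsilon>))\<^sup>2) * (b + 5 / 2 * ln (1 / \<epsilon>))) * \<epsilon> powr p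
     + B * 3 powr (2 * \<alpha>) / \<gamma>\<^sup>2 * \<epsilon> powr q) / (\<phi> - \<epsilon> powr p * \<phi> - \<epsilon> powr p)
     = (c + rest_risk \<gamma> \<alpha> B \<epsilon> (ln (1 / \<epsilon>)) K) / ((\<epsilon> powr (- p) - 1) * \<phi> - 1)" if \<epsilon>: "0 < \<epsilon>" for \<epsilon>
  proof -
    define L where "L = ln (1 / \<epsilon>)"
    have e0: "\<epsilon> powr p \<noteq> 0" using \<epsilon> by simp
    have inv: "\<epsilon> powr (- p) * \<epsilon> powr p = 1" using \<epsilon> by (simp add: powr_add[symmetric])
    have e2: "\<epsilon>\<^sup>2 = \<epsilon> powr 2" using \<epsilon> by simp
    have e4: "(\<epsilon>\<^sup>2) powr (2 * \<alpha>) = \<epsilon> powr (4 * \<alpha>)" unfolding e2 powr_powr by simp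
    have "(1 / (3 * \<epsilon>\<^sup>2)) powr (- 2 * \<alpha>) = (3 * \<epsilon>\<^sup>2) powr (2 * \<alpha>)"
      using \<epsilon> by (simp add: powr_minus powr_divide)
    also have "\<dots> = 3 powr (2 * \<alpha>) * \<epsilon> powr (4 * \<alpha>)"
      unfolding powr_mult e4 ..
    finally have "(1 / (3 * \<epsilon>\<^sup>2)) powr (- 2 * \<alpha>) / (\<gamma>\<^sup>2 * \<epsilon>\<^sup>2) * \<epsilon> powr p
      = 3 powr (2 * \<alpha>) / \<gamma>\<^sup>2 * (\<epsilon> powr (4 * \<alpha>) / \<epsilon>\<^sup>2 * \<epsilon> powr p)" by simp
    also have "\<epsilon> powr (4 * \<alpha>) / \<epsilon>\<^sup>2 * \<epsilon> powr p = \<epsilon> powr q"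
      unfolding q_def e2 by (simp only: powr_add powr_diff)
    finally have t: "(1 / (3 * \<epsilon>\<^sup>2)) powr (- 2 * \<alpha>) / (\<gamma>\<^sup>2 * \<epsilon>\<^sup>2) * \<epsilon> powr p = 3 powr (2 * \<alpha>) / \<gamma>\<^sup>2 * \<epsilon> powr q" .
    have num: "(c + a * L + (2 + 2 * L + 4 * L\<^sup>2) * (b + 5 / 2 * L)) * \<epsilon> powr p + B * 3 powr (2 * \<alpha>) / \<gamma>\<^sup>2 * \<epsilon> powr q
       = (c + rest_risk \<gamma> \<alpha> B \<epsilon> L K) * \<epsilon> powr p"
    proof -
      define w where "w = (1 / (3 * \<epsilon>\<^sup>2)) powr (- 2 * \<alpha>) / (\<gamma>\<^sup>2 * \<epsilon>\<^sup>2)"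
      have "rest_risk \<gamma> \<alpha> B \<epsilon> L K = a * L + B * w + (2 + 2 * L + 4 * L\<^sup>2) * (b + 5 / 2 * L)"
      proof -
        have "ln ((1 + \<gamma>\<^sup>2) / \<gamma>\<^sup>2) + (ln (1 + B) + 2 * L) / 4 + 6 + 2 * L = b + 5 / 2 * L"
          by (simp add: b_def add_divide_distrib)
        then show ?thesis unfolding rest_risk_def w_def a_def by simp
      qed
      moreover have "B * w * \<epsilon> powr p = B * 3 powr (2 * \<alpha>) / \<gamma>\<^sup>2 * \<epsilon> powr q"
        using arg_cong[OF t[folded w_def], of "(*) B"] by (simp add: mult.assoc)
      ultimately show ?thesis by (simp add: distrib_right)
    qed
    have den: "\<phi> - \<epsilon> powr p * \<phi> - \<epsilon> powr p = ((\<epsilon> powr (- p) - 1) * \<phi> - 1) * \<epsilon> powr p"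
    proof -
      have "((\<epsilon> powr (- p) - 1) * \<phi> - 1) * \<epsilon> powr p = (\<epsilon> powr (- p) * \<epsilon> powr p) * \<phi> - \<epsilon> powr p * \<phi> - \<epsilon> powr p"
        by (simp only: left_diff_distrib mult_1 mult.assoc mult.commute[of \<phi>])
      then show ?thesis unfolding inv by simp
    qed
    show ?thesis unfolding L_def[symmetric] num den using e0 by simp
  qed
  show ?thesis
    by (rule Lim_transform_eventually[OF lim eventually_mono[OF eventually_at_right_less[of 0] eq]])
qed

theorem theorem4p1:
  fixes \<gamma> \<alpha> B :: real
  assumes "\<gamma> > 0" and "\<alpha> > 0" and "B > 0"
  shows "((\<lambda>\<epsilon>. (SUP \<theta>\<in>sobolev \<alpha> B.
              risk \<epsilon> (\<gamma> * \<epsilon>) \<theta> (stein_pred (wgb_d \<epsilon>) (wgb_blocks \<epsilon>) \<epsilon> (\<gamma> * \<epsilon>)))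
           / (INF Qh\<in>pred_rules. SUP \<theta>\<in>sobolev \<alpha> B. risk \<epsilon> (\<gamma> * \<epsilon>) \<theta> Qh))
         \<longlongrightarrow> 1) (at_right 0)"
proof -
  note \<gamma> = assms(1) and \<alpha> = assms(2) and B = assms(3)
  let ?ratio = "\<lambda>\<epsilon>. (SUP \<theta>\<in>sobolev \<alpha> B.
              risk \<epsilon> (\<gamma> * \<epsilon>) \<theta> (stein_pred (wgb_d \<epsilon>) (wgb_blocks \<epsilon>) \<epsilon> (\<gamma> * \<epsilon>)))
           / (INF Qh\<in>pred_rules. SUP \<theta>\<in>sobolev \<alpha> B. risk \<epsilon> (\<gamma> * \<epsilon>) \<theta> Qh)"
  \<comment> \<open>With this exponent \<open>N = \<epsilon> powr (- p)\<close> solves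
    \<open>N powr (2 * \<alpha> + 1) * \<epsilon>^2 = 1\<close>.\<close>
  define p where "p = 2 / (2 * \<alpha> + 1)"
  define \<phi> where "\<phi> = phi 1 (\<gamma>\<^sup>2) (B / 2) / 4"
  \<comment> \<open>The inner 1 allows for rounding \<open>\<epsilon> powr (- p)\<close> down to a
    natural number, the outer one is the loss in \<open>minimax_growth\<close>.\<close>
  define m where "m \<epsilon> = (\<epsilon> powr (- p) - 1) * \<phi> - 1" for \<epsilon>
  have p: "0 < p" using \<alpha> by (simp add: p_def)
  have \<phi>: "0 < \<phi>" using \<gamma> B by (simp add: \<phi>_def phi_pos)
  have growth: "ennreal (m \<epsilon>) \<le> (SUP \<theta>\<in>sobolev \<alpha> B. risk \<epsilon> (\<gamma> * \<epsilon>) \<theta> Qh)"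
    if \<epsilon>: "0 < \<epsilon>" "17 \<le> \<epsilon> powr (- p)" and Qh: "Qh \<in> pred_rules" for \<epsilon> Qh
  proof -
    define N where "N = nat \<lfloor>\<epsilon> powr (- p)\<rfloor>"
    have N: "real N \<le> \<epsilon> powr (- p)" "\<epsilon> powr (- p) - 1 \<le> real N" "16 \<le> N"
      using \<epsilon>(2) unfolding N_def by linarith+
    have "real N powr (2 * \<alpha> + 1) * \<epsilon>\<^sup>2 \<le> (\<epsilon> powr (- p)) powr (2 * \<alpha> + 1) * \<epsilon>\<^sup>2"
      using N(1) \<alpha> by (intro mult_right_mono powr_mono2) auto
    also have "(\<epsilon> powr (- p)) powr (2 * \<alpha> + 1) = \<epsilon> powr (- 2)"
    proof -
      have "- p * (2 * \<alpha> + 1) = - 2" using \<alpha> by (simp add: p_def field_simps)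
      then show ?thesis by (simp only: powr_powr)
    qed
    also have "\<epsilon> powr (- 2) * \<epsilon>\<^sup>2 = 1"
      using \<epsilon> by (simp add: powr_minus powr_numeral)
    finally have "ennreal (real N * phi 1 (\<gamma>\<^sup>2) (B / 2) / 4 - 1) \<le> (SUP \<theta>\<in>sobolev \<alpha> B. risk \<epsilon> (\<gamma> * \<epsilon>) \<theta> Qh)"
      by (rule minimax_growth[OF \<gamma> \<alpha> B \<epsilon>(1) N(3) _ Qh])
    moreover have "m \<epsilon> \<le> real N * phi 1 (\<gamma>\<^sup>2) (B / 2) / 4 - 1"
      using mult_right_mono[OF N(2) less_imp_le[OF \<phi>]] by (simp add: m_def \<phi>_def)
    ultimately show ?thesis by (meson ennreal_leI order.trans)
  qed
  have ev: "\<forall>\<^sub>F \<epsilon> in at_right 0. 1 \<le> ?ratio \<epsilon> \<and> ?ratio \<epsilon> < a"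
    if a: "1 < a" for a :: ennreal
  proof -
    obtain a' where a': "1 < a'" "ennreal a' < a"
    proof -
      obtain z where z: "1 < z" "z < a" using dense[OF a] by blast
      then obtain a' where "z = ennreal a'" "0 \<le> a'" by (cases z) auto
      with z that[of a'] show ?thesis by auto
    qed
    \<comment> \<open>The limit of \<open>1 / k\<close> for slack \<open>\<eta> = 1 / K\<close>:
      some fixed \<open>K\<close> brings it below \<open>a'\<close>, and only then does \<epsilon>
      tend to 0. Taking \<open>K\<close> at least 3 ensures \<open>\<eta> < 1 / 2\<close>.\<close>
    have "((\<lambda>n. 1 / ((1 - 1 / real n) / (1 + 2 / real n) powr (2 * \<alpha>) * (1 - 2 * (1 / real n)))) \<longlongrightarrow> 1) sequentially"
      by real_asymp
    then have "\<forall>\<^sub>F n in sequentially. 1 / ((1 - 1 / real n) / (1 + 2 / real n) powr (2 * \<alpha>) * (1 - 2 * (1 / real n))) < a'"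
      using a'(1) by (rule order_tendstoD)
    then have "\<forall>\<^sub>F n in sequentially. 3 \<le> n \<and> 1 / ((1 - 1 / real n) / (1 + 2 / real n) powr (2 * \<alpha>) * (1 - 2 * (1 / real n))) < a'"
      by (intro eventually_conj eventually_ge_at_top)
    then obtain K where K: "3 \<le> K"
      and Ka: "1 / ((1 - 1 / real K) / (1 + 2 / real K) powr (2 * \<alpha>) * (1 - 2 * (1 / real K))) < a'"
      unfolding eventually_sequentially by auto
    define \<eta> where "\<eta> = 1 / real K"
    have \<eta>: "0 < \<eta>" "\<eta> < 1 / 2" using K by (auto simp: \<eta>_def field_simps)
    define k where "k = shrinkage \<alpha> \<eta> K * (1 - 2 * \<eta>)"
    have ka: "1 / k < a'" using Ka by (simp only: k_def shrinkage_def \<eta>_def)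
    let ?bound = "\<lambda>\<epsilon>. 1 / k + ((1 + 1 / (4 * \<eta>)) / k + rest_risk \<gamma> \<alpha> B \<epsilon> (ln (1 / \<epsilon>)) K) / m \<epsilon>"
    have "(?bound \<longlongrightarrow> 1 / k + 0) (at_right 0)"
      unfolding m_def p_def by (intro tendsto_add tendsto_const rest_risk_negligible \<gamma> \<alpha> \<phi>)
    then have b: "\<forall>\<^sub>F \<epsilon> in at_right 0. ?bound \<epsilon> < a'"
      by (rule order_tendstoD) (use ka in simp)
    have LL: "filterlim (\<lambda>\<epsilon>::real. ln (1 / \<epsilon>)) at_top (at_right 0)" by real_asymp
    have e1: "\<forall>\<^sub>F \<epsilon> in at_right (0::real). \<epsilon> < 1" by real_asymp
    have e2: "\<forall>\<^sub>F \<epsilon> in at_right (0::real). 4 \<le> ln (1 / \<epsilon>)" by real_asymp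
    have e3: "\<forall>\<^sub>F \<epsilon> in at_right (0::real). (1 + 1 / ln (1 / \<epsilon>)) ^ K < 3 / 2"
    proof (rule order_tendstoD)
      have "((\<lambda>\<epsilon>. 1 + 1 / ln (1 / \<epsilon>)) \<longlongrightarrow> 1) (at_right (0::real))" by real_asymp
      from tendsto_power[OF this, of K] show "((\<lambda>\<epsilon>. (1 + 1 / ln (1 / \<epsilon>)) ^ K) \<longlongrightarrow> 1) (at_right (0::real))" by simp
    qed simp
    have e4: "\<forall>\<^sub>F \<epsilon> in at_right (0::real). 3 * real K * ln (1 / \<epsilon>) \<le> 1 / \<epsilon>\<^sup>2 - 1"
      using K by real_asymp
    \<comment> \<open>This is the condition \<open>2 / (\<eta>^2 * L) \<le> \<eta>\<close> of the
      lower bound, solved for \<open>L\<close>.\<close>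
    have e5: "\<forall>\<^sub>F \<epsilon> in at_right (0::real). 2 / \<eta> ^ 3 \<le> ln (1 / \<epsilon>)"
      using LL unfolding filterlim_at_top by blast
    have mlim: "filterlim (\<lambda>\<epsilon>. \<epsilon> powr (- p)) at_top (at_right 0)" using p by real_asymp
    \<comment> \<open>The 17 leaves at least 16 coordinates after rounding; the summand
      \<open>2 / \<phi>\<close> makes \<open>m \<epsilon>\<close> positive.\<close>
    have e6: "\<forall>\<^sub>F \<epsilon> in at_right (0::real). 17 + 2 / \<phi> \<le> \<epsilon> powr (- p)"
      using mlim unfolding filterlim_at_top by blast
    show ?thesis
      using eventually_at_right_less[of "0::real"] e1 e2 e3 e4 e5 e6 b
    proof eventually_elim
      fix \<epsilon> :: real
      assume h: "0 < \<epsilon>" "\<epsilon> < 1" "4 \<le> ln (1 / \<epsilon>)" "(1 + 1 / ln (1 / \<epsilon>)) ^ K < 3 / 2"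
        "3 * real K * ln (1 / \<epsilon>) \<le> 1 / \<epsilon>\<^sup>2 - 1" "2 / \<eta> ^ 3 \<le> ln (1 / \<epsilon>)" "17 + 2 / \<phi> \<le> \<epsilon> powr (- p)" "?bound \<epsilon> < a'"
      have K1: "1 \<le> K" using K by simp
      have \<eta>L: "2 / (\<eta>\<^sup>2 * ln (1 / \<epsilon>)) \<le> \<eta>"
      proof -
        have "2 \<le> \<eta> ^ 3 * ln (1 / \<epsilon>)" using h(6) \<eta> by (simp add: divide_le_eq mult.commute)
        then have "2 \<le> \<eta> * (\<eta>\<^sup>2 * ln (1 / \<epsilon>))" by (simp add: power3_eq_cube power2_eq_square mult.assoc)
        moreover have "0 < \<eta>\<^sup>2 * ln (1 / \<epsilon>)" using \<eta> h(3) by (intro mult_pos_pos) auto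
        ultimately show ?thesis by (simp add: divide_le_eq)
      qed
      have "0 < 2 / \<phi>" using \<phi> by simp
      then have e17: "17 \<le> \<epsilon> powr (- p)" and ge: "2 / \<phi> \<le> \<epsilon> powr (- p) - 1" using h(7) by linarith+
      have "2 / \<phi> * \<phi> \<le> (\<epsilon> powr (- p) - 1) * \<phi>" using ge \<phi> by (intro mult_right_mono) auto
      then have m0: "0 < m \<epsilon>" using \<phi> by (simp add: m_def)
      note R = ratio_bounds[OF \<gamma> \<alpha> B h(1,2) refl h(3) K1 less_imp_le[OF h(4)] h(5) \<eta> \<eta>L m0 growth[OF h(1) e17]]
      have "?ratio \<epsilon> \<le> ennreal (?bound \<epsilon>)" unfolding k_def by (rule R(2))
      also have "\<dots> \<le> ennreal a'" using h(8) by (intro ennreal_leI) simp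
      also have "\<dots> < a" by (rule a')
      finally show "1 \<le> ?ratio \<epsilon> \<and> ?ratio \<epsilon> < a" using R(1) by blast
    qed
  qed
  show ?thesis
  proof (rule order_tendstoI)
    \<comment> \<open>The bound \<open>1 \<le> ?ratio \<epsilon>\<close> is contained in
      \<open>ev\<close> for every admissible upper level, for instance 2.\<close>
    fix a :: ennreal assume "a < 1"
    then show "\<forall>\<^sub>F \<epsilon> in at_right 0. a < ?ratio \<epsilon>"
      using ev[of 2] by (auto elim!: eventually_mono intro: less_le_trans)
  next
    fix a :: ennreal assume "1 < a"
    then show "\<forall>\<^sub>F \<epsilon> in at_right 0. ?ratio \<epsilon> < a"
      using ev[of a] by (auto elim!: eventually_mono)
  qed
qed

end
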